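(* Let $Q$ be a connected quiver with vertex set $I$ and let $J\subset I$. If $J\neq\emptyset$ then the partial preprojective algebra $\Pi_{Q,J}$ is RCI.
   Context: Ground field $\mathbb C$. $Q$ is a finite quiver with finite vertex set $I$; its double $\overline Q$ has for each edge $a$ of $Q$ a pair of oppositely oriented edges $a,a^*$. Let $R=\mathbb C^I$ with standard idempotents $e_i$, $V$ the $R$-bimodule with basis the edges of $\overline Q$, all in degree $1$, and $F=T_RV$ the path algebra of $\overline Q$. For $J\subset I$ let $p_J=\sum_{i\in J}e_i$ and $$\Pi_{Q,J}=F\Big/\Big((1-p_J)\sum_{a\in Q}[a,a^*]\,(1-p_J)\Big).$$ So $\Pi_{Q,J}=T_RV/(L)$, where $L\subset V\otimes_RV$ is the $R$-subbimodule generated by $(1-p_J)\sum_{a\in Q}[a,a^*](1-p_J)$, in degree $2$. RCI: for $\mathbf d=(d_i)\in\mathbb Z_{\ge0}^I$ let $\mathbf E_{\mathbf d}=\mathrm{End}_{\mathbb C}(\bigoplus_i\mathbb C^{d_i})$ with the natural algebra map $R\to\mathbf E_{\mathbf d}$; $\mathrm{Rep}_{\mathbf d}A$ is the affine scheme of algebra maps $A\to\mathbf E_{\mathbf d}$ restricting to this map on $R$; $\mathbb M_{\mathbf d}=\mathrm{Hom}_{R\text{-bimod}}(M,\mathbf E_{\mathbf d})$ for an $R$-bimodule $M$. Put $L^\circ=L\cap[F,F]$, with $[F,F]$ the linear span of commutators. $A=T_RV/(L)$ is RCI (representation complete intersection) if for any integer $N$ there is $\mathbf d$ with all $d_i>N$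 such that $\dim\mathrm{Rep}_{\mathbf d}A=\dim\mathbb V_{\mathbf d}-\dim\mathbb L_{\mathbf d}+\dim L^\circ$. *)

theory Defs
  imports
    "Graph_Theory.Digraph_Component"
    "Graph_Theory.Arc_Walk"
    "HOL-Algebra.QuotRing"
    "HOL-Library.Poly_Mapping"
    "HOL-Library.Function_Algebras"
    "HOL-Library.Extended_Real"
    Complex_Main
begin

section \<open>Complex vector spaces and their dimensions\<close>

definition pscale :: "complex \<Rightarrow> ('x \<Rightarrow>\<^sub>0 complex) \<Rightarrow> ('x \<Rightarrow>\<^sub>0 complex)" where
  "pscale c f = Poly_Mapping.map ((*) c) f"

definition hscale ::
  "complex \<Rightarrow> ('x \<Rightarrow> 'n \<Rightarrow> 'n \<Rightarrow> complex) \<Rightarrow> ('x \<Rightarrow> 'n \<Rightarrow> 'n \<Rightarrow> complex)" where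
  "hscale c \<phi> = (\<lambda>x p q. c * \<phi> x p q)"

lemma lookup_pscale [simp]: "Poly_Mapping.lookup (pscale c f) x = c * Poly_Mapping.lookup f x"
  by (simp add: pscale_def Poly_Mapping.map.rep_eq when_def)

global_interpretation pvs: vector_space "pscale :: complex \<Rightarrow> ('x \<Rightarrow>\<^sub>0 complex) \<Rightarrow> _"
  defines pspan = pvs.span and pdim = pvs.dim
  by unfold_locales (auto intro!: poly_mapping_eqI simp: lookup_add algebra_simps)

global_interpretation hvs:
  vector_space "hscale :: complex \<Rightarrow> ('x \<Rightarrow> 'n \<Rightarrow> 'n \<Rightarrow> complex) \<Rightarrow> _"
  defines hdim = hvs.dim
  by unfold_locales (auto simp: hscale_def fun_eq_iff algebra_simps)


section \<open>Path algebras\<close>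

text \<open>
  A quiver is a finite directed multigraph (\<^locale>\<open>fin_digraph\<close>). A path is a triple
  \<open>(u, p, v)\<close> with \<open>p\<close> an arc walk from \<open>u\<close> to \<open>v\<close>. Paths are multiplied from left to right, so
  an edge \<open>a\<close> from \<open>i\<close> to \<open>j\<close> satisfies \<open>a = e\<^sub>i a e\<^sub>j\<close>. The opposite convention amounts to
  replacing the quiver by the opposite one.
\<close>

type_synonym ('v, 'e) path = "'v \<times> 'e list \<times> 'v"

definition paths :: "('v, 'e) pre_digraph \<Rightarrow> ('v, 'e) path set" where
  "paths G = {(u, p, v). pre_digraph.awalk G u p v}"

definition path_single_mult ::
  "('v, 'e) path \<Rightarrow> ('v, 'e) path \<Rightarrow> complex \<Rightarrow> ('v, 'e) path \<Rightarrow>\<^sub>0 complex" where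
  "path_single_mult x y c = (case (x, y) of ((u, p, v), (v', q, w)) \<Rightarrow>
     if v = v' then Poly_Mapping.single (u, p @ q, w) c else 0)"

definition path_mult ::
  "(('v, 'e) path \<Rightarrow>\<^sub>0 complex) \<Rightarrow> (('v, 'e) path \<Rightarrow>\<^sub>0 complex) \<Rightarrow> (('v, 'e) path \<Rightarrow>\<^sub>0 complex)" where
  "path_mult f g = (\<Sum>x\<in>Poly_Mapping.keys f. \<Sum>y\<in>Poly_Mapping.keys g.
     path_single_mult x y (Poly_Mapping.lookup f x * Poly_Mapping.lookup g y))"

definition vertex_idem :: "'v \<Rightarrow> ('v, 'e) path \<Rightarrow>\<^sub>0 complex" where
  "vertex_idem i = Poly_Mapping.single (i, [], i) 1"

definition arc_elt :: "('v, 'e) pre_digraph \<Rightarrow> 'e \<Rightarrow> ('v, 'e) path \<Rightarrow>\<^sub>0 complex" where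
  "arc_elt G a = Poly_Mapping.single (tail G a, [a], head G a) 1"

text \<open>
  The structure map from \<open>R = \<complex>\<^sup>I\<close>, \<open>I\<close> the vertex set, to the path algebra. Elements of \<open>R\<close> are
  represented by functions on the vertex type, of which only the values on \<open>I\<close> matter.
\<close>

definition R_to_F :: "('v, 'e) pre_digraph \<Rightarrow> ('v \<Rightarrow> complex) \<Rightarrow> ('v, 'e) path \<Rightarrow>\<^sub>0 complex" where
  "R_to_F G r = (\<Sum>i\<in>verts G. pscale (r i) (vertex_idem i))"

definition path_algebra :: "('v, 'e) pre_digraph \<Rightarrow> (('v, 'e) path \<Rightarrow>\<^sub>0 complex) ring" where
  "path_algebra G =
     \<lparr>carrier = {f. Poly_Mapping.keys f \<subseteq> paths G},
      monoid.mult = path_mult,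
      one = R_to_F G (\<lambda>_. 1),
      ring.zero = 0,
      add = (+)\<rparr>"

definition arc_space :: "('v, 'e) pre_digraph \<Rightarrow> (('v, 'e) path \<Rightarrow>\<^sub>0 complex) set" where
  "arc_space G = pspan (arc_elt G ` arcs G)"

definition sub_bimodule_gen ::
  "('v, 'e) pre_digraph \<Rightarrow> (('v, 'e) path \<Rightarrow>\<^sub>0 complex) \<Rightarrow> (('v, 'e) path \<Rightarrow>\<^sub>0 complex) set" where
  "sub_bimodule_gen G w = pspan {path_mult (path_mult (R_to_F G r) w) (R_to_F G s) | r s. True}"

definition path_commutator ::
  "(('v, 'e) path \<Rightarrow>\<^sub>0 complex) \<Rightarrow> (('v, 'e) path \<Rightarrow>\<^sub>0 complex) \<Rightarrow> (('v, 'e) path \<Rightarrow>\<^sub>0 complex)" where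
  "path_commutator x y = path_mult x y - path_mult y x"

definition commutator_space :: "('v, 'e) pre_digraph \<Rightarrow> (('v, 'e) path \<Rightarrow>\<^sub>0 complex) set" where
  "commutator_space G = pspan {path_commutator x y | x y.
     x \<in> carrier (path_algebra G) \<and> y \<in> carrier (path_algebra G)}"

lemma keys_uminus: "Poly_Mapping.keys (- f) = Poly_Mapping.keys (f :: 'a \<Rightarrow>\<^sub>0 'b::ab_group_add)"
  by (auto simp: in_keys_iff)

lemma poly_mapping_expand:
  "(\<Sum>x\<in>Poly_Mapping.keys f. Poly_Mapping.single x (Poly_Mapping.lookup f x)) = f"
proof (rule poly_mapping_eqI)
  fix k
  have "Poly_Mapping.lookup (\<Sum>x\<in>Poly_Mapping.keys f. Poly_Mapping.single x (Poly_Mapping.lookup f x)) k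
      = (\<Sum>x\<in>Poly_Mapping.keys f. if x = k then Poly_Mapping.lookup f x else 0)"
    unfolding lookup_sum lookup_single when_def by (rule refl)
  also have "\<dots> = (if k \<in> Poly_Mapping.keys f then Poly_Mapping.lookup f k else 0)"
    by (rule sum.delta) (rule finite_keys)
  also have "\<dots> = Poly_Mapping.lookup f k"
    by (simp add: in_keys_iff)
  finally show "Poly_Mapping.lookup (\<Sum>x\<in>Poly_Mapping.keys f. Poly_Mapping.single x (Poly_Mapping.lookup f x)) k
      = Poly_Mapping.lookup f k" .
qed

lemma poly_mapping_add_induct [case_names single add]:
  assumes single: "\<And>x c. P (Poly_Mapping.single x c)"
    and add: "\<And>f g. P f \<Longrightarrow> P g \<Longrightarrow> P (f + g)"
  shows "P (f :: 'a \<Rightarrow>\<^sub>0 'b::comm_monoid_add)"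
proof -
  have zero: "P 0" using single[of undefined 0] by simp
  have "P (\<Sum>x\<in>S. Poly_Mapping.single x (Poly_Mapping.lookup f x))" for S
  proof (induction S rule: infinite_finite_induct)
    case (insert x S)
    have "P (Poly_Mapping.single x (Poly_Mapping.lookup f x) +
        (\<Sum>x\<in>S. Poly_Mapping.single x (Poly_Mapping.lookup f x)))"
      by (rule add[OF single insert.IH])
    then show ?case using insert.hyps by simp
  qed (simp_all add: zero)
  from this[of "Poly_Mapping.keys f"] show ?thesis by (simp only: poly_mapping_expand)
qed

lemma path_mult_superset:
  assumes "finite S" "finite T" "Poly_Mapping.keys f \<subseteq> S" "Poly_Mapping.keys g \<subseteq> T"
  shows "path_mult f g = (\<Sum>x\<in>S. \<Sum>y\<in>T.
    path_single_mult x y (Poly_Mapping.lookup f x * Poly_Mapping.lookup g y))"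
proof -
  have z: "path_single_mult x y 0 = 0" for x y :: "('v, 'e) path"
    by (auto simp: path_single_mult_def split: prod.split)
  have "path_mult f g = (\<Sum>x\<in>Poly_Mapping.keys f. \<Sum>y\<in>T.
    path_single_mult x y (Poly_Mapping.lookup f x * Poly_Mapping.lookup g y))"
    unfolding path_mult_def
    by (intro sum.cong refl sum.mono_neutral_left) (use assms in \<open>auto simp: z in_keys_iff\<close>)
  also have "\<dots> = (\<Sum>x\<in>S. \<Sum>y\<in>T.
    path_single_mult x y (Poly_Mapping.lookup f x * Poly_Mapping.lookup g y))"
    by (intro sum.mono_neutral_left) (use assms in \<open>auto simp: z in_keys_iff\<close>)
  finally show ?thesis .
qed

lemma path_single_mult_add:
  "path_single_mult x y (c + d) = path_single_mult x y c + path_single_mult x y d"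
  by (auto simp: path_single_mult_def single_add split: prod.split)

lemma path_mult_add_left: "path_mult (f + f') g = path_mult f g + path_mult f' g"
proof -
  let ?S = "Poly_Mapping.keys f \<union> Poly_Mapping.keys f'" and ?T = "Poly_Mapping.keys g"
  show ?thesis
    by (subst (1 2 3) path_mult_superset[of ?S ?T])
       (use Poly_Mapping.keys_add[of f f'] in
         \<open>auto simp: lookup_add distrib_right path_single_mult_add sum.distrib\<close>)
qed

lemma path_mult_add_right: "path_mult g (f + f') = path_mult g f + path_mult g f'"
proof -
  let ?S = "Poly_Mapping.keys f \<union> Poly_Mapping.keys f'" and ?T = "Poly_Mapping.keys g"
  show ?thesis
    by (subst (1 2 3) path_mult_superset[of ?T ?S])
       (use Poly_Mapping.keys_add[of f f'] in
         \<open>auto simp: lookup_add distrib_left path_single_mult_add sum.distrib\<close>)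
qed

lemma path_mult_0 [simp]: "path_mult 0 g = 0" "path_mult g 0 = 0"
  by (auto simp: path_mult_def)

lemma path_mult_single:
  "path_mult (Poly_Mapping.single x a) (Poly_Mapping.single y b) = path_single_mult x y (a * b)"
  by (subst path_mult_superset[of "{x}" "{y}"]) auto

lemma path_mult_sum_left: "path_mult (sum f S) g = (\<Sum>i\<in>S. path_mult (f i) g)"
  by (induction S rule: infinite_finite_induct) (auto simp: path_mult_add_left)

lemma path_mult_sum_right: "path_mult g (sum f S) = (\<Sum>i\<in>S. path_mult g (f i))"
  by (induction S rule: infinite_finite_induct) (auto simp: path_mult_add_right)

lemma path_mult_assoc: "path_mult (path_mult f g) h = path_mult f (path_mult g h)"
proof (induction f rule: poly_mapping_add_induct)
  case (single x a)
  show ?case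
  proof (induction g rule: poly_mapping_add_induct)
    case (single y b)
    show ?case
    proof (induction h rule: poly_mapping_add_induct)
      case (single z c)
      show ?case
        by (cases x; cases y; cases z)
           (auto simp: path_mult_single path_single_mult_def mult.assoc)
    qed (simp add: path_mult_add_right)
  qed (simp add: path_mult_add_right path_mult_add_left)
qed (simp add: path_mult_add_left)

lemma path_mult_keys:
  assumes "wf_digraph G" "Poly_Mapping.keys f \<subseteq> paths G" "Poly_Mapping.keys g \<subseteq> paths G"
  shows "Poly_Mapping.keys (path_mult f g) \<subseteq> paths G"
proof -
  interpret wf_digraph G by fact
  have *: "Poly_Mapping.keys (path_single_mult x y c) \<subseteq> paths G"
    if "x \<in> paths G" "y \<in> paths G" for x y c
    using that by (auto simp: path_single_mult_def paths_def split: prod.split intro: awalk_appendI)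
  have sum: "Poly_Mapping.keys (sum F S) \<subseteq> paths G"
    if "\<And>x. x \<in> S \<Longrightarrow> Poly_Mapping.keys (F x) \<subseteq> paths G"
    for F :: "_ \<Rightarrow> ('a, 'b) path \<Rightarrow>\<^sub>0 complex" and S
    using that Poly_Mapping.keys_sum[of F S] by blast
  show ?thesis
    unfolding path_mult_def by (intro sum *) (use assms in auto)
qed

lemma R_to_F_carrier: "fin_digraph G \<Longrightarrow> R_to_F G r \<in> carrier (path_algebra G)"
proof -
  assume "fin_digraph G"
  then interpret fin_digraph G .
  have "Poly_Mapping.keys (pscale (r i) (vertex_idem i)) \<subseteq> paths G" if "i \<in> verts G" for i
    using that by (auto simp: vertex_idem_def in_keys_iff lookup_single when_def paths_def
        awalk_def split: if_splits)
  then show ?thesis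
    using Poly_Mapping.keys_sum[of "\<lambda>i. pscale (r i) (vertex_idem i)" "verts G"]
    by (fastforce simp: path_algebra_def R_to_F_def)
qed

lemma R_to_F_mult_single:
  assumes "fin_digraph G" "(u, p, v) \<in> paths G"
  shows "path_mult (R_to_F G r) (Poly_Mapping.single (u, p, v) c) = Poly_Mapping.single (u, p, v) (r u * c)"
    and "path_mult (Poly_Mapping.single (u, p, v) c) (R_to_F G r) = Poly_Mapping.single (u, p, v) (c * r v)"
proof -
  interpret fin_digraph G by fact
  have uv: "u \<in> verts G" "v \<in> verts G" using assms(2) by (auto simp: paths_def)
  have ps: "pscale (r i) (vertex_idem i) = (Poly_Mapping.single (i, [], i) (r i) :: ('a,'b) path \<Rightarrow>\<^sub>0 complex)" for i
    by (auto intro!: poly_mapping_eqI simp: vertex_idem_def lookup_single when_def)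
  show "path_mult (R_to_F G r) (Poly_Mapping.single (u, p, v) c) = Poly_Mapping.single (u, p, v) (r u * c)"
    by (simp add: R_to_F_def path_mult_sum_left ps path_mult_single path_single_mult_def
        sum.delta uv cong: if_cong)
  show "path_mult (Poly_Mapping.single (u, p, v) c) (R_to_F G r) = Poly_Mapping.single (u, p, v) (c * r v)"
    by (simp add: R_to_F_def path_mult_sum_right ps path_mult_single path_single_mult_def
        sum.delta' uv cong: if_cong)
qed

lemma R_to_F_one:
  assumes "fin_digraph G" "Poly_Mapping.keys f \<subseteq> paths G"
  shows "path_mult (R_to_F G (\<lambda>_. 1)) f = f" "path_mult f (R_to_F G (\<lambda>_. 1)) = f"
proof -
  have f: "f = (\<Sum>x\<in>Poly_Mapping.keys f. Poly_Mapping.single x (Poly_Mapping.lookup f x))"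
    by (simp add: poly_mapping_expand)
  have 1: "path_mult (R_to_F G (\<lambda>_. 1)) (Poly_Mapping.single x c) = Poly_Mapping.single x c"
          "path_mult (Poly_Mapping.single x c) (R_to_F G (\<lambda>_. 1)) = Poly_Mapping.single x c"
    if "x \<in> paths G" for x c
    using R_to_F_mult_single[OF assms(1), where u = "fst x" and p = "fst (snd x)" and v = "snd (snd x)" and r = "\<lambda>_. 1" and c = c] that
    by auto
  show "path_mult (R_to_F G (\<lambda>_. 1)) f = f"
    by (subst (1 2) f, subst path_mult_sum_right, intro sum.cong) (use assms 1 in auto)
  show "path_mult f (R_to_F G (\<lambda>_. 1)) = f"
    by (subst (1 2) f, subst path_mult_sum_left, intro sum.cong) (use assms 1 in auto)
qed

lemma path_algebra_ring:
  assumes "fin_digraph G"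
  shows "Ring.ring (path_algebra G)"
proof -
  interpret fin_digraph G by fact
  have neg: "Poly_Mapping.keys (- f) \<subseteq> paths G" if "Poly_Mapping.keys f \<subseteq> paths G"
    for f :: "('a, 'b) path \<Rightarrow>\<^sub>0 complex"
    using that by (simp add: keys_uminus)
  show ?thesis
  proof (rule ringI)
    have add: "f + g \<in> carrier (path_algebra G)"
      if "f \<in> carrier (path_algebra G)" "g \<in> carrier (path_algebra G)" for f g
      using that Poly_Mapping.keys_add[of f g] by (force simp: path_algebra_def)
    show "abelian_group (path_algebra G)"
    proof (rule abelian_groupI)
      fix x assume "x \<in> carrier (path_algebra G)"
      then show "\<exists>y\<in>carrier (path_algebra G). y \<oplus>\<^bsub>path_algebra G\<^esub> x = \<zero>\<^bsub>path_algebra G\<^esub>"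
        by (intro bexI[of _ "- x"]) (auto simp: path_algebra_def keys_uminus)
    qed (use add in \<open>auto simp: path_algebra_def algebra_simps\<close>)
    show "Group.monoid (path_algebra G)"
    proof (rule Group.monoidI)
      show "\<one>\<^bsub>path_algebra G\<^esub> \<in> carrier (path_algebra G)"
        using R_to_F_carrier[OF assms, of "\<lambda>_. 1"] by (simp add: path_algebra_def)
    qed (use path_mult_keys[OF wf_digraph] R_to_F_one[OF assms] in
          \<open>auto simp: path_algebra_def path_mult_assoc\<close>)
  qed (auto simp: path_algebra_def path_mult_add_left path_mult_add_right)
qed

lemma genideal_sub_bimodule_gen:
  assumes G: "fin_digraph G" and w: "w \<in> carrier (path_algebra G)"
  shows "genideal (path_algebra G) (sub_bimodule_gen G w) = genideal (path_algebra G) {w}"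
proof -
  have "sub_bimodule_gen G w \<subseteq> I \<longleftrightarrow> w \<in> I" if I: "ideal I (path_algebra G)" for I
  proof
    interpret ideal I "path_algebra G" by fact
    have "w = path_mult (path_mult (R_to_F G (\<lambda>_. 1)) w) (R_to_F G (\<lambda>_. 1))"
      using w by (simp add: R_to_F_one[OF G] path_algebra_def)
    then have "w \<in> sub_bimodule_gen G w"
      unfolding sub_bimodule_gen_def by (blast intro: pvs.span_base)
    then show "w \<in> I" if "sub_bimodule_gen G w \<subseteq> I" using that by blast
    assume wI: "w \<in> I"
    have scale: "pscale c x \<in> I" if "x \<in> I" for c x
    proof -
      have x: "Poly_Mapping.keys x \<subseteq> paths G" using a_subset that by (auto simp: path_algebra_def)
      have f: "x = (\<Sum>y\<in>Poly_Mapping.keys x. Poly_Mapping.single y (Poly_Mapping.lookup x y))"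
        by (simp add: poly_mapping_expand)
      have "path_mult (R_to_F G (\<lambda>_. c)) x =
          (\<Sum>y\<in>Poly_Mapping.keys x. pscale c (Poly_Mapping.single y (Poly_Mapping.lookup x y)))"
      proof (subst (1) f, subst path_mult_sum_right, intro sum.cong refl)
        fix y assume "y \<in> Poly_Mapping.keys x"
        then show "path_mult (R_to_F G (\<lambda>_. c)) (Poly_Mapping.single y (Poly_Mapping.lookup x y)) =
          pscale c (Poly_Mapping.single y (Poly_Mapping.lookup x y))"
          using x R_to_F_mult_single(1)[OF G, where u = "fst y" and p = "fst (snd y)" and v = "snd (snd y)" and r = "\<lambda>_. c"]
          by (auto intro!: poly_mapping_eqI simp: lookup_single when_def)
      qed
      also have "\<dots> = pscale c x"
        by (metis f pvs.scale_sum_right)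
      finally show ?thesis
        using I_l_closed[OF that R_to_F_carrier[OF G, of "\<lambda>_. c"]] by (simp add: path_algebra_def)
    qed
    have "pvs.subspace I"
      using scale additive_subgroup.zero_closed[OF is_additive_subgroup] additive_subgroup.a_closed[OF is_additive_subgroup]
      by (auto simp: pvs.subspace_def path_algebra_def)
    moreover have "path_mult (path_mult (R_to_F G r) w) (R_to_F G s) \<in> I" for r s
      using I_r_closed[OF I_l_closed[OF wI R_to_F_carrier[OF G, of r]] R_to_F_carrier[OF G, of s]]
      by (simp add: path_algebra_def)
    ultimately show "sub_bimodule_gen G w \<subseteq> I"
      unfolding sub_bimodule_gen_def by (intro pvs.span_minimal) auto
  qed
  then show ?thesis unfolding genideal_def by auto
qed


section \<open>Krull dimension\<close>

text \<open>The supremum is taken in the extended reals, so the zero ring has dimension \<open>-\<infinity>\<close>.\<close>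

definition krull_dim :: "('a, 'm) ring_scheme \<Rightarrow> ereal" where
  "krull_dim B = Sup {ereal (real n) | n. \<exists>P :: nat \<Rightarrow> 'a set.
     (\<forall>k\<le>n. primeideal (P k) B) \<and> (\<forall>k<n. P k \<subset> P (Suc k))}"


section \<open>Matrices over the base ring or over a polynomial ring\<close>

text \<open>
  \<open>E\<^sub>d = End(\<Oplus>\<^sub>i \<complex>\<^bsup>d\<^sub>i\<^esup>)\<close> is the algebra of matrices with rows and columns indexed by
  \<open>block_index I d\<close>; \<open>(i, k)\<close> stands for the \<open>k\<close>-th basis vector of the \<open>i\<close>-th summand.
\<close>

definition block_index :: "'v set \<Rightarrow> ('v \<Rightarrow> nat) \<Rightarrow> ('v \<times> nat) set" where
  "block_index I d = (SIGMA i:I. {..<d i})"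

definition mats :: "'n set \<Rightarrow> ('n \<Rightarrow> 'n \<Rightarrow> 'b::zero) set" where
  "mats S = {M. \<forall>p q. p \<notin> S \<or> q \<notin> S \<longrightarrow> M p q = 0}"

definition mat_mult ::
  "'n set \<Rightarrow> ('n \<Rightarrow> 'n \<Rightarrow> 'b::semiring_0) \<Rightarrow> ('n \<Rightarrow> 'n \<Rightarrow> 'b) \<Rightarrow> ('n \<Rightarrow> 'n \<Rightarrow> 'b)" where
  "mat_mult S M N = (\<lambda>p q. \<Sum>k\<in>S. M p k * N k q)"

definition R_to_E ::
  "'v set \<Rightarrow> ('v \<Rightarrow> nat) \<Rightarrow> ('v \<Rightarrow> complex) \<Rightarrow> ('v \<times> nat \<Rightarrow> 'v \<times> nat \<Rightarrow> complex)" where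
  "R_to_E I d r = (\<lambda>p q. if p = q \<and> p \<in> block_index I d then r (fst p) else 0)"

text \<open>
  \<open>M\<^sub>d = Hom\<^bsub>R-bimod\<^esub>(M, E\<^sub>d)\<close> for an \<open>R\<close>-subbimodule \<open>M\<close> of the path algebra, as functions
  extended by zero outside \<open>M\<close>. Complex linearity is the case of constant \<open>r\<close>.
\<close>

definition bimod_hom ::
  "('v, 'e) pre_digraph \<Rightarrow> ('v \<Rightarrow> nat) \<Rightarrow> (('v, 'e) path \<Rightarrow>\<^sub>0 complex) set \<Rightarrow>
   ((('v, 'e) path \<Rightarrow>\<^sub>0 complex) \<Rightarrow> 'v \<times> nat \<Rightarrow> 'v \<times> nat \<Rightarrow> complex) set" where
  "bimod_hom G d M = (let S = block_index (verts G) d; E = R_to_E (verts G) d in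
     {\<phi>. (\<forall>m. m \<notin> M \<longrightarrow> \<phi> m = 0) \<and>
         (\<forall>m\<in>M. \<phi> m \<in> mats S) \<and>
         (\<forall>m\<in>M. \<forall>m'\<in>M. \<phi> (m + m') = \<phi> m + \<phi> m') \<and>
         (\<forall>m\<in>M. \<forall>r s. \<phi> (path_mult (path_mult (R_to_F G r) m) (R_to_F G s))
                       = mat_mult S (mat_mult S (E r) (\<phi> m)) (E s))})"


section \<open>Representation schemes\<close>

text \<open>Polynomials over the complex numbers in the variables from a (possibly infinite) set.\<close>

type_synonym 'x mpoly = "('x \<Rightarrow>\<^sub>0 nat) \<Rightarrow>\<^sub>0 complex"

definition mVar :: "'x \<Rightarrow> 'x mpoly" where
  "mVar x = Poly_Mapping.single (Poly_Mapping.single x 1) 1"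

definition mConst :: "complex \<Rightarrow> 'x mpoly" where
  "mConst c = Poly_Mapping.single 0 c"

definition mpoly_ring :: "'x set \<Rightarrow> 'x mpoly ring" where
  "mpoly_ring X =
     \<lparr>carrier = {f. \<forall>m\<in>Poly_Mapping.keys f. Poly_Mapping.keys m \<subseteq> X},
      monoid.mult = (*),
      one = 1,
      ring.zero = 0,
      add = (+)\<rparr>"

lemma mpoly_ring_cring: "cring (mpoly_ring X)"
proof (rule cringI)
  have add: "f + g \<in> carrier (mpoly_ring X)"
    if "f \<in> carrier (mpoly_ring X)" "g \<in> carrier (mpoly_ring X)" for f g
    using that Poly_Mapping.keys_add[of f g] by (force simp: mpoly_ring_def)
  have mult: "f * g \<in> carrier (mpoly_ring X)"
    if "f \<in> carrier (mpoly_ring X)" "g \<in> carrier (mpoly_ring X)" for f g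
  proof -
    have "Poly_Mapping.keys m \<subseteq> X" if m: "m \<in> Poly_Mapping.keys (f * g)" for m
    proof -
      obtain a b where "m = a + b" "a \<in> Poly_Mapping.keys f" "b \<in> Poly_Mapping.keys g"
        using m Poly_Mapping.keys_mult[of f g] by blast
      with \<open>f \<in> _\<close> \<open>g \<in> _\<close> Poly_Mapping.keys_add[of a b] show ?thesis
        by (fastforce simp: mpoly_ring_def)
    qed
    then show ?thesis by (simp add: mpoly_ring_def)
  qed
  have ops: "(\<otimes>\<^bsub>mpoly_ring X\<^esub>) = (*)" "(\<oplus>\<^bsub>mpoly_ring X\<^esub>) = (+)"
      "\<zero>\<^bsub>mpoly_ring X\<^esub> = 0" "\<one>\<^bsub>mpoly_ring X\<^esub> = 1"
    by (simp_all add: mpoly_ring_def)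
  have zero: "0 \<in> carrier (mpoly_ring X)" and one: "1 \<in> carrier (mpoly_ring X)"
    by (simp_all add: mpoly_ring_def)
  have minus: "- f \<in> carrier (mpoly_ring X)" if "f \<in> carrier (mpoly_ring X)" for f
    using that by (simp add: mpoly_ring_def keys_uminus)
  show "abelian_group (mpoly_ring X)"
  proof (rule abelian_groupI)
    fix x assume "x \<in> carrier (mpoly_ring X)"
    then show "\<exists>y\<in>carrier (mpoly_ring X). y \<oplus>\<^bsub>mpoly_ring X\<^esub> x = \<zero>\<^bsub>mpoly_ring X\<^esub>"
      by (intro bexI[of _ "- x"] minus) (simp_all add: ops)
  qed (simp_all add: ops add zero add.assoc add.commute)
  show "Group.comm_monoid (mpoly_ring X)"
  proof (rule Group.comm_monoidI)
    show "x \<otimes>\<^bsub>mpoly_ring X\<^esub> y = y \<otimes>\<^bsub>mpoly_ring X\<^esub> x" for x y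
      unfolding ops by (rule mult.commute)
  qed (simp_all add: ops mult one mult.assoc)
  show "(x \<oplus>\<^bsub>mpoly_ring X\<^esub> y) \<otimes>\<^bsub>mpoly_ring X\<^esub> z
      = x \<otimes>\<^bsub>mpoly_ring X\<^esub> z \<oplus>\<^bsub>mpoly_ring X\<^esub> y \<otimes>\<^bsub>mpoly_ring X\<^esub> z" for x y z
    unfolding ops by (rule distrib_right)
qed

text \<open>
  Let \<open>A\<close> be a ring with a ring map \<open>\<eta>\<close> from \<open>R = \<complex>\<^sup>I\<close>. The scheme \<open>Rep\<^sub>d A\<close> is the spectrum of
  the ring below, which is generated by the matrix entries \<open>x(a,p,q)\<close> of the images of all
  \<open>a \<in> A\<close> and has as relations precisely that \<open>a \<mapsto> (x(a,p,q))\<^bsub>p,q\<^esub>\<close> be additive, multiplicative,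
  and equal to the block scalar matrix of \<open>r\<close> on \<open>\<eta> r\<close>: its \<open>B\<close>-points, \<open>B\<close> a commutative
  \<open>\<complex>\<close>-algebra, are the algebra maps from \<open>A\<close> to \<open>E\<^sub>d \<otimes> B\<close> restricting to the
  given map on \<open>R\<close>. Unitality and complex linearity are the cases of constant \<open>r\<close>.
\<close>

definition generic_matrix ::
  "'a \<Rightarrow> 'v \<times> nat \<Rightarrow> 'v \<times> nat \<Rightarrow> ('a \<times> ('v \<times> nat) \<times> ('v \<times> nat)) mpoly" where
  "generic_matrix a = (\<lambda>p q. mVar (a, p, q))"

definition rep_relations ::
  "'v set \<Rightarrow> ('v \<Rightarrow> nat) \<Rightarrow> ('a, 'm) ring_scheme \<Rightarrow> (('v \<Rightarrow> complex) \<Rightarrow> 'a) \<Rightarrow>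
   ('a \<times> ('v \<times> nat) \<times> ('v \<times> nat)) mpoly set" where
  "rep_relations I d A \<eta> = (let S = block_index I d; X = generic_matrix in
     {X (a \<oplus>\<^bsub>A\<^esub> b) p q - (X a p q + X b p q) | a b p q.
        a \<in> carrier A \<and> b \<in> carrier A \<and> p \<in> S \<and> q \<in> S} \<union>
     {X (a \<otimes>\<^bsub>A\<^esub> b) p q - mat_mult S (X a) (X b) p q | a b p q.
        a \<in> carrier A \<and> b \<in> carrier A \<and> p \<in> S \<and> q \<in> S} \<union>
     {X (\<eta> r) p q - mConst (R_to_E I d r p q) | r p q. p \<in> S \<and> q \<in> S})"

definition rep_coordinate_ring ::
  "'v set \<Rightarrow> ('v \<Rightarrow> nat) \<Rightarrow> ('a, 'm) ring_scheme \<Rightarrow> (('v \<Rightarrow> complex) \<Rightarrow> 'a) \<Rightarrow>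
   ('a \<times> ('v \<times> nat) \<times> ('v \<times> nat)) mpoly set ring" where
  "rep_coordinate_ring I d A \<eta> =
     (let P = mpoly_ring (carrier A \<times> block_index I d \<times> block_index I d)
      in P Quot (genideal P (rep_relations I d A \<eta>)))"

definition rep_dim ::
  "'v set \<Rightarrow> ('v \<Rightarrow> nat) \<Rightarrow> ('a, 'm) ring_scheme \<Rightarrow> (('v \<Rightarrow> complex) \<Rightarrow> 'a) \<Rightarrow> ereal" where
  "rep_dim I d A \<eta> = krull_dim (rep_coordinate_ring I d A \<eta>)"


section \<open>Representation complete intersections\<close>

text \<open>
  \<open>T\<^sub>R V\<close>, \<open>V\<close> the bimodule spanned by the edges of \<open>G\<close>, is the path algebra of \<open>G\<close>; \<open>L\<close> is an
  \<open>R\<close>-subbimodule of it.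
\<close>

definition quot_alg ::
  "('v, 'e) pre_digraph \<Rightarrow> (('v, 'e) path \<Rightarrow>\<^sub>0 complex) set \<Rightarrow> (('v, 'e) path \<Rightarrow>\<^sub>0 complex) set ring" where
  "quot_alg G L = path_algebra G Quot (genideal (path_algebra G) L)"

definition R_to_quot_alg ::
  "('v, 'e) pre_digraph \<Rightarrow> (('v, 'e) path \<Rightarrow>\<^sub>0 complex) set \<Rightarrow> ('v \<Rightarrow> complex) \<Rightarrow>
   (('v, 'e) path \<Rightarrow>\<^sub>0 complex) set" where
  "R_to_quot_alg G L r = genideal (path_algebra G) L +>\<^bsub>path_algebra G\<^esub> R_to_F G r"

definition RCI :: "('v, 'e) pre_digraph \<Rightarrow> (('v, 'e) path \<Rightarrow>\<^sub>0 complex) set \<Rightarrow> bool" where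
  "RCI G L \<longleftrightarrow> (\<forall>N::int. \<exists>d :: 'v \<Rightarrow> nat. (\<forall>i\<in>verts G. int (d i) > N) \<and>
     rep_dim (verts G) d (quot_alg G L) (R_to_quot_alg G L) =
       ereal (real (hdim (bimod_hom G d (arc_space G)))
              - real (hdim (bimod_hom G d L))
              + real (pdim (L \<inter> commutator_space G))))"


section \<open>Partial preprojective algebras\<close>

datatype 'e double_arc = Orig 'e | Star 'e

definition double_quiver :: "('v, 'e) pre_digraph \<Rightarrow> ('v, 'e double_arc) pre_digraph" where
  "double_quiver Q =
     \<lparr>verts = verts Q,
      arcs = Orig ` arcs Q \<union> Star ` arcs Q,
      tail = case_double_arc (tail Q) (head Q),
      head = case_double_arc (head Q) (tail Q)\<rparr>"

definition partial_relation ::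
  "('v, 'e) pre_digraph \<Rightarrow> 'v set \<Rightarrow> ('v, 'e double_arc) path \<Rightarrow>\<^sub>0 complex" where
  "partial_relation Q J = (let D = double_quiver Q;
       z = \<one>\<^bsub>path_algebra D\<^esub> - (\<Sum>i\<in>J. vertex_idem i)
     in path_mult (path_mult z
          (\<Sum>a\<in>arcs Q. path_commutator (arc_elt D (Orig a)) (arc_elt D (Star a)))) z)"

definition partial_relation_space ::
  "('v, 'e) pre_digraph \<Rightarrow> 'v set \<Rightarrow> (('v, 'e double_arc) path \<Rightarrow>\<^sub>0 complex) set" where
  "partial_relation_space Q J = sub_bimodule_gen (double_quiver Q) (partial_relation Q J)"

definition partial_preprojective ::
  "('v, 'e) pre_digraph \<Rightarrow> 'v set \<Rightarrow> (('v, 'e double_arc) path \<Rightarrow>\<^sub>0 complex) set ring" where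
  "partial_preprojective Q J =
     path_algebra (double_quiver Q) Quot
       (genideal (path_algebra (double_quiver Q)) {partial_relation Q J})"

lemma double_quiver_fin_digraph:
  assumes "fin_digraph Q" shows "fin_digraph (double_quiver Q)"
proof -
  interpret fin_digraph Q by fact
  show ?thesis by unfold_locales (auto simp: double_quiver_def)
qed

lemma keys_diff_paths:
  "Poly_Mapping.keys f \<subseteq> A \<Longrightarrow> Poly_Mapping.keys g \<subseteq> A \<Longrightarrow> Poly_Mapping.keys (f - g) \<subseteq> A"
  using Poly_Mapping.keys_diff[of f g] by blast

lemma keys_sum_paths:
  "(\<And>x. x \<in> S \<Longrightarrow> Poly_Mapping.keys (F x) \<subseteq> A) \<Longrightarrow> Poly_Mapping.keys (sum F S) \<subseteq> A"
  using Poly_Mapping.keys_sum[of F S] by blast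

lemma partial_relation_carrier:
  assumes Q: "fin_digraph Q" and J: "J \<subseteq> verts Q"
  shows "partial_relation Q J \<in> carrier (path_algebra (double_quiver Q))"
proof -
  let ?D = "double_quiver Q"
  interpret Q: fin_digraph Q by fact
  interpret D: fin_digraph ?D by (rule double_quiver_fin_digraph[OF Q])
  have arc: "Poly_Mapping.keys (arc_elt ?D a) \<subseteq> paths ?D" if "a \<in> arcs ?D" for a
    using that by (auto simp: arc_elt_def paths_def intro: D.arc_implies_awalk)
  have vert: "Poly_Mapping.keys (vertex_idem i) \<subseteq> paths ?D" if "i \<in> J" for i
    using that J D.awalk_Nil_iff[of i i]
    by (auto simp: vertex_idem_def paths_def) (auto simp: double_quiver_def)
  have z: "Poly_Mapping.keys (\<one>\<^bsub>path_algebra ?D\<^esub> - (\<Sum>i\<in>J. vertex_idem i)) \<subseteq> paths ?D"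
    using R_to_F_carrier[OF D.fin_digraph, of "\<lambda>_. 1"]
    by (intro keys_diff_paths keys_sum_paths vert) (auto simp: path_algebra_def)
  have c: "Poly_Mapping.keys (\<Sum>a\<in>arcs Q. path_commutator (arc_elt ?D (Orig a)) (arc_elt ?D (Star a)))
      \<subseteq> paths ?D"
    unfolding path_commutator_def
    by (intro keys_sum_paths keys_diff_paths path_mult_keys[OF D.wf_digraph] arc)
       (auto simp: double_quiver_def)
  show ?thesis
    using path_mult_keys[OF D.wf_digraph path_mult_keys[OF D.wf_digraph z c] z]
    by (simp add: partial_relation_def Let_def path_algebra_def)
qed

lemma quot_alg_partial_relation_space:
  assumes "fin_digraph Q" "J \<subseteq> verts Q"
  shows "quot_alg (double_quiver Q) (partial_relation_space Q J) = partial_preprojective Q J"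
  unfolding quot_alg_def partial_preprojective_def partial_relation_space_def
  by (simp add: genideal_sub_bimodule_gen double_quiver_fin_digraph partial_relation_carrier assms)

end

(*
Upper bound: let h be the distance to J and choose for each vertex i outside J an arc al i of the
double quiver that lowers h. If the dimensions at least double along al i, suitable weights make
x(al i; k, k + l) x(al i*; k + l, l) the leading monomial of the (k, l) entry of the moment map at i.
These monomials are pairwise coprime, so the polynomials of weight at most D modulo the equations span
a space of dimension O(D^n) with n = dim V_d - dim L_d. A chain of primes of length m gives m
algebraically independent elements, hence m <= n.

Lower bound: the equations are bilinear in the entries of one arc of each pair of opposite arcs and
those of the other one, and contain a square linear system for the entries of the al i*, whose
determinant delta is nonzero since the system is triangular when the al i are [1 | 0] and the
other coefficients vanish. Cramer's rule, with the free unknowns multiplied by delta, parametrizes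
solutions by n polynomial parameters; setting these to zero one after the other gives a chain of n + 1
primes.

The space L meets [F, F] in 0: the coefficients of the cyclic words b b* show that an element
sum_i lambda_i mu_i of the commutator space has lambda constant along edges, while lambda vanishes on J.
*)

theory Submission
  imports Defs "Jordan_Normal_Form.Determinant"
begin

section \<open>Substitution in polynomials\<close>

text \<open>The coordinate ring of \<open>Rep\<close> is generated by entries of the images of all
  elements of the algebra, so it has to be compared with the finitely many arc entries before
  anything can be counted. Two substitutions, inverse to each other only modulo the relations, carry
  strict prime chains back and forth; no ring isomorphism is built. The middle index k + l of the
  leading monomials is what makes them coprime: (k, k + l) and (k + l, l) each determine the
  equation, whereas the middle index k would put x(al i; k, k) into all equations with the same i
  and k. The price is that k + l can reach 2 d_i - 2, hence the doubling of dimensions along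
  \<open>al i\<close>. It is affordable because RCI asks only for some dimension vector above each
  bound. The lower bound needs neither a fraction field nor a parametrization that hits every
  solution: each parameter merely has to be visible in one coordinate, up to a nonzero factor in
  earlier parameters. This is why all parameters of the linear system's coefficients come first.
  Nonemptiness of J is used together with connectedness: it gives the descent, an arc at every
  vertex outside J, and a vertex where lambda vanishes.\<close>

lemma mConst_0 [simp]: "mConst 0 = 0"
  by (simp add: mConst_def)

lemma mConst_1 [simp]: "mConst 1 = 1"
  by (simp add: mConst_def)

lemma mConst_add: "mConst (a + b) = mConst a + mConst b"
  by (simp add: mConst_def single_add)

lemma mConst_mult: "mConst (a * b) = mConst a * mConst b"
  by (simp add: mConst_def mult_single)

lemma mConst_uminus: "mConst (- a) = - mConst a"
  by (metis add.right_inverse mConst_0 mConst_add minus_unique)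

lemma mConst_eq_0_iff [simp]: "mConst a = 0 \<longleftrightarrow> a = 0"
  by (metis mConst_0 mConst_def lookup_single_eq lookup_zero)

lemma mVar_neq_0 [simp]: "mVar x \<noteq> 0"
  by (metis mVar_def lookup_single_eq lookup_zero zero_neq_one)

lemma mConst_mult_single: "mConst c * Poly_Mapping.single m b = Poly_Mapping.single m (c * b)"
  by (simp add: mConst_def mult_single)

lemma pscale_eq_mConst_mult: "pscale c f = mConst c * f"
proof (induction f rule: poly_mapping_add_induct)
  case (single m b)
  show ?case
    by (auto intro!: poly_mapping_eqI simp: mConst_mult_single lookup_single when_def)
next
  case (add f g)
  then show ?case by (simp add: distrib_left pvs.scale_right_distrib)
qed

definition monom_eval :: "('x \<Rightarrow> 'b::comm_semiring_1) \<Rightarrow> ('x \<Rightarrow>\<^sub>0 nat) \<Rightarrow> 'b" where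
  "monom_eval g m = (\<Prod>x\<in>Poly_Mapping.keys m. g x ^ Poly_Mapping.lookup m x)"

lemma monom_eval_superset:
  assumes "finite S" "Poly_Mapping.keys m \<subseteq> S"
  shows "monom_eval g m = (\<Prod>x\<in>S. g x ^ Poly_Mapping.lookup m x)"
  unfolding monom_eval_def
  by (intro prod.mono_neutral_left) (use assms in \<open>auto simp: in_keys_iff\<close>)

lemma monom_eval_0 [simp]: "monom_eval g 0 = 1"
  by (simp add: monom_eval_def)

lemma monom_eval_single [simp]: "monom_eval g (Poly_Mapping.single x k) = g x ^ k"
  by (subst monom_eval_superset[of "{x}"]) auto

lemma monom_eval_add: "monom_eval g (m + n) = monom_eval g m * monom_eval g n"
proof -
  let ?S = "Poly_Mapping.keys m \<union> Poly_Mapping.keys n"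
  show ?thesis
    by (subst (1 2 3) monom_eval_superset[of ?S])
       (use Poly_Mapping.keys_add[of m n] in
         \<open>auto simp: lookup_add power_add prod.distrib\<close>)
qed

definition msubst :: "('x \<Rightarrow> 'z mpoly) \<Rightarrow> 'x mpoly \<Rightarrow> 'z mpoly" where
  "msubst g f = (\<Sum>m\<in>Poly_Mapping.keys f. mConst (Poly_Mapping.lookup f m) * monom_eval g m)"

lemma msubst_superset:
  assumes "finite S" "Poly_Mapping.keys f \<subseteq> S"
  shows "msubst g f = (\<Sum>m\<in>S. mConst (Poly_Mapping.lookup f m) * monom_eval g m)"
  unfolding msubst_def
  by (intro sum.mono_neutral_left) (use assms in \<open>auto simp: in_keys_iff\<close>)

lemma msubst_single: "msubst g (Poly_Mapping.single m c) = mConst c * monom_eval g m"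
  by (subst msubst_superset[of "{m}"]) auto

lemma msubst_add: "msubst g (f + f') = msubst g f + msubst g f'"
proof -
  let ?S = "Poly_Mapping.keys f \<union> Poly_Mapping.keys f'"
  show ?thesis
    by (subst (1 2 3) msubst_superset[of ?S])
       (use Poly_Mapping.keys_add[of f f'] in
         \<open>auto simp: lookup_add mConst_add distrib_right sum.distrib\<close>)
qed

lemma msubst_mult: "msubst g (f * f') = msubst g f * msubst g f'"
proof (induction f rule: poly_mapping_add_induct)
  case (single m a)
  show ?case
  proof (induction f' rule: poly_mapping_add_induct)
    case (single n b)
    show ?case
      by (simp add: mult_single msubst_single mConst_mult monom_eval_add algebra_simps)
  qed (simp add: distrib_left msubst_add)
qed (simp add: distrib_right msubst_add)

lemma msubst_const [simp]: "msubst g (mConst c) = mConst c"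
  by (simp add: mConst_def msubst_single)

lemma msubst_var [simp]: "msubst g (mVar x) = g x"
  by (simp add: mVar_def msubst_single)

lemma msubst_0 [simp]: "msubst g 0 = 0"
  by (simp add: msubst_def)

lemma msubst_1 [simp]: "msubst g 1 = 1"
  by (metis mConst_1 msubst_const)

lemma msubst_uminus: "msubst g (- f) = - msubst g f"
  by (metis add.right_inverse msubst_0 msubst_add minus_unique)

lemma msubst_diff: "msubst g (f - f') = msubst g f - msubst g f'"
  by (metis diff_conv_add_uminus msubst_add msubst_uminus)

lemma msubst_sum: "msubst g (sum f S) = (\<Sum>i\<in>S. msubst g (f i))"
  by (induction S rule: infinite_finite_induct) (auto simp: msubst_add)

lemma comm_ring_hom_msubst: "comm_ring_hom (msubst g)"
  by unfold_locales (auto simp: msubst_add msubst_mult)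

text \<open>Constants and variables generate the polynomial algebra, so identities between
  substitutions need to be checked only on them.\<close>

lemma mpoly_induct [case_names const var add mult]:
  assumes const: "\<And>c. P (mConst c)" and var: "\<And>x. P (mVar x)"
    and add: "\<And>f g. P f \<Longrightarrow> P g \<Longrightarrow> P (f + g)"
    and mult: "\<And>f g. P f \<Longrightarrow> P g \<Longrightarrow> P (f * g)"
  shows "P (f :: 'x mpoly)"
proof (induction f rule: poly_mapping_add_induct)
  case (single m c)
  have pow: "P (mVar x ^ k)" for x k
    by (induction k) (use const[of 1] in \<open>auto intro: mult var\<close>)
  have "P (Poly_Mapping.single m 1)"
  proof (induction m rule: poly_mapping_add_induct)
    case (single x k)
    have "mVar x ^ k = (Poly_Mapping.single (Poly_Mapping.single x k) 1 :: 'x mpoly)"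
    proof (induction k)
      case (Suc k)
      then show ?case by (simp add: mVar_def mult_single flip: single_add)
    qed simp
    then show ?case using pow by metis
  next
    case (add m n)
    then show ?case using mult[of "Poly_Mapping.single m 1" "Poly_Mapping.single n 1"]
      by (simp add: mult_single)
  qed
  then show ?case using mult[OF const[of c]] by (metis mConst_mult_single mult.right_neutral)
qed (rule add)

lemma msubst_msubst: "msubst h (msubst g f) = msubst (\<lambda>x. msubst h (g x)) f"
  by (induction f rule: mpoly_induct) (auto simp: msubst_add msubst_mult)

lemma msubst_mVar: "msubst mVar f = f"
  by (induction f rule: mpoly_induct) (auto simp: msubst_add msubst_mult)


section \<open>Chains of prime ideals\<close>

text \<open>Stated on a whole type, without carriers, so that the chain arguments can use type class
  arithmetic. The locale \<open>primeideal\<close> enters only in the comparison with the coordinate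
  ring.\<close>

definition prime_ideal_set :: "'a::comm_ring_1 set \<Rightarrow> bool" where
  "prime_ideal_set P \<longleftrightarrow> 0 \<in> P \<and> (\<forall>f\<in>P. \<forall>g\<in>P. f + g \<in> P) \<and> (\<forall>f\<in>P. \<forall>h. h * f \<in> P) \<and>
     1 \<notin> P \<and> (\<forall>f g. f * g \<in> P \<longrightarrow> f \<in> P \<or> g \<in> P)"

text \<open>Primes that contain \<open>G\<close> correspond to primes of the quotient by the ideal
  that \<open>G\<close> generates; this ideal itself is never formed.\<close>

definition prime_chain :: "'a::comm_ring_1 set \<Rightarrow> nat \<Rightarrow> bool" where
  "prime_chain G n \<longleftrightarrow> (\<exists>P. (\<forall>k\<le>n. prime_ideal_set (P k) \<and> G \<subseteq> P k) \<and>
     (\<forall>k<n. P k \<subset> P (Suc k)))"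

context
  fixes P :: "'a::comm_ring_1 set"
  assumes P: "prime_ideal_set P"
begin

lemma prime_zero: "0 \<in> P"
  using P by (simp add: prime_ideal_set_def)

lemma prime_one: "1 \<notin> P"
  using P by (simp add: prime_ideal_set_def)

lemma prime_add: "f \<in> P \<Longrightarrow> g \<in> P \<Longrightarrow> f + g \<in> P"
  using P by (simp add: prime_ideal_set_def)

lemma prime_mult: "f \<in> P \<Longrightarrow> h * f \<in> P" "f \<in> P \<Longrightarrow> f * h \<in> P"
  using P by (auto simp: prime_ideal_set_def mult.commute)

lemma prime_multD: "f * g \<in> P \<Longrightarrow> f \<in> P \<or> g \<in> P"
  using P by (simp add: prime_ideal_set_def)

lemma prime_uminus: "f \<in> P \<Longrightarrow> - f \<in> P"
  using prime_mult(1)[of f "-1"] by simp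

lemma prime_diff: "f \<in> P \<Longrightarrow> g \<in> P \<Longrightarrow> f - g \<in> P"
  using prime_add[of f "- g"] prime_uminus[of g] by simp

lemma prime_sum: "(\<And>i. i \<in> S \<Longrightarrow> f i \<in> P) \<Longrightarrow> sum f S \<in> P"
  by (induction S rule: infinite_finite_induct) (auto intro: prime_add prime_zero)

lemma prime_powerD: "f ^ n \<in> P \<Longrightarrow> f \<in> P"
  by (induction n) (use prime_one prime_multD in auto)

lemma prime_diffD: "f - g \<in> P \<Longrightarrow> f \<in> P \<longleftrightarrow> g \<in> P"
  using prime_add[of "f - g" g] prime_diff[of f "f - g"] by auto

end

text \<open>The quotient by the kernel embeds into a domain.\<close>

lemma prime_ideal_set_kernel:
  fixes h :: "'a::comm_ring_1 \<Rightarrow> 'b::idom"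
  assumes "comm_ring_hom h"
  shows "prime_ideal_set {f. h f = 0}"
proof -
  interpret comm_ring_hom h by fact
  show ?thesis by (auto simp: prime_ideal_set_def hom_distribs)
qed


section \<open>An upper bound for the length of prime chains\<close>

definition mwt :: "('x \<Rightarrow> nat) \<Rightarrow> ('x \<Rightarrow>\<^sub>0 nat) \<Rightarrow> nat" where
  "mwt w m = (\<Sum>x\<in>Poly_Mapping.keys m. w x * Poly_Mapping.lookup m x)"

lemma mwt_superset:
  assumes "finite S" "Poly_Mapping.keys m \<subseteq> S"
  shows "mwt w m = (\<Sum>x\<in>S. w x * Poly_Mapping.lookup m x)"
  unfolding mwt_def
  by (intro sum.mono_neutral_left) (use assms in \<open>auto simp: in_keys_iff\<close>)

lemma mwt_single [simp]: "mwt w (Poly_Mapping.single x k) = w x * k"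
  by (subst mwt_superset[of "{x}"]) auto

lemma mwt_0 [simp]: "mwt w 0 = 0"
  by (simp add: mwt_def)

lemma mwt_add: "mwt w (m + n) = mwt w m + mwt w n"
proof -
  let ?S = "Poly_Mapping.keys m \<union> Poly_Mapping.keys n"
  show ?thesis
    by (subst (1 2 3) mwt_superset[of ?S])
       (use Poly_Mapping.keys_add[of m n] in
         \<open>auto simp: lookup_add sum.distrib distrib_left\<close>)
qed

lemma lookup_le_mwt:
  assumes "w x \<ge> 1"
  shows "Poly_Mapping.lookup m x \<le> mwt w m"
proof (cases "x \<in> Poly_Mapping.keys m")
  case True
  have "Poly_Mapping.lookup m x \<le> w x * Poly_Mapping.lookup m x" using assms by simp
  also have "\<dots> \<le> mwt w m" unfolding mwt_def
    by (rule member_le_sum[OF True, of "\<lambda>x. w x * Poly_Mapping.lookup m x"]) auto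
  finally show ?thesis .
qed (simp add: in_keys_iff)

definition wt_le :: "('x \<Rightarrow> nat) \<Rightarrow> nat \<Rightarrow> 'x mpoly set" where
  "wt_le w D = {f. \<forall>m\<in>Poly_Mapping.keys f. mwt w m \<le> D}"

lemma wt_le_mono: "D \<le> E \<Longrightarrow> wt_le w D \<subseteq> wt_le w E"
  by (force simp: wt_le_def)

lemma wt_le_mult: "f \<in> wt_le w D \<Longrightarrow> g \<in> wt_le w E \<Longrightarrow> f * g \<in> wt_le w (D + E)"
  using Poly_Mapping.keys_mult[of f g] by (fastforce simp: wt_le_def mwt_add intro: add_mono)

lemma wt_le_1 [simp]: "1 \<in> wt_le w D"
  by (auto simp: wt_le_def)

lemma wt_le_0 [simp]: "0 \<in> wt_le w D"
  by (simp add: wt_le_def)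

lemma wt_le_add: "f \<in> wt_le w D \<Longrightarrow> g \<in> wt_le w D \<Longrightarrow> f + g \<in> wt_le w D"
  using Poly_Mapping.keys_add[of f g] by (auto simp: wt_le_def)

lemma wt_le_sum: "(\<And>i. i \<in> S \<Longrightarrow> f i \<in> wt_le w D) \<Longrightarrow> sum f S \<in> wt_le w D"
  by (induction S rule: infinite_finite_induct) (auto intro: wt_le_add wt_le_0)

lemma wt_le_const: "f \<in> wt_le w D \<Longrightarrow> mConst c * f \<in> wt_le w D"
  by (auto simp: wt_le_def in_keys_iff simp flip: pscale_eq_mConst_mult)

lemma wt_le_var: "mVar x \<in> wt_le w (w x)"
  by (simp add: mVar_def wt_le_def)

lemma wt_le_power: "f \<in> wt_le w D \<Longrightarrow> f ^ n \<in> wt_le w (n * D)"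
  by (induction n) (auto dest: wt_le_mult)

lemma wt_le_prod:
  "(\<And>i. i \<in> S \<Longrightarrow> f i \<in> wt_le w (e i)) \<Longrightarrow> prod f S \<in> wt_le w (sum e S)"
  by (induction S rule: infinite_finite_induct) (auto intro: wt_le_mult)

lemma ex_wt_le: "\<exists>D. f \<in> wt_le w D"
proof (intro exI)
  show "f \<in> wt_le w (\<Sum>m\<in>Poly_Mapping.keys f. mwt w m)"
    unfolding wt_le_def by (auto intro: member_le_sum[of _ _ "mwt w"])
qed

section \<open>Algebraic independence of elements that separate the members of a prime chain\<close>

definition chain_monom :: "(nat \<Rightarrow> 'a::comm_monoid_mult) \<Rightarrow> nat list \<Rightarrow> 'a" where
  "chain_monom f as = (\<Prod>i<length as. f i ^ (as ! i))"

lemma chain_monom_Cons: "chain_monom f (a # as) = f 0 ^ a * chain_monom (\<lambda>i. f (Suc i)) as"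
  by (simp add: chain_monom_def prod.lessThan_Suc_shift del: prod.lessThan_Suc)

text \<open>
  Cancel the lowest power of \<open>f\<^sub>0\<close> in a relation and reduce modulo \<open>P\<^sub>1\<close>.
\<close>

lemma prime_chain_algebraically_independent:
  fixes P :: "nat \<Rightarrow> 'x mpoly set"
  assumes "\<And>k. k \<le> m \<Longrightarrow> prime_ideal_set (P k)"
    and "\<And>k. k < m \<Longrightarrow> P k \<subseteq> P (Suc k)"
    and "\<And>k. k < m \<Longrightarrow> f k \<in> P (Suc k) - P k"
    and "finite A" "A \<noteq> {}" "\<And>as. as \<in> A \<Longrightarrow> length as = m" "\<And>as. as \<in> A \<Longrightarrow> c as \<noteq> 0"
  shows "(\<Sum>as\<in>A. mConst (c as) * chain_monom f as) \<notin> P 0"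
  using assms
proof (induction m arbitrary: P f A c)
  case 0
  then have A: "A = {[]}" by auto
  have p: "prime_ideal_set (P 0)" using 0 by auto
  show ?case
  proof
    assume "(\<Sum>as\<in>A. mConst (c as) * chain_monom f as) \<in> P 0"
    then have "mConst (1 / c []) * mConst (c []) \<in> P 0"
      using prime_mult(1)[OF p] by (simp add: A chain_monom_def)
    then show False using 0(7)[of "[]"] prime_one[OF p] by (simp add: A flip: mConst_mult)
  qed
next
  case (Suc m)
  have p0: "prime_ideal_set (P 0)" and p1: "prime_ideal_set (P 1)" using Suc.prems(1) by auto
  have len: "as \<noteq> []" "length (tl as) = m" if "as \<in> A" for as
    using Suc.prems(6)[OF that] by auto
  define s where "s = Min (hd ` A)"
  have fin: "finite (hd ` A)" "hd ` A \<noteq> {}" using Suc.prems(4,5) by auto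
  have s_le: "s \<le> hd as" if "as \<in> A" for as using fin that by (simp add: s_def)
  have s_in: "s \<in> hd ` A" unfolding s_def using fin by (rule Min_in)
  define A0 where "A0 = {as \<in> A. hd as = s}"
  let ?f = "\<lambda>i. f (Suc i)"
  let ?g = "\<lambda>as. mConst (c as) * (f 0 ^ (hd as - s) * chain_monom ?f (tl as))"
  show ?case
  proof
    assume *: "(\<Sum>as\<in>A. mConst (c as) * chain_monom f as) \<in> P 0"
    have "mConst (c as) * chain_monom f as = f 0 ^ s * ?g as" if "as \<in> A" for as
    proof -
      have "as = hd as # tl as" using len that by auto
      then have "chain_monom f as = f 0 ^ hd as * chain_monom ?f (tl as)"
        by (metis chain_monom_Cons)
      moreover have "f 0 ^ hd as = f 0 ^ s * f 0 ^ (hd as - s)"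
        using s_le[OF that] by (simp flip: power_add)
      ultimately show ?thesis by (simp add: algebra_simps)
    qed
    then have "f 0 ^ s * (\<Sum>as\<in>A. ?g as) \<in> P 0" using * by (simp add: sum_distrib_left)
    moreover have "f 0 ^ s \<notin> P 0" using prime_powerD[OF p0] Suc.prems(3)[of 0] by auto
    ultimately have g: "(\<Sum>as\<in>A. ?g as) \<in> P 1"
      using prime_multD[OF p0] Suc.prems(2)[of 0] by auto
    \<comment> \<open>Terms with exponent above \<open>s\<close> still contain \<open>f 0\<close>,
      which lies in \<open>P 1\<close>. The terms with exponent exactly \<open>s\<close> are left as
      a relation in the remaining elements over the shorter chain that starts at
      \<open>P 1\<close>.\<close>
    have split: "(\<Sum>as\<in>A. ?g as) = (\<Sum>as\<in>A0. ?g as) + (\<Sum>as\<in>A - A0. ?g as)"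
      using Suc.prems(4) by (subst sum.subset_diff[of A0]) (auto simp: A0_def add.commute)
    have rest: "(\<Sum>as\<in>A - A0. ?g as) \<in> P 1"
    proof (rule prime_sum[OF p1])
      fix as assume "as \<in> A - A0"
      then have "s < hd as" using s_le[of as] by (auto simp: A0_def)
      then have "f 0 ^ (hd as - s) = f 0 * f 0 ^ (hd as - s - 1)"
        by (metis Suc_diff_1 power_Suc zero_less_diff)
      then have "f 0 ^ (hd as - s) \<in> P 1"
        using Suc.prems(3)[of 0] prime_mult(2)[OF p1] by auto
      then show "?g as \<in> P 1" by (intro prime_mult[OF p1])
    qed
    have "(\<Sum>as\<in>A0. ?g as) \<in> P 1"
      using prime_diff[OF p1 g rest] unfolding split by simp
    moreover have "(\<Sum>as\<in>A0. ?g as) = (\<Sum>as\<in>tl ` A0. mConst (c (s # as)) * chain_monom ?f as)"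
    proof (subst sum.reindex)
      have eq: "as = s # tl as" if "as \<in> A0" for as
        using len(1)[of as] that by (cases as) (auto simp: A0_def)
      then show "inj_on tl A0" by (metis inj_onI)
      have "c as = c (s # tl as)" if "as \<in> A0" for as
        using eq[OF that] by simp
      then show "(\<Sum>as\<in>A0. ?g as)
          = sum ((\<lambda>as. mConst (c (s # as)) * chain_monom ?f as) \<circ> tl) A0"
        by (intro sum.cong) (auto simp: A0_def)
    qed
    moreover have "(\<Sum>as\<in>tl ` A0. mConst (c (s # as)) * chain_monom ?f as) \<notin> P (Suc 0)"
    proof (rule Suc.IH[of "\<lambda>k. P (Suc k)" ?f "tl ` A0" "\<lambda>as. c (s # as)"])
      show "tl ` A0 \<noteq> {}" "finite (tl ` A0)" using s_in Suc.prems(4) by (auto simp: A0_def)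
      show "length as = m" if "as \<in> tl ` A0" for as using len that by (auto simp: A0_def)
      show "c (s # as) \<noteq> 0" if "as \<in> tl ` A0" for as
      proof -
        have "\<exists>bs\<in>A. hd bs = s \<and> as = tl bs" using that by (auto simp: A0_def)
        then obtain bs where bs: "bs \<in> A" "hd bs = s" "as = tl bs" by auto
        then have "bs = s # as" using len(1)[of bs] by (cases bs) auto
        then show ?thesis using Suc.prems(7) bs by auto
      qed
    qed (use Suc.prems(1-3) in auto)
    ultimately show False by simp
  qed
qed

section \<open>Standard monomials and the comparison of growth rates\<close>

lemma single_add_one: "Poly_Mapping.single (m + n) 1 = (Poly_Mapping.single m 1 * Poly_Mapping.single n 1 :: 'x mpoly)"
  by (simp add: mult_single)

lemma monom_split:
  fixes m :: "'x \<Rightarrow>\<^sub>0 nat"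
  assumes "Poly_Mapping.lookup m x \<noteq> 0"
  obtains m' where "m = Poly_Mapping.single x 1 + m'"
proof
  show "m = Poly_Mapping.single x 1 + (m - Poly_Mapping.single x 1)"
    by (rule poly_mapping_eqI) (use assms in \<open>auto simp: lookup_add lookup_minus lookup_single when_def\<close>)
qed

lemma reduce_combination:
  fixes f :: "'x mpoly"
  assumes P: "prime_ideal_set P" and S: "pvs.subspace S"
    and monom: "\<And>n. n \<in> Poly_Mapping.keys f \<Longrightarrow> \<exists>r\<in>S. Poly_Mapping.single n 1 - r \<in> P"
  shows "\<exists>r\<in>S. f - r \<in> P"
proof -
  obtain r where r: "r n \<in> S" "Poly_Mapping.single n 1 - r n \<in> P"
    if "n \<in> Poly_Mapping.keys f" for n
    using monom by metis
  let ?r = "\<Sum>n\<in>Poly_Mapping.keys f. pscale (Poly_Mapping.lookup f n) (r n)"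
  have "?r \<in> S"
    using r by (intro pvs.subspace_sum[OF S] pvs.subspace_scale[OF S])
  moreover have "f - ?r
      = (\<Sum>n\<in>Poly_Mapping.keys f. mConst (Poly_Mapping.lookup f n) * (Poly_Mapping.single n 1 - r n))"
    by (subst (1) poly_mapping_expand[symmetric, of f])
       (simp add: pscale_eq_mConst_mult sum_subtractf right_diff_distrib mConst_mult_single)
  then have "f - ?r \<in> P"
    using r by (auto intro!: prime_sum[OF P] prime_mult(1)[OF P])
  ultimately show ?thesis by blast
qed

lemma card_bounded_monoms:
  assumes "finite Y"
  shows "finite {m :: 'x \<Rightarrow>\<^sub>0 nat. Poly_Mapping.keys m \<subseteq> Y \<and> (\<forall>x. Poly_Mapping.lookup m x \<le> D)}" (is "finite ?B")
    and "card {m :: 'x \<Rightarrow>\<^sub>0 nat. Poly_Mapping.keys m \<subseteq> Y \<and> (\<forall>x. Poly_Mapping.lookup m x \<le> D)}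
      \<le> Suc D ^ card Y"
proof -
  have inj: "inj_on (\<lambda>m. restrict (Poly_Mapping.lookup m) Y) ?B"
  proof (rule inj_onI)
    fix m n assume mn: "m \<in> ?B" "n \<in> ?B"
      and eq: "restrict (Poly_Mapping.lookup m) Y = restrict (Poly_Mapping.lookup n) Y"
    show "m = n"
    proof (rule poly_mapping_eqI)
      fix k
      show "Poly_Mapping.lookup m k = Poly_Mapping.lookup n k"
        using fun_cong[OF eq, of k] mn
        by (cases "k \<in> Y") (auto simp: in_keys_iff subset_iff, metis gr_zeroI)
    qed
  qed
  have sub: "(\<lambda>m. restrict (Poly_Mapping.lookup m) Y) ` ?B \<subseteq> Y \<rightarrow>\<^sub>E {..D}" by auto
  have fin: "finite (Y \<rightarrow>\<^sub>E {..D})" using assms by (intro finite_PiE) auto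
  show "finite ?B" by (rule inj_on_finite[OF inj sub fin])
  have "card ?B \<le> card (Y \<rightarrow>\<^sub>E {..D})" by (rule card_inj_on_le[OF inj sub fin])
  then show "card ?B \<le> Suc D ^ card Y" using assms by (simp add: card_PiE)
qed

text \<open>
  The leading monomials \<open>x\<^sub>u\<^sub>i x\<^sub>v\<^sub>i\<close> are pairwise coprime, so the standard monomials are those
  that miss \<open>u\<^sub>i\<close> or \<open>v\<^sub>i\<close> for each \<open>i\<close>. Counting them by weight bounds the number of
  algebraically independent elements.
\<close>

locale coprime_leading_monoms =
  fixes Y :: "'x set" and w :: "'x \<Rightarrow> nat" and I :: "'i set" and u v :: "'i \<Rightarrow> 'x" and G :: "'x mpoly set"
  assumes finite_Y: "finite Y" and finite_I: "finite I"
    and w_pos: "\<And>x. x \<in> Y \<Longrightarrow> w x \<ge> 1"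
    and uv_Y: "u ` I \<subseteq> Y" "v ` I \<subseteq> Y"
    and inj_uv: "inj_on u I" "inj_on v I" "u ` I \<inter> v ` I = {}"
    and vanish: "\<And>x. x \<notin> Y \<Longrightarrow> mVar x \<in> G"
    and leading: "\<And>i. i \<in> I \<Longrightarrow> \<exists>c r. c \<noteq> 0 \<and>
      (\<forall>m\<in>Poly_Mapping.keys r. mwt w m < w (u i) + w (v i)) \<and>
      mConst c * (mVar (u i) * mVar (v i)) + r \<in> G"
begin

definition std_monoms :: "nat \<Rightarrow> ('x \<Rightarrow>\<^sub>0 nat) set" where
  "std_monoms D = {m. mwt w m \<le> D \<and> Poly_Mapping.keys m \<subseteq> Y \<and>
     (\<forall>i\<in>I. Poly_Mapping.lookup m (u i) = 0 \<or> Poly_Mapping.lookup m (v i) = 0)}"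

definition std_space :: "nat \<Rightarrow> 'x mpoly set" where
  "std_space D = pspan ((\<lambda>m. Poly_Mapping.single m 1) ` std_monoms D)"

lemma subspace_std_space: "pvs.subspace (std_space D)"
  by (simp add: std_space_def)

text \<open>A nonstandard monomial of weight at most \<open>D\<close> contains a variable outside
  \<open>Y\<close>, and then lies in \<open>P\<close>, or is divisible by a leading product, which
  can be traded for terms of smaller weight. Induction on the weight terminates. Only spanning by
  standard monomials is claimed, not uniqueness of the remainder.\<close>

lemma monom_reduction:
  assumes P: "prime_ideal_set P" "G \<subseteq> P" and "mwt w m \<le> D"
  shows "\<exists>r\<in>std_space D. Poly_Mapping.single m 1 - r \<in> P"
  using assms(3)
proof (induction "mwt w m" arbitrary: m rule: less_induct)
  case less
  show ?case
  proof (cases "m \<in> std_monoms D")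
    case True
    then have "Poly_Mapping.single m 1 \<in> std_space D"
      unfolding std_space_def by (intro pvs.span_base) auto
    then show ?thesis using prime_zero[OF P(1)] by (metis diff_self)
  next
    case False
    then consider x where "x \<in> Poly_Mapping.keys m" "x \<notin> Y"
      | i where "i \<in> I" "Poly_Mapping.lookup m (u i) \<noteq> 0" "Poly_Mapping.lookup m (v i) \<noteq> 0"
      using less.prems by (auto simp: std_monoms_def)
    then show ?thesis
    proof cases
      case 1
      obtain m' where m: "m = Poly_Mapping.single x 1 + m'"
        using monom_split 1(1) by (metis in_keys_iff)
      have "mVar x \<in> P" using 1 vanish P by auto
      then have "Poly_Mapping.single m 1 \<in> P"
        unfolding m single_add_one using prime_mult(2)[OF P(1)] by (simp add: mVar_def)
      moreover have "0 \<in> std_space D" by (rule pvs.subspace_0[OF subspace_std_space])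
      ultimately show ?thesis by (intro bexI[of _ 0]) auto
    next
      case 2
      obtain m1 where m1: "m = Poly_Mapping.single (u i) 1 + m1" using monom_split 2(2) by metis
      have ne: "u i \<noteq> v i" using inj_uv 2 by blast
      then have "Poly_Mapping.lookup m1 (v i) \<noteq> 0"
        using 2 by (simp add: m1 lookup_add lookup_single)
      then obtain m2 where m2: "m1 = Poly_Mapping.single (v i) 1 + m2" using monom_split by metis
      obtain c r where cr: "c \<noteq> 0" "\<And>m. m \<in> Poly_Mapping.keys r \<Longrightarrow> mwt w m < w (u i) + w (v i)"
        and g: "mConst c * (mVar (u i) * mVar (v i)) + r \<in> G" using leading[OF 2(1)] by blast
      let ?n = "Poly_Mapping.single m2 1 :: 'x mpoly"
      let ?f = "mConst (- 1 / c) * (r * ?n)"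
      have wm: "mwt w m = w (u i) + w (v i) + mwt w m2" by (simp add: m1 m2 mwt_add)
      have m_eq: "Poly_Mapping.single m 1 = mVar (u i) * mVar (v i) * ?n"
        by (simp add: m1 m2 mVar_def mult_single flip: single_add_one) (simp add: add.assoc)
      have inv: "mConst (1 / c) * mConst c = (1 :: 'x mpoly)"
        using cr by (simp flip: mConst_mult)
      have "mConst (1 / c) * ?n * (mConst c * (mVar (u i) * mVar (v i)) + r)
          = (mConst (1 / c) * mConst c) * (mVar (u i) * mVar (v i) * ?n) + mConst (1 / c) * (r * ?n)"
        by (simp add: algebra_simps)
      also have "\<dots> = Poly_Mapping.single m 1 - ?f"
        unfolding inv m_eq using mConst_uminus[of "1 / c", where ?'a = 'x] by simp
      finally have "Poly_Mapping.single m 1 - ?f \<in> P"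
        using prime_mult(1)[OF P(1)] g P(2) by (metis subsetD)
      moreover have "\<exists>s\<in>std_space D. ?f - s \<in> P"
      proof (rule reduce_combination[OF P(1) subspace_std_space])
        fix n assume "n \<in> Poly_Mapping.keys ?f"
        then have "n \<in> Poly_Mapping.keys (r * ?n)"
          by (auto simp: in_keys_iff simp flip: pscale_eq_mConst_mult)
        then obtain m' where "m' \<in> Poly_Mapping.keys r" "n = m' + m2"
          using Poly_Mapping.keys_mult[of r ?n] by auto
        then have "mwt w n < mwt w m" using cr(2)[of m'] by (simp add: mwt_add wm)
        then show "\<exists>r\<in>std_space D. Poly_Mapping.single n 1 - r \<in> P"
          using less by auto
      qed
      then obtain s where "s \<in> std_space D" "?f - s \<in> P" by blast
      ultimately show ?thesis
        using prime_add[OF P(1), of "Poly_Mapping.single m 1 - ?f" "?f - s"]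
        by (intro bexI[of _ s]) auto
    qed
  qed
qed

lemma wt_le_reduction:
  assumes "prime_ideal_set P" "G \<subseteq> P" "f \<in> wt_le w D"
  shows "\<exists>r\<in>std_space D. f - r \<in> P"
  by (rule reduce_combination[OF assms(1) subspace_std_space])
     (use assms monom_reduction in \<open>auto simp: wt_le_def\<close>)

text \<open>A standard monomial misses \<open>u i\<close> for the i in some \<open>A\<close> and
  \<open>v i\<close> for the other i. For each of the 2 ^ card I choices of \<open>A\<close> there
  remain card Y - card I variables, with exponents at most \<open>D\<close> because the weights on
  \<open>Y\<close> are at least 1.\<close>

lemma card_std_monoms:
  "finite (std_monoms D)" "card (std_monoms D) \<le> 2 ^ card I * Suc D ^ (card Y - card I)"
proof -
  let ?Y = "\<lambda>A. Y - u ` A - v ` (I - A)"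
  let ?B = "\<lambda>A. {m :: 'x \<Rightarrow>\<^sub>0 nat. Poly_Mapping.keys m \<subseteq> ?Y A \<and> (\<forall>x. Poly_Mapping.lookup m x \<le> D)}"
  have sub: "std_monoms D \<subseteq> (\<Union>A\<in>Pow I. ?B A)"
  proof
    fix m assume m: "m \<in> std_monoms D"
    have "Poly_Mapping.lookup m x \<le> D" for x
    proof (cases "x \<in> Poly_Mapping.keys m")
      case True
      then have "w x \<ge> 1" using m w_pos[of x] by (auto simp: std_monoms_def)
      then show ?thesis using lookup_le_mwt[of w x m] m by (auto simp: std_monoms_def)
    qed (simp add: in_keys_iff)
    moreover have "Poly_Mapping.keys m \<subseteq> ?Y {i \<in> I. Poly_Mapping.lookup m (u i) = 0}"
      using m by (auto simp: std_monoms_def in_keys_iff)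
    ultimately show "m \<in> (\<Union>A\<in>Pow I. ?B A)"
      by (intro UN_I[of "{i \<in> I. Poly_Mapping.lookup m (u i) = 0}"]) auto
  qed
  have fin: "finite (\<Union>A\<in>Pow I. ?B A)"
    using finite_Y finite_I by (intro finite_UN_I card_bounded_monoms(1)) auto
  show "finite (std_monoms D)" using sub fin by (rule finite_subset)
  have "card (std_monoms D) \<le> card (\<Union>A\<in>Pow I. ?B A)" by (rule card_mono[OF fin sub])
  also have "\<dots> \<le> (\<Sum>A\<in>Pow I. card (?B A))" by (rule card_UN_le) (use finite_I in auto)
  also have "\<dots> \<le> (\<Sum>A\<in>Pow I. Suc D ^ (card Y - card I))"
  proof (rule sum_mono)
    fix A assume "A \<in> Pow I"
    then have A: "A \<subseteq> I" by auto
    have fins: "finite A" "finite (I - A)" using A finite_I finite_subset by auto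
    have sub: "u ` A \<union> v ` (I - A) \<subseteq> Y" using uv_Y A by blast
    have "card (u ` A \<union> v ` (I - A)) = card (u ` A) + card (v ` (I - A))"
      using inj_uv(3) A fins by (intro card_Un_disjoint) auto
    also have "\<dots> = card A + card (I - A)"
      using inj_uv A by (metis card_image inj_on_subset Diff_subset)
    also have "\<dots> = card I" using A finite_I by (metis card_Un_disjoint Diff_disjoint Un_Diff_cancel Un_absorb1 fins)
    finally have "card (Y - (u ` A \<union> v ` (I - A))) = card Y - card I"
      using fins by (subst card_Diff_subset[OF _ sub]) simp_all
    moreover have "?Y A = Y - (u ` A \<union> v ` (I - A))" by auto
    ultimately have "card (?Y A) = card Y - card I" by simp
    then show "card (?B A) \<le> Suc D ^ (card Y - card I)"
      using card_bounded_monoms(2)[of "?Y A" D] finite_Y by auto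
  qed
  also have "\<dots> = 2 ^ card I * Suc D ^ (card Y - card I)"
    using finite_I by (simp add: card_Pow)
  finally show "card (std_monoms D) \<le> 2 ^ card I * Suc D ^ (card Y - card I)" .
qed

text \<open>The Suc T ^ m products of the \<open>f k\<close> with exponents at most \<open>T\<close>
  are independent modulo \<open>P 0\<close>, and so are their standard remainders. These lie in the
  span of the standard monomials of weight at most m * (T * e).\<close>

lemma prime_chain_count:
  assumes P: "\<And>k. k \<le> m \<Longrightarrow> prime_ideal_set (P k)" "\<And>k. k \<le> m \<Longrightarrow> G \<subseteq> P k"
    and f: "\<And>k. k < m \<Longrightarrow> P k \<subseteq> P (Suc k)" "\<And>k. k < m \<Longrightarrow> f k \<in> P (Suc k) - P k"
      "\<And>k. k < m \<Longrightarrow> f k \<in> wt_le w e"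
  shows "Suc T ^ m \<le> 2 ^ card I * Suc (m * (T * e)) ^ (card Y - card I)"
proof -
  let ?D = "m * (T * e)"
  define A where "A = {as. set as \<subseteq> {..T} \<and> length as = m}"
  have fin: "finite A" unfolding A_def by (rule finite_lists_length_eq) auto
  have cA: "card A = Suc T ^ m" unfolding A_def by (subst card_lists_length_eq) auto
  have p0: "prime_ideal_set (P 0)" "G \<subseteq> P 0" using P by auto
  have "chain_monom f as \<in> wt_le w ?D" if "as \<in> A" for as
  proof -
    have "chain_monom f as \<in> wt_le w (\<Sum>i<length as. as ! i * e)"
      unfolding chain_monom_def
      by (intro wt_le_prod wt_le_power f) (use that in \<open>auto simp: A_def\<close>)
    moreover have "(\<Sum>i<length as. as ! i * e) \<le> (\<Sum>i<length as. T * e)"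
      using that by (intro sum_mono mult_right_mono) (auto simp: A_def subset_iff)
    ultimately show ?thesis using that wt_le_mono by (fastforce simp: A_def)
  qed
  then have "\<exists>r\<in>std_space ?D. chain_monom f as - r \<in> P 0" if "as \<in> A" for as
    using wt_le_reduction[OF p0] that by blast
  then obtain r where r: "\<And>as. as \<in> A \<Longrightarrow> r as \<in> std_space ?D"
      "\<And>as. as \<in> A \<Longrightarrow> chain_monom f as - r as \<in> P 0" by metis
  have indep: "(\<forall>as\<in>A. c as = 0)" if "(\<Sum>as\<in>A. pscale (c as) (r as)) = 0" for c
  proof (rule ccontr)
    assume ne: "\<not> (\<forall>as\<in>A. c as = 0)"
    let ?A = "{as \<in> A. c as \<noteq> 0}"
    have "(\<Sum>as\<in>A. mConst (c as) * (chain_monom f as - r as)) \<in> P 0"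
      using r by (intro prime_sum[OF p0(1)] prime_mult[OF p0(1)])
    moreover have "(\<Sum>as\<in>A. mConst (c as) * (chain_monom f as - r as))
        = (\<Sum>as\<in>A. mConst (c as) * chain_monom f as)"
      using that by (simp add: right_diff_distrib sum_subtractf pscale_eq_mConst_mult)
    moreover have "\<dots> = (\<Sum>as\<in>?A. mConst (c as) * chain_monom f as)"
      using fin by (intro sum.mono_neutral_right) auto
    moreover have "(\<Sum>as\<in>?A. mConst (c as) * chain_monom f as) \<notin> P 0"
      by (rule prime_chain_algebraically_independent[of m])
         (use P f ne fin in \<open>auto simp: A_def simp del: set_replicate_conv_if intro: finite_subset[OF _ fin]\<close>)
    ultimately show False by simp
  qed
  \<comment> \<open>Independence is a property of sets, so two indices with the same remainder have
    to be excluded separately; they would give the relation with coefficients 1 and -1.\<close>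
  have inj: "inj_on r A"
  proof (rule inj_onI, rule ccontr)
    fix a b assume ab: "a \<in> A" "b \<in> A" "r a = r b" "a \<noteq> b"
    let ?c = "\<lambda>x. if x = a then 1 else if x = b then -1 else 0 :: complex"
    have "(\<Sum>as\<in>A. pscale (?c as) (r as)) = (\<Sum>as\<in>{a, b}. pscale (?c as) (r as))"
      using ab fin by (intro sum.mono_neutral_right) auto
    also have "\<dots> = 0" using ab by simp
    finally show False using indep[of ?c] ab by auto
  qed
  have "pvs.independent (r ` A)"
  proof (rule pvs.independent_if_scalars_zero)
    fix c b assume "(\<Sum>b\<in>r ` A. pscale (c b) b) = 0" "b \<in> r ` A"
    then show "c b = 0" using indep[of "c \<circ> r"] by (auto simp: sum.reindex[OF inj])
  qed (use fin in auto)
  moreover have "r ` A \<subseteq> std_space ?D" using r by auto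
  ultimately have "card (r ` A) \<le> card ((\<lambda>m. Poly_Mapping.single m (1::complex)) ` std_monoms ?D)"
    unfolding std_space_def using card_std_monoms(1) pvs.independent_span_bound by blast
  also have "\<dots> \<le> card (std_monoms ?D)" by (rule card_image_le[OF card_std_monoms(1)])
  also have "\<dots> \<le> 2 ^ card I * Suc ?D ^ (card Y - card I)" by (rule card_std_monoms(2))
  finally show ?thesis by (simp add: card_image[OF inj] cA)
qed

theorem prime_chain_le:
  assumes "prime_chain G m"
  shows "m \<le> card Y - card I"
proof (rule ccontr)
  let ?n = "card Y - card I"
  assume "\<not> m \<le> ?n"
  then have m: "Suc ?n \<le> m" by simp
  obtain P where P: "\<And>k. k \<le> m \<Longrightarrow> prime_ideal_set (P k)" "\<And>k. k \<le> m \<Longrightarrow> G \<subseteq> P k"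
    and lt: "\<And>k. k < m \<Longrightarrow> P k \<subset> P (Suc k)"
    using assms by (auto simp: prime_chain_def)
  have "\<exists>f. f \<in> P (Suc k) - P k" if "k < m" for k using lt[OF that] by blast
  then obtain f where f: "\<And>k. k < m \<Longrightarrow> f k \<in> P (Suc k) - P k" by metis
  obtain D where D: "\<And>k. f k \<in> wt_le w (D k)" using ex_wt_le[of "f _" w] by metis
  \<comment> \<open>A common weight bound for the \<open>f k\<close>; the \<open>Suc\<close> makes m
    * e positive.\<close>
  define e where "e = Suc (\<Sum>k<m. D k)"
  have e: "f k \<in> wt_le w e" if "k < m" for k
    using D[of k] wt_le_mono[of "D k" e] member_le_sum[of k "{..<m}" D] that
    by (auto simp: e_def)
  have le: "P k \<subseteq> P (Suc k)" if "k < m" for k using lt[OF that] by blast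
  have count: "Suc T ^ m \<le> 2 ^ card I * Suc (m * (T * e)) ^ ?n" for T
    by (rule prime_chain_count[of m P f])
       (fact P f e le)+
  have me: "1 \<le> m * e" using m by (simp add: e_def)
  \<comment> \<open>With \<open>T\<close> equal to \<open>?C\<close> the count reads Suc ?C ^ m <=
    ?C * Suc ?C ^ n, where the factor 1 <= m * e absorbs the inner \<open>Suc\<close>. This fails as
    soon as m > n.\<close>
  let ?C = "2 ^ card I * (m * e) ^ ?n"
  have "Suc ?C * Suc ?C ^ ?n \<le> Suc ?C ^ m"
    using m by (metis power_Suc power_increasing le_numeral_extra(4) le_SucI plus_1_eq_Suc le_add1)
  also have "\<dots> \<le> 2 ^ card I * Suc (m * (?C * e)) ^ ?n" by (rule count)
  also have "\<dots> \<le> 2 ^ card I * ((m * e) * Suc ?C) ^ ?n"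
    using me by (intro mult_left_mono power_mono) (auto simp: algebra_simps)
  also have "\<dots> = ?C * Suc ?C ^ ?n" by (simp only: power_mult_distrib mult.assoc)
  finally show False by simp
qed

end


section \<open>Prime chains from a parametrization\<close>

definition mtrunc :: "nat \<Rightarrow> nat mpoly \<Rightarrow> nat mpoly" where
  "mtrunc j = msubst (\<lambda>i. if i < j then mVar i else 0)"

lemma mtrunc_mtrunc: "mtrunc i (mtrunc j f) = mtrunc (min i j) f"
  unfolding mtrunc_def msubst_msubst by (rule arg_cong[of _ _ "\<lambda>g. msubst g f"]) auto

lemma comm_ring_hom_mtrunc: "comm_ring_hom (mtrunc j)"
  unfolding mtrunc_def by (rule comm_ring_hom_msubst)

text \<open>\<open>Q k\<close> is the kernel of \<sigma> followed by setting the parameters from n -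
  k on to zero. For j = n - Suc k, the value \<delta> * mVar j survives the truncation at j + 1,
  since \<delta> involves only earlier parameters, and dies under the truncation at j; so
  consecutive kernels differ.\<close>

lemma prime_chain_parametrization:
  fixes \<sigma> :: "'x \<Rightarrow> nat mpoly"
  assumes G: "\<And>g. g \<in> G \<Longrightarrow> msubst \<sigma> g = 0"
    and param: "\<And>j. j < n \<Longrightarrow> \<exists>x \<delta>. \<sigma> x = \<delta> * mVar j \<and> \<delta> \<noteq> 0 \<and> mtrunc j \<delta> = \<delta>"
  shows "prime_chain G n"
proof -
  define Q where "Q k = {f. mtrunc (n - k) (msubst \<sigma> f) = 0}" for k
  have prime: "prime_ideal_set (Q k)" for k
  proof -
    interpret a: comm_ring_hom "msubst \<sigma>" by (rule comm_ring_hom_msubst)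
    interpret b: comm_ring_hom "mtrunc (n - k)" by (rule comm_ring_hom_mtrunc)
    have "comm_ring_hom (\<lambda>f. mtrunc (n - k) (msubst \<sigma> f))"
      by unfold_locales (auto simp: a.hom_add a.hom_mult b.hom_add b.hom_mult)
    from prime_ideal_set_kernel[OF this] show ?thesis by (simp add: Q_def)
  qed
  have GQ: "G \<subseteq> Q k" for k
    using G by (auto simp: Q_def mtrunc_def)
  have sub: "Q k \<subseteq> Q (Suc k)" for k
  proof
    fix f assume "f \<in> Q k"
    then have "mtrunc (n - Suc k) (mtrunc (n - k) (msubst \<sigma> f)) = mtrunc (n - Suc k) 0"
      by (simp add: Q_def)
    then show "f \<in> Q (Suc k)"
      unfolding mtrunc_mtrunc by (simp add: Q_def mtrunc_def min_def split: if_splits)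
  qed
  have "Q k \<noteq> Q (Suc k)" if k: "k < n" for k
  proof -
    let ?j = "n - Suc k"
    interpret b: comm_ring_hom "mtrunc i" for i by (rule comm_ring_hom_mtrunc)
    obtain x \<delta> where x: "\<sigma> x = \<delta> * mVar ?j" "\<delta> \<noteq> 0" "mtrunc ?j \<delta> = \<delta>"
      using param[of ?j] k by auto
    have \<delta>: "mtrunc (n - k) \<delta> = \<delta>"
      using mtrunc_mtrunc[of "n - k" ?j \<delta>] k x(3) by (simp add: min_absorb2)
    have "?j < n - k" using k by simp
    then have "mtrunc (n - k) (mVar ?j) = mVar ?j" unfolding mtrunc_def msubst_var by simp
    then have "mVar x \<notin> Q k"
      using x by (simp add: Q_def b.hom_mult \<delta>)
    moreover have "mVar x \<in> Q (Suc k)"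
      by (simp add: Q_def x b.hom_mult) (simp add: mtrunc_def)
    ultimately show ?thesis by blast
  qed
  then show ?thesis
    unfolding prime_chain_def using prime GQ sub by (intro exI[of _ Q]) blast
qed


section \<open>Representations of the path algebra\<close>

lemma mat_mult_assoc:
  "mat_mult S (mat_mult S A B) C = mat_mult S A (mat_mult S B (C :: _ \<Rightarrow> _ \<Rightarrow> 'b::comm_semiring_0))"
  unfolding mat_mult_def fun_eq_iff
  by (simp add: sum_distrib_left sum_distrib_right mult.assoc) (auto intro: sum.swap)

definition block_id :: "'v set \<Rightarrow> ('v \<Rightarrow> nat) \<Rightarrow> 'v \<Rightarrow> 'v \<times> nat \<Rightarrow> 'v \<times> nat \<Rightarrow> 'b::zero_neq_one" where
  "block_id I d v = (\<lambda>p q. if p = q \<and> p \<in> block_index I d \<and> fst p = v then 1 else 0)"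

text \<open>The recursion ends in the identity block of the final vertex, so that a trivial path
  acts as its idempotent and not as the full identity matrix.\<close>

primrec word_mat ::
  "'v set \<Rightarrow> ('v \<Rightarrow> nat) \<Rightarrow> ('e \<Rightarrow> 'v \<times> nat \<Rightarrow> 'v \<times> nat \<Rightarrow> 'b::comm_ring_1) \<Rightarrow> 'v \<Rightarrow> 'e list \<Rightarrow>
   'v \<times> nat \<Rightarrow> 'v \<times> nat \<Rightarrow> 'b" where
  "word_mat I d M v [] = block_id I d v"
| "word_mat I d M v (b # bs) = mat_mult (block_index I d) (M b) (word_mat I d M v bs)"

definition path_mat ::
  "'v set \<Rightarrow> ('v \<Rightarrow> nat) \<Rightarrow> ('e \<Rightarrow> 'v \<times> nat \<Rightarrow> 'v \<times> nat \<Rightarrow> 'b::comm_ring_1) \<Rightarrow> ('v, 'e) path \<Rightarrow>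
   'v \<times> nat \<Rightarrow> 'v \<times> nat \<Rightarrow> 'b" where
  "path_mat I d M x = word_mat I d M (snd (snd x)) (fst (snd x))"

definition path_rep ::
  "'v set \<Rightarrow> ('v \<Rightarrow> nat) \<Rightarrow> ('e \<Rightarrow> 'v \<times> nat \<Rightarrow> 'v \<times> nat \<Rightarrow> 'z mpoly) \<Rightarrow> (('v, 'e) path \<Rightarrow>\<^sub>0 complex) \<Rightarrow>
   'v \<times> nat \<Rightarrow> 'v \<times> nat \<Rightarrow> 'z mpoly" where
  "path_rep I d M f = (\<lambda>p q. \<Sum>x\<in>Poly_Mapping.keys f.
     mConst (Poly_Mapping.lookup f x) * path_mat I d M x p q)"

lemma path_rep_superset:
  assumes "finite S" "Poly_Mapping.keys f \<subseteq> S"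
  shows "path_rep I d M f p q = (\<Sum>x\<in>S. mConst (Poly_Mapping.lookup f x) * path_mat I d M x p q)"
  unfolding path_rep_def
  by (intro sum.mono_neutral_left) (use assms in \<open>auto simp: in_keys_iff\<close>)

lemma path_rep_single: "path_rep I d M (Poly_Mapping.single x c) p q = mConst c * path_mat I d M x p q"
  by (subst path_rep_superset[of "{x}"]) auto

lemma path_rep_add: "path_rep I d M (f + g) p q = path_rep I d M f p q + path_rep I d M g p q"
proof -
  let ?S = "Poly_Mapping.keys f \<union> Poly_Mapping.keys g"
  show ?thesis
    by (subst (1 2 3) path_rep_superset[of ?S])
       (use Poly_Mapping.keys_add[of f g] in
         \<open>auto simp: lookup_add mConst_add distrib_right sum.distrib\<close>)
qed

lemma path_rep_0 [simp]: "path_rep I d M 0 p q = 0"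
  by (simp add: path_rep_def)

lemma path_rep_uminus: "path_rep I d M (- f) p q = - path_rep I d M f p q"
  by (metis add.right_inverse path_rep_0 path_rep_add minus_unique)

lemma path_rep_diff: "path_rep I d M (f - g) p q = path_rep I d M f p q - path_rep I d M g p q"
  by (metis diff_conv_add_uminus path_rep_add path_rep_uminus)

lemma path_rep_sum: "path_rep I d M (sum f S) p q = (\<Sum>i\<in>S. path_rep I d M (f i) p q)"
  by (induction S rule: infinite_finite_induct) (auto simp: path_rep_add)

lemma pscale_single: "pscale c (Poly_Mapping.single x a) = Poly_Mapping.single x (c * a)"
  by (auto intro!: poly_mapping_eqI simp: lookup_single when_def)

lemma path_rep_pscale: "path_rep I d M (pscale c f) p q = mConst c * path_rep I d M f p q"
  by (induction f rule: poly_mapping_add_induct)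
     (auto simp: pvs.scale_right_distrib path_rep_add distrib_left path_rep_single mConst_mult mult.assoc
        pscale_single)

locale path_matrices = fin_digraph G for G :: "('v, 'e) pre_digraph" +
  fixes d :: "'v \<Rightarrow> nat" and M :: "'e \<Rightarrow> 'v \<times> nat \<Rightarrow> 'v \<times> nat \<Rightarrow> 'z mpoly"
  assumes M_support: "\<And>b p q. b \<in> arcs G \<Longrightarrow> M b p q \<noteq> 0 \<Longrightarrow>
    p \<in> block_index (verts G) d \<and> fst p = tail G b \<and> q \<in> block_index (verts G) d \<and> fst q = head G b"
begin

abbreviation "S \<equiv> block_index (verts G) d"
abbreviation "W \<equiv> word_mat (verts G) d M"
abbreviation "\<rho> \<equiv> path_rep (verts G) d M"

lemma finite_S: "finite S"
  by (simp add: block_index_def)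

lemma word_mat_support:
  assumes "awalk u bs v" "W v bs p q \<noteq> 0"
  shows "p \<in> S \<and> fst p = u \<and> q \<in> S \<and> fst q = v"
  using assms
proof (induction bs arbitrary: u p)
  case Nil
  then show ?case by (auto simp: block_id_def awalk_Nil_iff split: if_splits)
next
  case (Cons b bs)
  from Cons.prems(2) obtain k where "M b p k * W v bs k q \<noteq> 0"
    unfolding word_mat.simps mat_mult_def by (meson sum.not_neutral_contains_not_neutral)
  then have "M b p k \<noteq> 0" "W v bs k q \<noteq> 0" by auto
  moreover have "b \<in> arcs G" "u = tail G b" "awalk (head G b) bs v"
    using Cons.prems(1) by (auto simp: awalk_Cons_iff)
  ultimately show ?case using M_support Cons.IH by blast
qed

lemma block_id_mult:
  assumes "\<And>k. A k q \<noteq> 0 \<Longrightarrow> k \<in> S \<and> fst k = v"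
  shows "mat_mult S (block_id (verts G) d v) A p q = (A p q :: 'z mpoly)"
proof -
  have "mat_mult S (block_id (verts G) d v) A p q
      = (\<Sum>k\<in>S. if k = p then (if fst p = v then A p q else 0) else 0)"
    unfolding mat_mult_def by (intro sum.cong) (auto simp: block_id_def)
  then show ?thesis using assms[of p] finite_S by auto
qed

lemma mult_block_id:
  assumes "\<And>k. A p k \<noteq> 0 \<Longrightarrow> k \<in> S \<and> fst k = v"
  shows "mat_mult S A (block_id (verts G) d v) p q = (A p q :: 'z mpoly)"
proof -
  have "mat_mult S A (block_id (verts G) d v) p q
      = (\<Sum>k\<in>S. if k = q then (if fst q = v then A p q else 0) else 0)"
    unfolding mat_mult_def by (intro sum.cong) (auto simp: block_id_def)
  then show ?thesis using assms[of q] finite_S by auto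
qed

lemma word_mat_append:
  assumes "awalk v cs w"
  shows "W w (bs @ cs) = mat_mult S (W v bs) (W w cs)"
proof (induction bs)
  case Nil
  show ?case
    by (intro ext) (use word_mat_support[OF assms] in \<open>auto intro!: block_id_mult[symmetric]\<close>)
qed (simp add: mat_mult_assoc)

text \<open>For paths that do not compose, the matrix product vanishes as well: the middle index
  would have to lie in two different blocks.\<close>

lemma path_mat_mult:
  assumes "x \<in> paths G" "y \<in> paths G"
  shows "\<rho> (path_single_mult x y c) p q
    = mConst c * mat_mult S (path_mat (verts G) d M x) (path_mat (verts G) d M y) p q"
proof -
  obtain u bs v v' cs w where xy: "x = (u, bs, v)" "y = (v', cs, w)" by (metis prod_cases3)
  have aw: "awalk u bs v" "awalk v' cs w" using assms by (auto simp: xy paths_def)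
  show ?thesis
  proof (cases "v = v'")
    case True
    then show ?thesis
      using word_mat_append[OF aw(2), of bs]
      by (simp add: xy path_single_mult_def path_rep_single path_mat_def)
  next
    case False
    have "W v bs p k * W w cs k q = 0" for k
      using word_mat_support[OF aw(1), of p k] word_mat_support[OF aw(2), of k q] False
      by (cases "W v bs p k = 0"; cases "W w cs k q = 0") auto
    then show ?thesis using False
      by (simp add: xy path_single_mult_def path_mat_def mat_mult_def)
  qed
qed

lemma path_rep_mult:
  assumes f: "Poly_Mapping.keys f \<subseteq> paths G" and g: "Poly_Mapping.keys g \<subseteq> paths G"
  shows "\<rho> (path_mult f g) p q = mat_mult S (\<rho> f) (\<rho> g) p q"
proof -
  let ?P = "path_mat (verts G) d M" and ?l = Poly_Mapping.lookup
  have "\<rho> (path_mult f g) p q = (\<Sum>x\<in>Poly_Mapping.keys f. \<Sum>y\<in>Poly_Mapping.keys g.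
      mConst (?l f x * ?l g y) * mat_mult S (?P x) (?P y) p q)"
    unfolding path_mult_def path_rep_sum
    by (intro sum.cong refl path_mat_mult) (use f g in auto)
  also have "\<dots> = (\<Sum>x\<in>Poly_Mapping.keys f. \<Sum>y\<in>Poly_Mapping.keys g. \<Sum>k\<in>S.
      (mConst (?l f x) * ?P x p k) * (mConst (?l g y) * ?P y k q))"
    by (intro sum.cong refl) (simp add: mat_mult_def mConst_mult sum_distrib_left algebra_simps)
  also have "\<dots> = (\<Sum>x\<in>Poly_Mapping.keys f. \<Sum>k\<in>S. \<Sum>y\<in>Poly_Mapping.keys g.
      (mConst (?l f x) * ?P x p k) * (mConst (?l g y) * ?P y k q))"
    by (intro sum.cong refl sum.swap)
  also have "\<dots> = (\<Sum>k\<in>S. \<Sum>x\<in>Poly_Mapping.keys f. \<Sum>y\<in>Poly_Mapping.keys g.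
      (mConst (?l f x) * ?P x p k) * (mConst (?l g y) * ?P y k q))"
    by (rule sum.swap)
  also have "\<dots> = mat_mult S (\<rho> f) (\<rho> g) p q"
    unfolding mat_mult_def path_rep_def by (simp only: sum_product)
  finally show ?thesis .
qed

lemma path_rep_R_to_F:
  "\<rho> (R_to_F G r) p q = mConst (R_to_E (verts G) d r p q)"
proof -
  have "\<rho> (R_to_F G r) p q = (\<Sum>i\<in>verts G. mConst (r i) * block_id (verts G) d i p q)"
    unfolding R_to_F_def path_rep_sum path_rep_pscale vertex_idem_def path_rep_single
    by (simp add: path_mat_def)
  also have "\<dots> = (\<Sum>i\<in>verts G. if i = fst p then (if p = q \<and> p \<in> S then mConst (r (fst p)) else 0) else 0)"
    by (intro sum.cong) (auto simp: block_id_def)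
  also have "\<dots> = mConst (R_to_E (verts G) d r p q)"
    by (auto simp: R_to_E_def block_index_def)
  finally show ?thesis .
qed

lemma path_rep_arc_elt:
  assumes "b \<in> arcs G"
  shows "\<rho> (arc_elt G b) p q = M b p q"
  unfolding arc_elt_def path_rep_single path_mat_def
  using M_support[OF assms] by (simp add: mult_block_id)

lemma path_rep_support:
  assumes "Poly_Mapping.keys f \<subseteq> paths G" "\<rho> f p q \<noteq> 0"
  shows "p \<in> S" "q \<in> S"
proof -
  obtain x where x: "x \<in> Poly_Mapping.keys f" "path_mat (verts G) d M x p q \<noteq> 0"
    using assms(2) unfolding path_rep_def by (metis (no_types, lifting) mult_zero_right sum.neutral)
  then have "x \<in> paths G" using assms(1) by auto
  then show "p \<in> S" "q \<in> S"
    using x(2) word_mat_support[of "fst x" "fst (snd x)" "snd (snd x)" p q]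
    by (auto simp: paths_def path_mat_def)
qed

end


section \<open>Prime ideals of the coordinate ring of the representation scheme\<close>

lemma carrier_FactRing_cosets:
  "a \<in> carrier (R Quot K) \<Longrightarrow> \<exists>f\<in>carrier R. a = K +>\<^bsub>R\<^esub> f"
  by (auto simp: FactRing_simps)

lemma zero_FactRing: "\<zero>\<^bsub>R Quot K\<^esub> = K"
  by (simp add: FactRing_def)

lemma quot_prime_chain_iff:
  assumes "cring R" "ideal K R"
  shows "(\<exists>P. (\<forall>k\<le>n. primeideal (P k) (R Quot K)) \<and> (\<forall>k<n. P k \<subset> P (Suc k))) \<longleftrightarrow>
    (\<exists>P. (\<forall>k\<le>n. primeideal (P k) R \<and> K \<subseteq> P k) \<and> (\<forall>k<n. P k \<subset> P (Suc k)))"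
    (is "?L \<longleftrightarrow> ?R")
proof
  interpret R: cring R by fact
  interpret K: ideal K R by fact
  interpret \<pi>: ring_hom_ring R "R Quot K" "(+>\<^bsub>R\<^esub>) K" by (rule K.rcos_ring_hom_ring)
  have surj: "\<exists>f\<in>carrier R. a = K +>\<^bsub>R\<^esub> f" if "a \<in> carrier (R Quot K)" for a
    using carrier_FactRing_cosets that by blast
  {
    assume ?L
    then obtain P where *: "(\<forall>k\<le>n. primeideal (P k) (R Quot K)) \<and> (\<forall>k<n. P k \<subset> P (Suc k))"
      by (rule exE)
    note P = conjunct1[OF *, rule_format] and lt = conjunct2[OF *, rule_format]
    define T where "T k = {f \<in> carrier R. K +>\<^bsub>R\<^esub> f \<in> P k}" for k
    have "primeideal (T k) R" if "k \<le> n" for k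
      unfolding T_def by (rule \<pi>.primeideal_vimage[OF \<open>cring R\<close> P[OF that]])
    moreover have "K \<subseteq> T k" if k: "k \<le> n" for k
    proof
      fix f assume f: "f \<in> K"
      interpret Pk: primeideal "P k" "R Quot K" by (rule P[OF k])
      have "K +>\<^bsub>R\<^esub> f = K" using f by (rule K.a_rcos_const)
      also have "\<dots> = \<zero>\<^bsub>R Quot K\<^esub>" by (rule zero_FactRing[symmetric])
      finally show "f \<in> T k"
        using K.Icarr[OF f] additive_subgroup.zero_closed[OF Pk.is_additive_subgroup]
        by (simp add: T_def)
    qed
    moreover have "T k \<subset> T (Suc k)" if k: "k < n" for k
    proof -
      obtain a where a: "a \<in> P (Suc k)" "a \<notin> P k" using lt[OF k] by blast
      interpret Pk: primeideal "P (Suc k)" "R Quot K" using P k by simp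
      obtain f where "f \<in> carrier R" "a = K +>\<^bsub>R\<^esub> f" using surj Pk.Icarr[OF a(1)] by blast
      then have "f \<in> T (Suc k) - T k" using a by (simp add: T_def)
      then show ?thesis using lt[OF k] by (auto simp: T_def)
    qed
    ultimately show ?R by blast
  next
    assume ?R
    then obtain P where *: "(\<forall>k\<le>n. primeideal (P k) R \<and> K \<subseteq> P k) \<and> (\<forall>k<n. P k \<subset> P (Suc k))"
      by (rule exE)
    note P = conjunct1[OF *, rule_format, THEN conjunct1] conjunct1[OF *, rule_format, THEN conjunct2]
      and lt = conjunct2[OF *, rule_format]
    define T where "T k = (+>\<^bsub>R\<^esub>) K ` P k" for k
    \<comment> \<open>Because \<open>K\<close> is contained in \<open>P k\<close>, membership does
      not depend on the representative of the coset.\<close>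
    have T_iff: "K +>\<^bsub>R\<^esub> f \<in> T k \<longleftrightarrow> f \<in> P k" if k: "k \<le> n" and f: "f \<in> carrier R" for k f
    proof
      interpret Pk: primeideal "P k" R by (rule P(1)[OF k])
      assume "K +>\<^bsub>R\<^esub> f \<in> T k"
      then obtain g where g: "g \<in> P k" "K +>\<^bsub>R\<^esub> f = K +>\<^bsub>R\<^esub> g" by (auto simp: T_def)
      then have "f \<ominus>\<^bsub>R\<^esub> g \<in> K"
        using R.quotient_eq_iff_same_a_r_cos[OF \<open>ideal K R\<close> f] Pk.Icarr by blast
      then have "(f \<ominus>\<^bsub>R\<^esub> g) \<oplus>\<^bsub>R\<^esub> g \<in> P k"
        using P(2)[OF k] g(1) additive_subgroup.a_closed[OF Pk.is_additive_subgroup] by blast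
      then show "f \<in> P k" using f Pk.Icarr[OF g(1)]
        by (simp add: a_minus_def R.a_assoc R.l_neg)
    qed (simp add: T_def)
    have "primeideal (T k) (R Quot K)" if k: "k \<le> n" for k
    proof (rule primeidealI)
      interpret Pk: primeideal "P k" R by (rule P(1)[OF k])
      show "ideal (T k) (R Quot K)"
        unfolding T_def by (rule R.ring_ideal_imp_quot_ideal[OF \<open>ideal K R\<close> Pk.is_ideal])
      show "cring (R Quot K)" by (rule K.quotient_is_cring[OF \<open>cring R\<close>])
      show "carrier (R Quot K) \<noteq> T k"
        using T_iff[OF k] Pk.I_notcarr Pk.Icarr \<pi>.hom_closed by blast
      fix a b assume ab: "a \<in> carrier (R Quot K)" "b \<in> carrier (R Quot K)"
        and prod: "a \<otimes>\<^bsub>R Quot K\<^esub> b \<in> T k"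
      obtain f g where fg: "f \<in> carrier R" "a = K +>\<^bsub>R\<^esub> f" "g \<in> carrier R" "b = K +>\<^bsub>R\<^esub> g"
        using surj ab by meson
      then have "f \<otimes>\<^bsub>R\<^esub> g \<in> P k" using prod T_iff[OF k] by (simp flip: \<pi>.hom_mult)
      then show "a \<in> T k \<or> b \<in> T k" using fg T_iff[OF k] Pk.I_prime by blast
    qed
    moreover have "T k \<subset> T (Suc k)" if k: "k < n" for k
    proof -
      obtain f where f: "f \<in> P (Suc k)" "f \<notin> P k" using lt[OF k] by blast
      interpret Pk: primeideal "P (Suc k)" R using P k by simp
      have "K +>\<^bsub>R\<^esub> f \<in> T (Suc k) - T k" using T_iff Pk.Icarr f k by simp
      then show ?thesis using lt[OF k] by (auto simp: T_def)
    qed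
    ultimately show ?L by blast
  }
qed

section \<open>Polynomial rings in a given set of variables and preimages of primes under
  substitution\<close>

lemma mpoly_ring_simps:
  "x \<otimes>\<^bsub>mpoly_ring X\<^esub> y = x * y" "x \<oplus>\<^bsub>mpoly_ring X\<^esub> y = x + y"
  "\<zero>\<^bsub>mpoly_ring X\<^esub> = 0" "\<one>\<^bsub>mpoly_ring X\<^esub> = 1"
  by (simp_all add: mpoly_ring_def)

lemma mpoly_ring_a_inv:
  assumes "f \<in> carrier (mpoly_ring X)"
  shows "\<ominus>\<^bsub>mpoly_ring X\<^esub> f = - f"
proof -
  interpret cring "mpoly_ring X" by (rule mpoly_ring_cring)
  have "- f \<in> carrier (mpoly_ring X)" using assms by (simp add: mpoly_ring_def keys_uminus)
  then show ?thesis using assms by (intro minus_equality) (auto simp: mpoly_ring_simps)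
qed

lemma mpoly_ring_closed:
  "mConst c \<in> carrier (mpoly_ring X)"
  "x \<in> X \<Longrightarrow> mVar x \<in> carrier (mpoly_ring X)"
  "f \<in> carrier (mpoly_ring X) \<Longrightarrow> g \<in> carrier (mpoly_ring X) \<Longrightarrow> f + g \<in> carrier (mpoly_ring X)"
  "f \<in> carrier (mpoly_ring X) \<Longrightarrow> g \<in> carrier (mpoly_ring X) \<Longrightarrow> f * g \<in> carrier (mpoly_ring X)"
  "f \<in> carrier (mpoly_ring X) \<Longrightarrow> - f \<in> carrier (mpoly_ring X)"
  "f \<in> carrier (mpoly_ring X) \<Longrightarrow> g \<in> carrier (mpoly_ring X) \<Longrightarrow> f - g \<in> carrier (mpoly_ring X)"
proof -
  interpret cring "mpoly_ring X" by (rule mpoly_ring_cring)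
  show "mConst c \<in> carrier (mpoly_ring X)" by (simp add: mpoly_ring_def mConst_def)
  show "x \<in> X \<Longrightarrow> mVar x \<in> carrier (mpoly_ring X)" by (simp add: mpoly_ring_def mVar_def)
  assume f: "f \<in> carrier (mpoly_ring X)"
  then show neg: "- f \<in> carrier (mpoly_ring X)" using mpoly_ring_a_inv a_inv_closed by metis
  assume g: "g \<in> carrier (mpoly_ring X)"
  show "f + g \<in> carrier (mpoly_ring X)" "f * g \<in> carrier (mpoly_ring X)"
    using f g a_closed m_closed by (simp_all add: mpoly_ring_simps)
  show "f - g \<in> carrier (mpoly_ring X)"
    using minus_closed[OF f g] mpoly_ring_a_inv[OF g] by (simp add: a_minus_def mpoly_ring_simps)
qed

lemma mpoly_ring_sum_closed:
  "(\<And>i. i \<in> S \<Longrightarrow> f i \<in> carrier (mpoly_ring X)) \<Longrightarrow> sum f S \<in> carrier (mpoly_ring X)"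
  by (induction S rule: infinite_finite_induct)
     (use mpoly_ring_closed(1)[of 0 X] in \<open>auto intro: mpoly_ring_closed\<close>)

lemma msubst_closed:
  "(\<And>x. g x \<in> carrier (mpoly_ring X)) \<Longrightarrow> msubst g f \<in> carrier (mpoly_ring X)"
  by (induction f rule: mpoly_induct) (auto simp: msubst_add msubst_mult intro: mpoly_ring_closed)

text \<open>Setting the variables outside \<open>X\<close> to zero fixes \<open>f\<close> and maps
  every polynomial into the ring. Hence the induction over all polynomials can be run on the
  images.\<close>

lemma mpoly_ring_induct [consumes 1, case_names const var add mult]:
  assumes f: "f \<in> carrier (mpoly_ring X)"
    and const: "\<And>c. P (mConst c)" and var: "\<And>x. x \<in> X \<Longrightarrow> P (mVar x)"
    and add: "\<And>f g. f \<in> carrier (mpoly_ring X) \<Longrightarrow> g \<in> carrier (mpoly_ring X) \<Longrightarrow> P f \<Longrightarrow> P g \<Longrightarrow> P (f + g)"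
    and mult: "\<And>f g. f \<in> carrier (mpoly_ring X) \<Longrightarrow> g \<in> carrier (mpoly_ring X) \<Longrightarrow> P f \<Longrightarrow> P g \<Longrightarrow> P (f * g)"
  shows "P f"
proof -
  let ?h = "\<lambda>x. if x \<in> X then mVar x else 0"
  have "mConst c * monom_eval ?h m = mConst c * monom_eval mVar m" if "m \<in> Poly_Mapping.keys f" for m c
    using f that unfolding monom_eval_def mpoly_ring_def
    by (intro arg_cong2[of _ _ _ _ "(*)"] prod.cong) auto
  then have "msubst ?h f = msubst mVar f" unfolding msubst_def by (intro sum.cong) auto
  then have f_eq: "msubst ?h f = f" by (simp add: msubst_mVar)
  have h: "?h x \<in> carrier (mpoly_ring X)" for x
    using mpoly_ring_closed(1)[of 0 X] by (auto intro: mpoly_ring_closed)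
  have "P (msubst ?h g)" for g
  proof (induction g rule: mpoly_induct)
    case (var x)
    then show ?case using const[of 0] assms(3)[of x] by simp
  qed (use const in \<open>auto simp: msubst_add msubst_mult intro!: assms(4,5) msubst_closed[OF h]\<close>)
  from this[of f] show ?thesis by (simp add: f_eq)
qed

lemma ideal_mpoly_ring_closed:
  assumes "ideal K (mpoly_ring X)" "f \<in> K" "g \<in> K"
  shows "f + g \<in> K" "f - g \<in> K" "- f \<in> K"
    and "h \<in> carrier (mpoly_ring X) \<Longrightarrow> h * f \<in> K" "h \<in> carrier (mpoly_ring X) \<Longrightarrow> f * h \<in> K"
proof -
  interpret ideal K "mpoly_ring X" by fact
  note a_closed = additive_subgroup.a_closed[OF is_additive_subgroup]
    and a_inv_closed = additive_subgroup.a_inv_closed[OF is_additive_subgroup]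
  show "f + g \<in> K" using a_closed[OF assms(2,3)] by (simp add: mpoly_ring_simps)
  show "- f \<in> K" using a_inv_closed[OF assms(2)] Icarr[OF assms(2)] by (simp add: mpoly_ring_a_inv)
  have "- g \<in> K" using a_inv_closed[OF assms(3)] Icarr[OF assms(3)] by (simp add: mpoly_ring_a_inv)
  from a_closed[OF assms(2) this] show "f - g \<in> K" by (simp add: mpoly_ring_simps)
  show "h \<in> carrier (mpoly_ring X) \<Longrightarrow> h * f \<in> K" "h \<in> carrier (mpoly_ring X) \<Longrightarrow> f * h \<in> K"
    using I_l_closed[OF assms(2), of h] I_r_closed[OF assms(2), of h] by (simp_all add: mpoly_ring_simps)
qed

text \<open>With \<open>prime_ideal_set_vimage_msubst\<close> this passes between the two notions of
  prime ideal, in the direction opposite to a substitution.\<close>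

lemma primeideal_vimage_msubst:
  assumes P: "prime_ideal_set P"
  shows "primeideal {f \<in> carrier (mpoly_ring X). msubst \<theta> f \<in> P} (mpoly_ring X)" (is "primeideal ?I ?R")
proof (rule primeidealI2)
  interpret cring ?R by (rule mpoly_ring_cring)
  show "cring ?R" by (rule mpoly_ring_cring)
  show "additive_subgroup ?I ?R"
  proof (intro additive_subgroupI subgroup.intro)
    fix x assume "x \<in> ?I"
    then have "\<ominus>\<^bsub>?R\<^esub> x \<in> ?I"
      using prime_uminus[OF P] mpoly_ring_closed(5)
      by (auto simp: mpoly_ring_a_inv msubst_uminus)
    then show "inv\<^bsub>add_monoid ?R\<^esub> x \<in> ?I" by (simp only: a_inv_def)
  qed (use prime_zero[OF P] zero_closed in
      \<open>auto simp: mpoly_ring_simps msubst_add intro: prime_add[OF P] mpoly_ring_closed\<close>)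
  show "carrier ?R \<noteq> ?I"
  proof
    assume "carrier ?R = ?I"
    then have "1 \<in> ?I" using one_closed by (simp add: mpoly_ring_simps)
    then show False using prime_one[OF P] by simp
  qed
qed (use prime_multD[OF P] in
    \<open>auto simp: mpoly_ring_simps msubst_mult intro: prime_mult[OF P] mpoly_ring_closed\<close>)

lemma prime_ideal_set_vimage_msubst:
  assumes P: "primeideal P (mpoly_ring X)" and \<psi>: "\<And>x. \<psi> x \<in> carrier (mpoly_ring X)"
  shows "prime_ideal_set {f. msubst \<psi> f \<in> P}"
proof -
  interpret primeideal P "mpoly_ring X" by fact
  note closed = msubst_closed[of \<psi> X, OF \<psi>]
  have "1 \<notin> P" using one_imp_carrier I_notcarr by (auto simp: mpoly_ring_simps)
  moreover have "0 \<in> P" using additive_subgroup.zero_closed[OF is_additive_subgroup] by (simp add: mpoly_ring_simps)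
  ultimately show ?thesis
    using ideal_mpoly_ring_closed[OF is_ideal] I_prime closed
    by (auto simp: prime_ideal_set_def msubst_add msubst_mult mpoly_ring_simps)
qed


section \<open>The coordinate ring in terms of the arc entries\<close>

definition gen_mat ::
  "('v, 'e) pre_digraph \<Rightarrow> ('v \<Rightarrow> nat) \<Rightarrow> 'e \<Rightarrow> 'v \<times> nat \<Rightarrow> 'v \<times> nat \<Rightarrow> ('e \<times> nat \<times> nat) mpoly" where
  "gen_mat G d b p q = (if p \<in> block_index (verts G) d \<and> fst p = tail G b \<and>
     q \<in> block_index (verts G) d \<and> fst q = head G b then mVar (b, snd p, snd q) else 0)"

definition arc_entries :: "('v, 'e) pre_digraph \<Rightarrow> ('v \<Rightarrow> nat) \<Rightarrow> ('e \<times> nat \<times> nat) set" where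
  "arc_entries G d = {(b, k, l). b \<in> arcs G \<and> k < d (tail G b) \<and> l < d (head G b)}"

locale rep_presentation = fin_digraph G for G :: "('v, 'e) pre_digraph" +
  fixes d :: "'v \<Rightarrow> nat" and L :: "(('v, 'e) path \<Rightarrow>\<^sub>0 complex) set"
  assumes L_carrier: "L \<subseteq> carrier (path_algebra G)"
begin

sublocale path_matrices G d "gen_mat G d"
  by unfold_locales (auto simp: gen_mat_def split: if_splits)

abbreviation "F \<equiv> path_algebra G"
abbreviation "K \<equiv> genideal F L"
abbreviation "A \<equiv> quot_alg G L"
abbreviation "\<pi> f \<equiv> K +>\<^bsub>F\<^esub> f"
abbreviation "\<eta> \<equiv> R_to_quot_alg G L"
abbreviation "X \<equiv> carrier A \<times> S \<times> S"
abbreviation "PX \<equiv> mpoly_ring X"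
abbreviation "rel \<equiv> rep_relations (verts G) d A \<eta>"
abbreviation "KX \<equiv> genideal PX rel"

text \<open>The polynomial type has a variable for every triple, so those that are not entries of an
  arc matrix are put among the generators to remove them from the quotient.\<close>

definition rep_gens :: "('e \<times> nat \<times> nat) mpoly set" where
  "rep_gens = {\<rho> f p q | f p q. f \<in> L \<and> p \<in> S \<and> q \<in> S} \<union> {mVar y | y. y \<notin> arc_entries G d}"

lemma ring_F: "Ring.ring F"
  by (rule path_algebra_ring[OF fin_digraph_axioms])

lemma F_simps:
  "f \<in> carrier F \<longleftrightarrow> Poly_Mapping.keys f \<subseteq> paths G" "f \<otimes>\<^bsub>F\<^esub> g = path_mult f g" "f \<oplus>\<^bsub>F\<^esub> g = f + g"
  "\<zero>\<^bsub>F\<^esub> = 0"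
  by (simp_all add: path_algebra_def)

lemma F_closed:
  "f \<in> carrier F \<Longrightarrow> g \<in> carrier F \<Longrightarrow> f + g \<in> carrier F"
  "f \<in> carrier F \<Longrightarrow> g \<in> carrier F \<Longrightarrow> path_mult f g \<in> carrier F"
  "f \<in> carrier F \<Longrightarrow> - f \<in> carrier F"
  "R_to_F G r \<in> carrier F"
  "b \<in> arcs G \<Longrightarrow> arc_elt G b \<in> carrier F"
proof -
  interpret ring F by (rule ring_F)
  show "f \<in> carrier F \<Longrightarrow> g \<in> carrier F \<Longrightarrow> f + g \<in> carrier F"
    using a_closed[of f g] by (simp add: F_simps(3))
  show "f \<in> carrier F \<Longrightarrow> g \<in> carrier F \<Longrightarrow> path_mult f g \<in> carrier F"
    using m_closed[of f g] by (simp add: F_simps(2))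
  show "f \<in> carrier F \<Longrightarrow> - f \<in> carrier F" by (simp add: F_simps(1) keys_uminus)
  show "R_to_F G r \<in> carrier F" by (rule R_to_F_carrier[OF fin_digraph_axioms])
  show "b \<in> arcs G \<Longrightarrow> arc_elt G b \<in> carrier F"
    by (auto simp: F_simps arc_elt_def paths_def intro: arc_implies_awalk)
qed

lemma F_a_inv:
  assumes "f \<in> carrier F"
  shows "\<ominus>\<^bsub>F\<^esub> f = - f"
proof -
  interpret ring F by (rule ring_F)
  show ?thesis using assms by (intro minus_equality) (auto simp: F_simps(3,4) F_closed)
qed

lemma ideal_K: "ideal K F"
  by (rule ring.genideal_ideal[OF ring_F L_carrier])

lemma quotient_closed: "f \<in> carrier F \<Longrightarrow> \<pi> f \<in> carrier A"
  using ring_hom_closed[OF ideal.rcos_ring_hom[OF ideal_K]] unfolding quot_alg_def by blast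

lemma quotient_hom:
  assumes "f \<in> carrier F" "g \<in> carrier F"
  shows "\<pi> (f + g) = \<pi> f \<oplus>\<^bsub>A\<^esub> \<pi> g" "\<pi> (path_mult f g) = \<pi> f \<otimes>\<^bsub>A\<^esub> \<pi> g"
  using ring_hom_add[OF ideal.rcos_ring_hom[OF ideal_K] assms]
    ring_hom_mult[OF ideal.rcos_ring_hom[OF ideal_K] assms]
  unfolding quot_alg_def F_simps by blast+

lemma eta_eq: "\<eta> r = \<pi> (R_to_F G r)"
  by (simp add: R_to_quot_alg_def)

lemma quotient_eqD:
  assumes "f \<in> carrier F" "g \<in> carrier F" "\<pi> f = \<pi> g"
  shows "f - g \<in> K"
proof -
  interpret ring F by (rule ring_F)
  have "f \<ominus>\<^bsub>F\<^esub> g \<in> K" using quotient_eq_iff_same_a_r_cos[OF ideal_K assms(1,2)] assms(3) by blast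
  then show ?thesis using assms by (simp add: a_minus_def F_a_inv F_simps(3))
qed

text \<open>An arbitrary representative: it respects sums and products only modulo \<open>K\<close>.
  That is enough, since entries of \<open>K\<close> under the generic representation lie in every
  prime above \<open>rep_gens\<close>.\<close>

definition lift_elt :: "(('v, 'e) path \<Rightarrow>\<^sub>0 complex) set \<Rightarrow> ('v, 'e) path \<Rightarrow>\<^sub>0 complex" where
  "lift_elt a = (SOME f. f \<in> carrier F \<and> a = \<pi> f)"

lemma lift_elt:
  assumes "a \<in> carrier A"
  shows "lift_elt a \<in> carrier F" "\<pi> (lift_elt a) = a"
proof -
  have "\<exists>f. f \<in> carrier F \<and> a = \<pi> f"
    using assms carrier_FactRing_cosets unfolding quot_alg_def by blast
  from someI_ex[OF this] show "lift_elt a \<in> carrier F" "\<pi> (lift_elt a) = a"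
    unfolding lift_elt_def by auto
qed

lemma rel_cases [consumes 1, case_names add mult R]:
  assumes "g \<in> rel"
  obtains a b p q where "a \<in> carrier A" "b \<in> carrier A" "p \<in> S" "q \<in> S"
      "g = mVar (a \<oplus>\<^bsub>A\<^esub> b, p, q) - (mVar (a, p, q) + mVar (b, p, q))"
    | a b p q where "a \<in> carrier A" "b \<in> carrier A" "p \<in> S" "q \<in> S"
      "g = mVar (a \<otimes>\<^bsub>A\<^esub> b, p, q) - (\<Sum>k\<in>S. mVar (a, p, k) * mVar (b, k, q))"
    | r p q where "p \<in> S" "q \<in> S" "g = mVar (\<eta> r, p, q) - mConst (R_to_E (verts G) d r p q)"
  using assms unfolding rep_relations_def Let_def generic_matrix_def mat_mult_def by blast

lemma relI:
  "a \<in> carrier A \<Longrightarrow> b \<in> carrier A \<Longrightarrow> p \<in> S \<Longrightarrow> q \<in> S \<Longrightarrow>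
    mVar (a \<oplus>\<^bsub>A\<^esub> b, p, q) - (mVar (a, p, q) + mVar (b, p, q)) \<in> rel"
  "a \<in> carrier A \<Longrightarrow> b \<in> carrier A \<Longrightarrow> p \<in> S \<Longrightarrow> q \<in> S \<Longrightarrow>
    mVar (a \<otimes>\<^bsub>A\<^esub> b, p, q) - (\<Sum>k\<in>S. mVar (a, p, k) * mVar (b, k, q)) \<in> rel"
  "p \<in> S \<Longrightarrow> q \<in> S \<Longrightarrow> mVar (\<eta> r, p, q) - mConst (R_to_E (verts G) d r p q) \<in> rel"
  unfolding rep_relations_def Let_def generic_matrix_def mat_mult_def by blast+

lemma A_closed:
  assumes "a \<in> carrier A" "b \<in> carrier A"
  shows "a \<oplus>\<^bsub>A\<^esub> b \<in> carrier A" "a \<otimes>\<^bsub>A\<^esub> b \<in> carrier A"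
proof -
  interpret ring A unfolding quot_alg_def by (rule ideal.quotient_is_ring[OF ideal_K])
  show "a \<oplus>\<^bsub>A\<^esub> b \<in> carrier A" "a \<otimes>\<^bsub>A\<^esub> b \<in> carrier A" using assms by auto
qed

lemma eta_closed: "\<eta> r \<in> carrier A"
  unfolding eta_eq by (rule quotient_closed[OF F_closed(4)])

lemma rel_carrier: "rel \<subseteq> carrier PX"
proof
  fix g assume "g \<in> rel"
  then show "g \<in> carrier PX"
    by (cases rule: rel_cases)
       (auto intro!: mpoly_ring_closed mpoly_ring_sum_closed A_closed eta_closed)
qed

lemma ideal_KX: "ideal KX PX"
  by (rule ring.genideal_ideal[OF cring.axioms(1)[OF mpoly_ring_cring] rel_carrier])

lemma rel_KX: "rel \<subseteq> KX"
  by (rule ring.genideal_self[OF cring.axioms(1)[OF mpoly_ring_cring] rel_carrier])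

lemmas KX_add = ideal_mpoly_ring_closed(1)[OF ideal_KX]
lemmas KX_diff = ideal_mpoly_ring_closed(2)[OF ideal_KX]
lemmas KX_uminus = ideal_mpoly_ring_closed(3)[OF ideal_KX]

lemma KX_mult:
  "f \<in> KX \<Longrightarrow> h \<in> carrier PX \<Longrightarrow> h * f \<in> KX" "f \<in> KX \<Longrightarrow> h \<in> carrier PX \<Longrightarrow> f * h \<in> KX"
  using ideal_mpoly_ring_closed(4,5)[OF ideal_KX] by blast+

lemma KX_zero: "0 \<in> KX"
  using additive_subgroup.zero_closed[OF ideal.axioms(1)[OF ideal_KX]] by (simp add: mpoly_ring_simps)

lemma KX_sum: "(\<And>i. i \<in> T \<Longrightarrow> f i \<in> KX) \<Longrightarrow> sum f T \<in> KX"
  by (induction T rule: infinite_finite_induct) (auto intro: KX_add KX_zero)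

lemma KX_cong: "f - g \<in> KX \<Longrightarrow> f \<in> KX \<longleftrightarrow> g \<in> KX"
  using KX_add[of "f - g" g] KX_diff[of f "f - g"] by auto

text \<open>Sends an arc entry to the variable of the coordinate ring at the class of that arc;
  \<open>rep_entry\<close> goes back through the generic representation. The value 0 elsewhere
  matches the extra variables in \<open>rep_gens\<close>.\<close>

definition entry_var :: "('e \<times> nat \<times> nat) \<Rightarrow> _ mpoly" where
  "entry_var = (\<lambda>(b, k, l). if (b, k, l) \<in> arc_entries G d
     then mVar (\<pi> (arc_elt G b), (tail G b, k), (head G b, l)) else 0)"

lemma entry_var_closed: "entry_var y \<in> carrier PX"
  using mpoly_ring_closed(1)[of 0 X]
  by (cases y) (auto simp: entry_var_def arc_entries_def block_index_def intro!: mpoly_ring_closed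
      quotient_closed F_closed)

lemma rep_entry_closed: "msubst entry_var f \<in> carrier PX"
  by (rule msubst_closed[OF entry_var_closed])

text \<open>Expresses that modulo the relations the variables at the class of \<open>f\<close> are
  determined by those at the arcs. It holds on idempotents and arcs and is inherited by sums and
  products, hence holds on the whole path algebra.\<close>

definition entry_cong :: "(('v, 'e) path \<Rightarrow>\<^sub>0 complex) \<Rightarrow> bool" where
  "entry_cong f \<longleftrightarrow> (\<forall>p\<in>S. \<forall>q\<in>S. msubst entry_var (\<rho> f p q) - mVar (\<pi> f, p, q) \<in> KX)"

lemma entry_cong_add:
  assumes "f \<in> carrier F" "g \<in> carrier F" "entry_cong f" "entry_cong g"
  shows "entry_cong (f + g)"
  unfolding entry_cong_def
proof (intro ballI)
  fix p q assume pq: "p \<in> S" "q \<in> S"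
  have "mVar (\<pi> (f + g), p, q) - (mVar (\<pi> f, p, q) + mVar (\<pi> g, p, q)) \<in> KX" (is "?r \<in> KX")
    using relI(1)[of "\<pi> f" "\<pi> g" p q] quotient_closed quotient_hom assms pq rel_KX by auto
  moreover have "(msubst entry_var (\<rho> f p q) - mVar (\<pi> f, p, q)) +
      (msubst entry_var (\<rho> g p q) - mVar (\<pi> g, p, q)) \<in> KX" (is "?s \<in> KX")
    using assms(3,4) pq by (intro KX_add) (auto simp: entry_cong_def)
  ultimately have "?s - ?r \<in> KX" by (rule KX_diff[rotated])
  then show "msubst entry_var (\<rho> (f + g) p q) - mVar (\<pi> (f + g), p, q) \<in> KX"
    by (simp add: path_rep_add msubst_add algebra_simps)
qed

lemma entry_cong_mult:
  assumes "f \<in> carrier F" "g \<in> carrier F" "entry_cong f" "entry_cong g"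
  shows "entry_cong (path_mult f g)"
  unfolding entry_cong_def
proof (intro ballI)
  fix p q assume pq: "p \<in> S" "q \<in> S"
  let ?x = "\<lambda>k. mVar (\<pi> f, p, k)" and ?y = "\<lambda>k. mVar (\<pi> g, k, q)"
  let ?a = "\<lambda>k. msubst entry_var (\<rho> f p k)" and ?b = "\<lambda>k. msubst entry_var (\<rho> g k q)"
  have 1: "mVar (\<pi> (path_mult f g), p, q) - (\<Sum>k\<in>S. ?x k * ?y k) \<in> KX"
    using relI(2)[of "\<pi> f" "\<pi> g" p q] quotient_closed quotient_hom assms pq rel_KX by auto
  \<comment> \<open>The telescoping a b - x y = (a - x) b + x (b - y) shows that the difference of
    products lies in the ideal.\<close>
  have "(\<Sum>k\<in>S. (?a k - ?x k) * ?b k + ?x k * (?b k - ?y k)) \<in> KX"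
    using assms pq quotient_closed
    by (intro KX_sum KX_add KX_mult rep_entry_closed mpoly_ring_closed(2)) (auto simp: entry_cong_def)
  also have "(\<Sum>k\<in>S. (?a k - ?x k) * ?b k + ?x k * (?b k - ?y k))
      = (\<Sum>k\<in>S. ?a k * ?b k) - (\<Sum>k\<in>S. ?x k * ?y k)"
    by (simp add: algebra_simps sum_subtractf)
  also have "(\<Sum>k\<in>S. ?a k * ?b k) = msubst entry_var (\<rho> (path_mult f g) p q)"
    using assms(1,2) by (simp add: path_rep_mult F_simps(1) mat_mult_def msubst_sum msubst_mult)
  finally show "msubst entry_var (\<rho> (path_mult f g) p q) - mVar (\<pi> (path_mult f g), p, q) \<in> KX"
    using KX_diff[OF _ 1] by fastforce
qed

lemma entry_cong_R: "entry_cong (R_to_F G r)"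
  unfolding entry_cong_def
proof (intro ballI)
  fix p q assume "p \<in> S" "q \<in> S"
  then have "mVar (\<eta> r, p, q) - mConst (R_to_E (verts G) d r p q) \<in> KX" using relI(3) rel_KX by blast
  from KX_uminus[OF this this]
  show "msubst entry_var (\<rho> (R_to_F G r) p q) - mVar (\<pi> (R_to_F G r), p, q) \<in> KX"
    by (simp add: path_rep_R_to_F eta_eq)
qed

text \<open>An arc is unchanged by multiplication with the idempotents of its ends. The product
  relation then writes an entry outside its block as a sum of products in which every term contains
  a vanishing entry of an idempotent.\<close>

lemma var_off_block:
  assumes b: "b \<in> arcs G" and pq: "p \<in> S" "q \<in> S" and off: "fst p \<noteq> tail G b \<or> fst q \<noteq> head G b"
  shows "mVar (\<pi> (arc_elt G b), p, q) \<in> KX"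
proof -
  let ?b = "arc_elt G b" and ?R = "\<lambda>i. R_to_F G (\<lambda>j. if j = i then 1 else 0)"
  have path: "(tail G b, [b], head G b) \<in> paths G" using b by (auto simp: paths_def intro: arc_implies_awalk)
  have R: "path_mult (?R (tail G b)) ?b = ?b" "path_mult ?b (?R (head G b)) = ?b"
    using R_to_F_mult_single[OF fin_digraph_axioms path] by (simp_all add: arc_elt_def)
  have closed: "\<pi> ?b \<in> carrier A" "?b \<in> carrier F"
    using quotient_closed F_closed b by auto
  have zero: "mVar (\<eta> (\<lambda>j. if j = i then 1 else 0), k, k') \<in> KX"
    if "k \<in> S" "k' \<in> S" "fst k \<noteq> i \<or> fst k' \<noteq> i" for i k k'
  proof -
    have "R_to_E (verts G) d (\<lambda>j. if j = i then 1 else 0) k k' = 0"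
      using that by (auto simp: R_to_E_def)
    then show ?thesis using relI(3)[OF that(1,2), of "\<lambda>j. if j = i then 1 else 0"] rel_KX by auto
  qed
  from off show ?thesis
  proof
    assume p: "fst p \<noteq> tail G b"
    let ?i = "\<lambda>j. if j = tail G b then 1 else 0"
    have "\<eta> ?i \<otimes>\<^bsub>A\<^esub> \<pi> ?b = \<pi> ?b"
      using quotient_hom(2)[OF F_closed(4) closed(2), of ?i] R(1) by (simp add: eta_eq)
    then have "mVar (\<pi> ?b, p, q) - (\<Sum>k\<in>S. mVar (\<eta> ?i, p, k) * mVar (\<pi> ?b, k, q)) \<in> KX"
      using relI(2)[OF eta_closed closed(1) pq, of ?i] rel_KX by auto
    moreover have "(\<Sum>k\<in>S. mVar (\<eta> ?i, p, k) * mVar (\<pi> ?b, k, q)) \<in> KX"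
      using p pq closed by (intro KX_sum KX_mult zero mpoly_ring_closed) auto
    ultimately show ?thesis using KX_cong by blast
  next
    assume q: "fst q \<noteq> head G b"
    let ?i = "\<lambda>j. if j = head G b then 1 else 0"
    have "\<pi> ?b \<otimes>\<^bsub>A\<^esub> \<eta> ?i = \<pi> ?b"
      using quotient_hom(2)[OF closed(2) F_closed(4), of ?i] R(2) by (simp add: eta_eq)
    then have "mVar (\<pi> ?b, p, q) - (\<Sum>k\<in>S. mVar (\<pi> ?b, p, k) * mVar (\<eta> ?i, k, q)) \<in> KX"
      using relI(2)[OF closed(1) eta_closed pq, of ?i] rel_KX by auto
    moreover have "(\<Sum>k\<in>S. mVar (\<pi> ?b, p, k) * mVar (\<eta> ?i, k, q)) \<in> KX"
      using q pq closed by (intro KX_sum KX_mult zero mpoly_ring_closed) auto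
    ultimately show ?thesis using KX_cong by blast
  qed
qed

lemma entry_cong_arc:
  assumes b: "b \<in> arcs G"
  shows "entry_cong (arc_elt G b)"
  unfolding entry_cong_def
proof (intro ballI)
  fix p q assume pq: "p \<in> S" "q \<in> S"
  show "msubst entry_var (\<rho> (arc_elt G b) p q) - mVar (\<pi> (arc_elt G b), p, q) \<in> KX"
  proof (cases "fst p = tail G b \<and> fst q = head G b")
    case True
    then have "entry_var (b, snd p, snd q) = mVar (\<pi> (arc_elt G b), p, q)"
      using pq b by (cases p; cases q) (auto simp: entry_var_def arc_entries_def block_index_def)
    then show ?thesis
      using True pq by (simp add: path_rep_arc_elt[OF b] gen_mat_def KX_zero)
  next
    case False
    then have "mVar (\<pi> (arc_elt G b), p, q) \<in> KX" using var_off_block[OF b pq] by blast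
    moreover have "\<rho> (arc_elt G b) p q = 0"
      using False by (auto simp: path_rep_arc_elt[OF b] gen_mat_def)
    ultimately show ?thesis using KX_uminus by simp
  qed
qed

text \<open>The arcs are split off with coefficient 1, and the scalar is carried to the trivial path
  at the end. There it is the image of an element of R, so complex scalars need no treatment of
  their own.\<close>

lemma entry_cong_single:
  assumes "awalk u bs v"
  shows "entry_cong (Poly_Mapping.single (u, bs, v) c)"
  using assms
proof (induction bs arbitrary: u)
  case Nil
  then have uv: "u = v" "u \<in> verts G" by (auto simp: awalk_Nil_iff)
  have path: "(u, [], u) \<in> paths G" using Nil uv by (auto simp: paths_def)
  have "R_to_F G (\<lambda>j. if j = u then c else 0) = Poly_Mapping.single (u, [], u) c"
  proof -
    have "R_to_F G (\<lambda>j. if j = u then c else 0)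
        = (\<Sum>i\<in>verts G. if i = u then Poly_Mapping.single (u, [], u) c else 0)"
      unfolding R_to_F_def vertex_idem_def pscale_single by (intro sum.cong) auto
    then show ?thesis using uv by simp
  qed
  then show ?case using entry_cong_R uv by metis
next
  case (Cons b bs)
  then have b: "b \<in> arcs G" "u = tail G b" and aw: "awalk (head G b) bs v" by (auto simp: awalk_Cons_iff)
  have "Poly_Mapping.single (u, b # bs, v) c
      = path_mult (arc_elt G b) (Poly_Mapping.single (head G b, bs, v) c)"
    by (simp add: arc_elt_def path_mult_single path_single_mult_def b)
  moreover have "Poly_Mapping.single (head G b, bs, v) c \<in> carrier F"
    using aw by (auto simp: F_simps paths_def)
  ultimately show ?case
    using entry_cong_mult[OF F_closed(5)[OF b(1)] _ entry_cong_arc[OF b(1)] Cons.IH[OF aw]] by simp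
qed

lemma entry_cong_carrier:
  assumes f: "f \<in> carrier F"
  shows "entry_cong f"
proof -
  have single: "Poly_Mapping.single x c \<in> carrier F" "entry_cong (Poly_Mapping.single x c)"
    if "x \<in> Poly_Mapping.keys f" for x c
    using f that entry_cong_single by (cases x; force simp: F_simps paths_def)+
  have 0: "0 \<in> carrier F" "entry_cong 0"
  proof -
    have "R_to_F G (\<lambda>_. 0) = 0" by (simp add: R_to_F_def)
    then show "0 \<in> carrier F" "entry_cong 0" using entry_cong_R F_closed(4) by metis+
  qed
  have "(\<Sum>x\<in>T. Poly_Mapping.single x (Poly_Mapping.lookup f x)) \<in> carrier F \<and>
      entry_cong (\<Sum>x\<in>T. Poly_Mapping.single x (Poly_Mapping.lookup f x))"
    if "T \<subseteq> Poly_Mapping.keys f" for T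
    using finite_subset[OF that finite_keys] that
  proof (induction T rule: finite_induct)
    case (insert x T)
    then show ?case using single by (simp add: F_closed(1) entry_cong_add)
  qed (use 0 in auto)
  from this[OF subset_refl] show ?thesis by (simp only: poly_mapping_expand)
qed

definition rep_entry :: "(('v, 'e) path \<Rightarrow>\<^sub>0 complex) set \<times> ('v \<times> nat) \<times> ('v \<times> nat) \<Rightarrow> ('e \<times> nat \<times> nat) mpoly" where
  "rep_entry = (\<lambda>(a, p, q). \<rho> (lift_elt a) p q)"

text \<open>One composite of the two substitutions is the identity modulo \<open>KX\<close>;
  \<open>rep_entry_entry_var\<close> treats the other one modulo a prime above
  \<open>rep_gens\<close>.\<close>

lemma entry_var_rep_entry:
  assumes "g \<in> carrier PX"
  shows "msubst entry_var (msubst rep_entry g) - g \<in> KX"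
  using assms
proof (induction g rule: mpoly_ring_induct)
  case (var x)
  obtain a p q where x: "x = (a, p, q)" "a \<in> carrier A" "p \<in> S" "q \<in> S" using var by auto
  have "entry_cong (lift_elt a)" using entry_cong_carrier lift_elt x by blast
  then show ?case using x lift_elt(2)[OF x(2)] by (auto simp: rep_entry_def entry_cong_def)
next
  case (add f g)
  then show ?case using KX_add[OF add(3,4)] by (simp add: msubst_add algebra_simps)
next
  case (mult f g)
  let ?h = "\<lambda>f. msubst entry_var (msubst rep_entry f)"
  have "(?h f - f) * ?h g + f * (?h g - g) \<in> KX"
    using mult by (intro KX_add KX_mult rep_entry_closed) auto
  then show ?case by (simp add: msubst_mult algebra_simps)
qed (simp add: KX_zero)

context
  fixes P :: "('e \<times> nat \<times> nat) mpoly set"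
  assumes P: "prime_ideal_set P" and gens: "rep_gens \<subseteq> P"
begin

text \<open>The elements whose generic matrix has all entries in \<open>P\<close> form a two-sided
  ideal, and it contains \<open>L\<close>.\<close>

lemma rep_K: "f \<in> K \<Longrightarrow> \<rho> f p q \<in> P"
proof -
  let ?I = "{f \<in> carrier F. \<forall>p q. \<rho> f p q \<in> P}"
  interpret F: ring F by (rule ring_F)
  have "ideal ?I F"
  proof (rule idealI[OF ring_F], intro subgroup.intro)
    fix x assume "x \<in> ?I"
    then have "\<ominus>\<^bsub>F\<^esub> x \<in> ?I"
      by (auto simp: F_a_inv F_closed path_rep_uminus intro: prime_uminus[OF P])
    then show "inv\<^bsub>add_monoid F\<^esub> x \<in> ?I" by (simp only: a_inv_def)
  next
    fix a x assume ax: "a \<in> ?I" "x \<in> carrier F"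
    then show "x \<otimes>\<^bsub>F\<^esub> a \<in> ?I" "a \<otimes>\<^bsub>F\<^esub> x \<in> ?I"
      unfolding F_simps(2)
      by (auto simp: F_closed path_rep_mult F_simps(1)[symmetric] mat_mult_def
          intro!: prime_sum[OF P] intro: prime_mult[OF P])
  qed (use F.zero_closed in \<open>auto simp: F_simps(3,4) F_closed path_rep_add intro: prime_add[OF P] prime_zero[OF P]\<close>)
  moreover have "L \<subseteq> ?I"
  proof
    fix f assume f: "f \<in> L"
    have "\<rho> f p q \<in> P" for p q
    proof (cases "p \<in> S \<and> q \<in> S")
      case True
      then show ?thesis using f gens unfolding rep_gens_def by blast
    next
      case False
      moreover have "Poly_Mapping.keys f \<subseteq> paths G" using f L_carrier F_simps(1) by blast
      ultimately have "\<rho> f p q = 0" using path_rep_support[of f p q] by blast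
      then show ?thesis by (simp add: prime_zero[OF P])
    qed
    then show "f \<in> ?I" using f L_carrier by auto
  qed
  ultimately have "K \<subseteq> ?I" by (rule F.genideal_minimal)
  then show "f \<in> K \<Longrightarrow> \<rho> f p q \<in> P" by blast
qed

lemma rep_lift_elt:
  assumes "f \<in> carrier F"
  shows "\<rho> (lift_elt (\<pi> f)) p q - \<rho> f p q \<in> P"
proof -
  have "\<pi> f \<in> carrier A" using quotient_closed assms by blast
  note l = lift_elt[OF this]
  show ?thesis using rep_K[OF quotient_eqD[OF l(1) assms l(2)]] by (simp add: path_rep_diff)
qed

lemma rep_entry_rel:
  assumes "g \<in> rel"
  shows "msubst rep_entry g \<in> P"
  using assms
proof (cases rule: rel_cases)
  case (add a b p q)
  have "a \<oplus>\<^bsub>A\<^esub> b = \<pi> (lift_elt a + lift_elt b)"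
    using add lift_elt quotient_hom(1) by simp
  then show ?thesis
    using rep_lift_elt[of "lift_elt a + lift_elt b" p q] add lift_elt
    by (simp add: rep_entry_def msubst_diff msubst_add path_rep_add F_closed)
next
  case (mult a b p q)
  have "a \<otimes>\<^bsub>A\<^esub> b = \<pi> (path_mult (lift_elt a) (lift_elt b))"
    using mult lift_elt quotient_hom(2) by simp
  moreover have "\<rho> (path_mult (lift_elt a) (lift_elt b)) p q
      = (\<Sum>k\<in>S. \<rho> (lift_elt a) p k * \<rho> (lift_elt b) k q)"
    using mult lift_elt by (simp add: path_rep_mult F_simps(1)[symmetric] mat_mult_def)
  ultimately show ?thesis
    using rep_lift_elt[of "path_mult (lift_elt a) (lift_elt b)" p q] mult lift_elt
    by (simp add: rep_entry_def msubst_diff msubst_sum msubst_mult F_closed)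
next
  case (R r p q)
  then show ?thesis using rep_lift_elt[OF F_closed(4), of r p q]
    by (simp add: rep_entry_def msubst_diff path_rep_R_to_F eta_eq)
qed

lemma rep_entry_entry_var: "msubst rep_entry (msubst entry_var f) - f \<in> P"
proof (induction f rule: mpoly_induct)
  case (var y)
  obtain b k l where y: "y = (b, k, l)" by (cases y)
  show ?case
  proof (cases "y \<in> arc_entries G d")
    case True
    then have b: "b \<in> arcs G" "(tail G b, k) \<in> S" "(head G b, l) \<in> S"
      by (auto simp: y arc_entries_def block_index_def)
    then show ?thesis using rep_lift_elt[OF F_closed(5)[OF b(1)], of "(tail G b, k)" "(head G b, l)"] True
      by (simp add: y entry_var_def rep_entry_def path_rep_arc_elt gen_mat_def)
  next
    case False
    then have "mVar y \<in> P" using gens unfolding rep_gens_def by blast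
    then show ?thesis using False prime_uminus[OF P] by (simp add: y entry_var_def)
  qed
next
  case (add f g)
  then show ?case using prime_add[OF P add] by (simp add: msubst_add algebra_simps)
next
  case (mult f g)
  let ?h = "\<lambda>f. msubst rep_entry (msubst entry_var f)"
  have "(?h f - f) * ?h g + f * (?h g - g) \<in> P"
    using mult by (intro prime_add[OF P] prime_mult[OF P])
  then show ?case by (simp add: msubst_mult algebra_simps)
qed (simp add: prime_zero[OF P])

end

lemma entry_var_gens:
  assumes "g \<in> rep_gens"
  shows "msubst entry_var g \<in> KX"
  using assms unfolding rep_gens_def
proof (elim UnE CollectE exE conjE)
  fix f p q assume g: "g = \<rho> f p q" and f: "f \<in> L" and pq: "p \<in> S" "q \<in> S"
  interpret F: ring F by (rule ring_F)
  interpret K: ideal K F by (rule ideal_K)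
  have "f \<in> K" using f F.genideal_self[OF L_carrier] by blast
  then have "\<pi> f = K" by (rule K.a_rcos_const)
  also have "\<dots> = \<zero>\<^bsub>A\<^esub>" unfolding quot_alg_def by (rule zero_FactRing[symmetric])
  finally have z: "\<pi> f = \<zero>\<^bsub>A\<^esub>" .
  have fF: "f \<in> carrier F" using f L_carrier by blast
  \<comment> \<open>The sum relation for the zero class added to itself puts the negative of its
    variable into \<open>KX\<close>.\<close>
  interpret A: ring A unfolding quot_alg_def by (rule K.quotient_is_ring)
  have "\<pi> f \<oplus>\<^bsub>A\<^esub> \<pi> f = \<pi> f" unfolding z by simp
  then have "- mVar (\<pi> f, p, q) \<in> KX"
    using relI(1)[of "\<pi> f" "\<pi> f" p q] quotient_closed[OF fF] pq rel_KX by auto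
  then have "mVar (\<pi> f, p, q) \<in> KX" using KX_uminus by fastforce
  moreover have "msubst entry_var g - mVar (\<pi> f, p, q) \<in> KX"
    using entry_cong_carrier[OF fF] pq by (simp add: entry_cong_def g)
  ultimately show ?thesis using KX_cong by blast
next
  fix y assume "g = mVar y" "y \<notin> arc_entries G d"
  then show ?thesis by (cases y) (auto simp: entry_var_def KX_zero)
qed

text \<open>Both directions take preimages of primes under a substitution. Strictness survives
  because an element that separates two primes goes over to one that separates their preimages: the
  composite substitution changes it only by an element of both primes.\<close>

lemma coordinate_ring_prime_chain_iff:
  "(\<exists>P. (\<forall>k\<le>n. primeideal (P k) (rep_coordinate_ring (verts G) d A \<eta>)) \<and> (\<forall>k<n. P k \<subset> P (Suc k)))
    \<longleftrightarrow> prime_chain rep_gens n"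
  unfolding rep_coordinate_ring_def Let_def quot_prime_chain_iff[OF mpoly_ring_cring ideal_KX]
proof
  assume "\<exists>P. (\<forall>k\<le>n. primeideal (P k) PX \<and> KX \<subseteq> P k) \<and> (\<forall>k<n. P k \<subset> P (Suc k))"
  then obtain P where *: "(\<forall>k\<le>n. primeideal (P k) PX \<and> KX \<subseteq> P k) \<and> (\<forall>k<n. P k \<subset> P (Suc k))"
    by (rule exE)
  note P = conjunct1[OF *, rule_format, THEN conjunct1] conjunct1[OF *, rule_format, THEN conjunct2]
    and lt = conjunct2[OF *, rule_format]
  define T where "T k = {f. msubst entry_var f \<in> P k}" for k
  have "prime_ideal_set (T k)" if "k \<le> n" for k
    unfolding T_def by (rule prime_ideal_set_vimage_msubst[OF P(1)[OF that] entry_var_closed])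
  moreover have "rep_gens \<subseteq> T k" if "k \<le> n" for k
    using entry_var_gens P(2)[OF that] by (auto simp: T_def)
  moreover have "T k \<subset> T (Suc k)" if k: "k < n" for k
  proof -
    obtain g where g: "g \<in> P (Suc k)" "g \<notin> P k" using lt[OF k] by blast
    interpret p1: primeideal "P (Suc k)" PX using P(1) k by simp
    interpret p0: primeideal "P k" PX using P(1) k by simp
    have "msubst entry_var (msubst rep_entry g) - g \<in> KX"
      by (rule entry_var_rep_entry[OF p1.Icarr[OF g(1)]])
    then have d: "msubst entry_var (msubst rep_entry g) - g \<in> P (Suc k)"
      "msubst entry_var (msubst rep_entry g) - g \<in> P k" using P(2)[of "Suc k"] P(2)[of k] k by auto
    have "msubst rep_entry g \<in> T (Suc k)"
      using ideal_mpoly_ring_closed(1)[OF p1.is_ideal d(1) g(1)] by (simp add: T_def)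
    moreover have "msubst rep_entry g \<notin> T k"
      using ideal_mpoly_ring_closed(2)[OF p0.is_ideal _ d(2), of "msubst entry_var (msubst rep_entry g)"] g(2)
      by (auto simp: T_def)
    moreover have "T k \<subseteq> T (Suc k)" using lt[OF k] by (auto simp: T_def)
    ultimately show ?thesis by blast
  qed
  ultimately show "prime_chain rep_gens n" unfolding prime_chain_def by blast
next
  assume "prime_chain rep_gens n"
  then obtain P where *: "(\<forall>k\<le>n. prime_ideal_set (P k) \<and> rep_gens \<subseteq> P k) \<and> (\<forall>k<n. P k \<subset> P (Suc k))"
    unfolding prime_chain_def by (rule exE)
  note P = conjunct1[OF *, rule_format, THEN conjunct1] conjunct1[OF *, rule_format, THEN conjunct2]
    and lt = conjunct2[OF *, rule_format]
  define T where "T k = {f \<in> carrier PX. msubst rep_entry f \<in> P k}" for k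
  have prime: "primeideal (T k) PX" if "k \<le> n" for k
    unfolding T_def by (rule primeideal_vimage_msubst[OF P(1)[OF that]])
  moreover have "KX \<subseteq> T k" if k: "k \<le> n" for k
  proof (rule ring.genideal_minimal[OF cring.axioms(1)[OF mpoly_ring_cring]])
    show "ideal (T k) PX" using prime[OF k] by (rule primeideal.axioms(1))
    show "rel \<subseteq> T k"
      using rel_carrier rep_entry_rel[OF P(1)[OF k] P(2)[OF k]] unfolding T_def by blast
  qed
  moreover have "T k \<subset> T (Suc k)" if k: "k < n" for k
  proof -
    obtain f where f: "f \<in> P (Suc k)" "f \<notin> P k" using lt[OF k] by blast
    have k': "k \<le> n" "Suc k \<le> n" using k by auto
    have "msubst rep_entry (msubst entry_var f) \<in> P (Suc k)"
      using prime_diffD[OF P(1)[OF k'(2)] rep_entry_entry_var[OF P(1)[OF k'(2)] P(2)[OF k'(2)]]] f by blast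
    moreover have "msubst rep_entry (msubst entry_var f) \<notin> P k"
      using prime_diffD[OF P(1)[OF k'(1)] rep_entry_entry_var[OF P(1)[OF k'(1)] P(2)[OF k'(1)]]] f by blast
    ultimately have "msubst entry_var f \<in> T (Suc k) - T k"
      by (simp add: T_def rep_entry_closed)
    then show ?thesis using lt[OF k] by (auto simp: T_def)
  qed
  ultimately show "\<exists>P. (\<forall>k\<le>n. primeideal (P k) PX \<and> KX \<subseteq> P k) \<and> (\<forall>k<n. P k \<subset> P (Suc k))"
    by (intro exI[of _ T] conjI allI impI)
qed

theorem rep_dim_eq: "rep_dim (verts G) d A \<eta> = Sup {ereal (real n) | n. prime_chain rep_gens n}"
  unfolding rep_dim_def krull_dim_def coordinate_ring_prime_chain_iff by (rule refl)

end


section \<open>Dimensions of bimodule homomorphism spaces\<close>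

lemma path_mult_pscale:
  "path_mult (pscale c f) g = pscale c (path_mult f g)"
  "path_mult f (pscale c g) = pscale c (path_mult f g)"
proof -
  have sc: "pscale c (path_single_mult x y a) = path_single_mult x y (c * a)" for x y :: "('v, 'e) path" and a
    by (auto simp: path_single_mult_def pscale_single split: prod.split)
  have "path_mult (pscale c f) g = pscale c (path_mult f g) \<and> path_mult f (pscale c g) = pscale c (path_mult f g)"
  proof (induction f rule: poly_mapping_add_induct)
    case (single x a)
    show ?case
    proof (induction g rule: poly_mapping_add_induct)
      case (single y b)
      then show ?case
        by (simp add: pscale_single path_mult_single sc mult.left_commute mult.assoc)
    qed (simp add: path_mult_add_left path_mult_add_right pvs.scale_right_distrib)
  qed (simp add: path_mult_add_left path_mult_add_right pvs.scale_right_distrib)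
  then show "path_mult (pscale c f) g = pscale c (path_mult f g)"
    "path_mult f (pscale c g) = pscale c (path_mult f g)" by auto
qed

lemma matsD: "\<Phi> \<in> mats S \<Longrightarrow> p \<notin> S \<or> q \<notin> S \<Longrightarrow> \<Phi> p q = 0"
  unfolding mats_def by blast

lemma mat_mult_R_to_E:
  assumes "finite I" "\<Phi> \<in> mats (block_index I d)"
  shows "mat_mult (block_index I d) (mat_mult (block_index I d) (R_to_E I d r) \<Phi>) (R_to_E I d s) p q
    = r (fst p) * \<Phi> p q * s (fst q)"
proof -
  let ?S = "block_index I d"
  have fin: "finite ?S" using assms(1) by (simp add: block_index_def)
  have zero: "\<Phi> p q = 0" if "p \<notin> ?S \<or> q \<notin> ?S" for p q
    by (rule matsD[OF assms(2) that])
  have left: "mat_mult ?S (R_to_E I d r) \<Phi> p q = r (fst p) * \<Phi> p q" for p q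
  proof -
    have "mat_mult ?S (R_to_E I d r) \<Phi> p q = (\<Sum>k\<in>?S. if k = p then r (fst p) * \<Phi> p q else 0)"
      unfolding mat_mult_def by (intro sum.cong) (auto simp: R_to_E_def)
    then show ?thesis using fin zero[of p q] by auto
  qed
  have "mat_mult ?S (mat_mult ?S (R_to_E I d r) \<Phi>) (R_to_E I d s) p q
      = (\<Sum>k\<in>?S. if k = q then r (fst p) * \<Phi> p q * s (fst q) else 0)"
    unfolding mat_mult_def[of ?S "mat_mult ?S (R_to_E I d r) \<Phi>"] left
    by (intro sum.cong) (auto simp: R_to_E_def)
  then show ?thesis using fin zero[of p q] by auto
qed

lemma hscale_apply: "hscale c \<phi> x p q = c * \<phi> x p q"
  by (simp add: hscale_def)

lemma sum_apply2: "(\<Sum>i\<in>T. f i) p q = (\<Sum>i\<in>T. f i p q)"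
  by (induction T rule: infinite_finite_induct) auto

lemma sum_apply3: "(\<Sum>i\<in>T. f i) x p q = (\<Sum>i\<in>T. f i x p q)"
  by (induction T rule: infinite_finite_induct) auto

text \<open>A bimodule spanned by simultaneous eigenvectors \<open>m t\<close> of the left and right
  action of R. The path \<open>\<kappa> t\<close> occurs in \<open>m t\<close> and in no other
  generator, which proves independence and reads off coordinates.\<close>

locale separated_bimodule = fin_digraph G for G :: "('v, 'e) pre_digraph" +
  fixes T :: "'t set" and m :: "'t \<Rightarrow> ('v, 'e) path \<Rightarrow>\<^sub>0 complex"
    and src tgt :: "'t \<Rightarrow> 'v" and \<kappa> :: "'t \<Rightarrow> ('v, 'e) path"
  assumes finite_T: "finite T"
    and endpoints: "\<And>t. t \<in> T \<Longrightarrow> src t \<in> verts G" "\<And>t. t \<in> T \<Longrightarrow> tgt t \<in> verts G"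
    and bimod: "\<And>t r s. t \<in> T \<Longrightarrow>
      path_mult (path_mult (R_to_F G r) (m t)) (R_to_F G s) = pscale (r (src t) * s (tgt t)) (m t)"
    and separated: "\<And>t. t \<in> T \<Longrightarrow> Poly_Mapping.lookup (m t) (\<kappa> t) \<noteq> 0"
      "\<And>t t'. t \<in> T \<Longrightarrow> t' \<in> T \<Longrightarrow> t \<noteq> t' \<Longrightarrow> Poly_Mapping.lookup (m t) (\<kappa> t') = 0"
begin

abbreviation "B \<equiv> pspan (m ` T)"

definition coord :: "'t \<Rightarrow> (('v, 'e) path \<Rightarrow>\<^sub>0 complex) \<Rightarrow> complex" where
  "coord t x = Poly_Mapping.lookup x (\<kappa> t) / Poly_Mapping.lookup (m t) (\<kappa> t)"

lemma coord_add: "coord t (x + y) = coord t x + coord t y"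
  by (simp add: coord_def lookup_add add_divide_distrib)

lemma coord_0: "coord t 0 = 0"
  by (simp add: coord_def)

lemma coord_sum: "coord t (sum f U) = (\<Sum>i\<in>U. coord t (f i))"
  by (induction U rule: infinite_finite_induct) (auto simp: coord_add coord_0)

lemma coord_pscale: "coord t (pscale c x) = c * coord t x"
  by (simp add: coord_def)

lemma coord_m: "t \<in> T \<Longrightarrow> t' \<in> T \<Longrightarrow> coord t (m t') = (if t = t' then 1 else 0)"
  using separated by (auto simp: coord_def)

lemma m_B: "t \<in> T \<Longrightarrow> m t \<in> B"
  by (rule pvs.span_base) auto

lemma B_expand:
  assumes "x \<in> B"
  shows "x = (\<Sum>t\<in>T. pscale (coord t x) (m t))"
  using assms
proof (induction rule: pvs.span_induct_alt)
  case base
  then show ?case by (simp add: coord_def)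
next
  case (step c y z)
  then obtain t where t: "t \<in> T" "y = m t" by auto
  have "(\<Sum>t'\<in>T. pscale (coord t' (pscale c y + z)) (m t'))
      = (\<Sum>t'\<in>T. pscale (if t' = t then c else 0) (m t')) + (\<Sum>t'\<in>T. pscale (coord t' z) (m t'))"
    using t by (simp add: coord_add coord_pscale coord_m pvs.scale_left_distrib sum.distrib
        if_distrib[of "\<lambda>a. c * a"] cong: if_cong)
  also have "(\<Sum>t'\<in>T. pscale (if t' = t then c else 0) (m t')) = (\<Sum>t'\<in>T. if t' = t then pscale c (m t) else 0)"
    by (intro sum.cong) auto
  also have "\<dots> = pscale c y" using t finite_T by simp
  finally show ?case using step by simp
qed

lemma bimod_expand:
  assumes "x \<in> B"
  shows "path_mult (path_mult (R_to_F G r) x) (R_to_F G s)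
    = (\<Sum>t\<in>T. pscale (coord t x * (r (src t) * s (tgt t))) (m t))"
  by (subst B_expand[OF assms])
     (simp add: path_mult_sum_left path_mult_sum_right path_mult_pscale bimod cong: sum.cong)

lemma coord_bimod:
  assumes "x \<in> B" "t \<in> T"
  shows "coord t (path_mult (path_mult (R_to_F G r) x) (R_to_F G s)) = coord t x * (r (src t) * s (tgt t))"
proof -
  have "coord t (path_mult (path_mult (R_to_F G r) x) (R_to_F G s))
      = (\<Sum>t'\<in>T. if t' = t then coord t x * (r (src t) * s (tgt t)) else 0)"
    unfolding bimod_expand[OF assms(1)] coord_sum coord_pscale
    using assms(2) by (intro sum.cong) (auto simp: coord_m)
  then show ?thesis using assms(2) finite_T by simp
qed

lemma bimod_closed: "x \<in> B \<Longrightarrow> path_mult (path_mult (R_to_F G r) x) (R_to_F G s) \<in> B"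
  unfolding bimod_expand by (intro pvs.span_sum pvs.span_scale m_B)

context
  fixes d :: "'v \<Rightarrow> nat"
begin

abbreviation (input) "SS \<equiv> block_index (verts G) d"

definition hom_index :: "('t \<times> nat \<times> nat) set" where
  "hom_index = (SIGMA t:T. {..<d (src t)} \<times> {..<d (tgt t)})"

definition basic_hom :: "'t \<times> nat \<times> nat \<Rightarrow> (('v, 'e) path \<Rightarrow>\<^sub>0 complex) \<Rightarrow> 'v \<times> nat \<Rightarrow> 'v \<times> nat \<Rightarrow> complex" where
  "basic_hom = (\<lambda>(t, k, l) x p q. if x \<in> B \<and> p = (src t, k) \<and> q = (tgt t, l) then coord t x else 0)"

lemma basic_hom_in:
  assumes "z \<in> hom_index"
  shows "basic_hom z \<in> bimod_hom G d B"
proof -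
  obtain t k l where z: "z = (t, k, l)" "t \<in> T" "k < d (src t)" "l < d (tgt t)"
    using assms by (auto simp: hom_index_def)
  have mats: "basic_hom z x \<in> mats SS" for x
    using z endpoints by (auto simp: basic_hom_def mats_def block_index_def)
  show ?thesis
    unfolding bimod_hom_def Let_def mem_Collect_eq
  proof (intro conjI allI ballI impI)
    fix x y assume "x \<in> B" "y \<in> B"
    then show "basic_hom z (x + y) = basic_hom z x + basic_hom z y"
      using pvs.span_add[of x "m ` T" y]
      by (auto simp: basic_hom_def z coord_add fun_eq_iff)
  next
    fix x r s assume x: "x \<in> B"
    show "basic_hom z (path_mult (path_mult (R_to_F G r) x) (R_to_F G s)) =
      mat_mult SS (mat_mult SS (R_to_E (verts G) d r) (basic_hom z x)) (R_to_E (verts G) d s)"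
    proof (intro ext)
      fix p q
      show "basic_hom z (path_mult (path_mult (R_to_F G r) x) (R_to_F G s)) p q =
        mat_mult SS (mat_mult SS (R_to_E (verts G) d r) (basic_hom z x)) (R_to_E (verts G) d s) p q"
        unfolding mat_mult_R_to_E[OF finite_verts mats]
        using x z by (auto simp: basic_hom_def coord_bimod bimod_closed)
    qed
  qed (rule mats | simp add: basic_hom_def z fun_eq_iff)+
qed

lemma basic_hom_m:
  assumes "t \<in> T" "z \<in> hom_index"
  shows "basic_hom z (m t) (src t, k) (tgt t, l) = (if z = (t, k, l) then 1 else 0)"
  using assms by (cases z) (auto simp: basic_hom_def m_B hom_index_def coord_m)

lemma finite_hom_index: "finite hom_index"
  unfolding hom_index_def using finite_T by auto

lemma basic_hom_coefficients:
  assumes "(\<Sum>z\<in>hom_index. hscale (u z) (basic_hom z)) = \<phi>" "(t, k, l) \<in> hom_index"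
  shows "u (t, k, l) = \<phi> (m t) (src t, k) (tgt t, l)"
proof -
  have t: "t \<in> T" using assms(2) by (auto simp: hom_index_def)
  have "\<phi> (m t) (src t, k) (tgt t, l)
      = (\<Sum>z\<in>hom_index. u z * basic_hom z (m t) (src t, k) (tgt t, l))"
    unfolding assms(1)[symmetric] sum_apply3 hscale_apply ..
  also have "\<dots> = (\<Sum>z\<in>hom_index. if z = (t, k, l) then u z else 0)"
    using t by (intro sum.cong) (auto simp: basic_hom_m)
  also have "\<dots> = u (t, k, l)" using assms(2) finite_hom_index by simp
  finally show ?thesis ..
qed

lemma basic_hom_span:
  assumes \<phi>: "\<phi> \<in> bimod_hom G d B"
  shows "\<phi> = (\<Sum>(t, k, l)\<in>hom_index. hscale (\<phi> (m t) (src t, k) (tgt t, l)) (basic_hom (t, k, l)))"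
proof -
  have out: "\<phi> x = 0" if "x \<notin> B" for x using \<phi> that by (auto simp: bimod_hom_def Let_def)
  have mats: "\<phi> x \<in> mats SS" if "x \<in> B" for x using \<phi> that by (auto simp: bimod_hom_def Let_def)
  have add: "\<phi> (x + y) = \<phi> x + \<phi> y" if "x \<in> B" "y \<in> B" for x y
    using \<phi> that by (auto simp: bimod_hom_def Let_def)
  have RR: "\<phi> (path_mult (path_mult (R_to_F G r) x) (R_to_F G s)) p q = r (fst p) * \<phi> x p q * s (fst q)"
    if "x \<in> B" for x r s p q
  proof -
    have "\<phi> (path_mult (path_mult (R_to_F G r) x) (R_to_F G s))
        = mat_mult SS (mat_mult SS (R_to_E (verts G) d r) (\<phi> x)) (R_to_E (verts G) d s)"
      using \<phi> that unfolding bimod_hom_def Let_def by blast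
    then show ?thesis by (simp add: mat_mult_R_to_E[OF finite_verts mats[OF that]])
  qed
  have scale: "\<phi> (pscale c (m t)) p q = c * \<phi> (m t) p q" if "t \<in> T" for c t p q
    using RR[OF m_B[OF that], of "\<lambda>_. c" "\<lambda>_. 1" p q] bimod[OF that, of "\<lambda>_. c" "\<lambda>_. 1"] by simp
  \<comment> \<open>Bilinearity applied to the idempotents of the two ends confines the image of
    \<open>m t\<close> to a single block.\<close>
  have supp: "\<phi> (m t) p q = (if p \<in> SS \<and> fst p = src t \<and> q \<in> SS \<and> fst q = tgt t then \<phi> (m t) p q else 0)"
    if t: "t \<in> T" for t p q
  proof -
    let ?r = "\<lambda>j. if j = src t then 1 else 0" and ?s = "\<lambda>j. if j = tgt t then 1 else 0"
    have "\<phi> (m t) p q = ?r (fst p) * \<phi> (m t) p q * ?s (fst q)"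
      using RR[OF m_B[OF t], of ?r ?s p q] bimod[OF t, of ?r ?s] by simp
    then show ?thesis using matsD[OF mats[OF m_B[OF t]], of p q]
      by (auto split: if_splits)
  qed
  have sum: "\<phi> (\<Sum>t\<in>U. pscale (a t) (m t)) = (\<Sum>t\<in>U. \<phi> (pscale (a t) (m t)))" if "finite U" "U \<subseteq> T" for U a
    using that
  proof (induction U rule: finite_induct)
    case empty
    have "\<phi> 0 + \<phi> 0 = \<phi> 0" using add[of 0 0] pvs.span_zero[of "m ` T"] by simp
    then show ?case by simp
  next
    case (insert t U)
    have "\<phi> (pscale (a t) (m t) + (\<Sum>t\<in>U. pscale (a t) (m t)))
        = \<phi> (pscale (a t) (m t)) + \<phi> (\<Sum>t\<in>U. pscale (a t) (m t))"
      using insert.prems by (intro add pvs.span_sum pvs.span_scale m_B) auto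
    then show ?case using insert by simp
  qed
  show ?thesis
  proof (intro ext)
    fix x p q
    have rhs: "(\<Sum>(t, k, l)\<in>hom_index. hscale (\<phi> (m t) (src t, k) (tgt t, l)) (basic_hom (t, k, l))) x p q
        = (\<Sum>t\<in>T. \<Sum>k<d (src t). \<Sum>l<d (tgt t).
            \<phi> (m t) (src t, k) (tgt t, l) * basic_hom (t, k, l) x p q)"
    proof -
      have "(\<Sum>(t, k, l)\<in>hom_index. hscale (\<phi> (m t) (src t, k) (tgt t, l)) (basic_hom (t, k, l))) x p q
        = (\<Sum>(t, k, l)\<in>hom_index. \<phi> (m t) (src t, k) (tgt t, l) * basic_hom (t, k, l) x p q)"
        unfolding sum_apply3 by (intro sum.cong) (auto simp: hscale_apply)
      also have "\<dots> = (\<Sum>t\<in>T. \<Sum>(k, l)\<in>{..<d (src t)} \<times> {..<d (tgt t)}.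
          \<phi> (m t) (src t, k) (tgt t, l) * basic_hom (t, k, l) x p q)"
        unfolding hom_index_def using finite_T by (subst sum.Sigma) auto
      finally show ?thesis by (simp add: sum.cartesian_product)
    qed
    show "\<phi> x p q = (\<Sum>(t, k, l)\<in>hom_index. hscale (\<phi> (m t) (src t, k) (tgt t, l)) (basic_hom (t, k, l))) x p q"
    proof (cases "x \<in> B")
      case False
      then show ?thesis unfolding rhs by (simp add: out basic_hom_def)
    next
      case True
      have "\<phi> x p q = \<phi> (\<Sum>t\<in>T. pscale (coord t x) (m t)) p q" using B_expand[OF True] by simp
      also have "\<dots> = (\<Sum>t\<in>T. coord t x * \<phi> (m t) p q)"
        using sum[OF finite_T subset_refl, of "\<lambda>t. coord t x"] scale
        by (simp add: sum_apply2 cong: sum.cong)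
      also have "\<dots> = (\<Sum>t\<in>T. \<Sum>k<d (src t). \<Sum>l<d (tgt t).
            \<phi> (m t) (src t, k) (tgt t, l) * basic_hom (t, k, l) x p q)"
      proof (intro sum.cong refl)
        fix t assume t: "t \<in> T"
        obtain i k0 j l0 where pq: "p = (i, k0)" "q = (j, l0)" by (metis surj_pair)
        have "(\<Sum>k<d (src t). \<Sum>l<d (tgt t). \<phi> (m t) (src t, k) (tgt t, l) * basic_hom (t, k, l) x p q)
            = (\<Sum>k<d (src t). \<Sum>l<d (tgt t). if k = k0 then (if l = l0 then
                (if i = src t \<and> j = tgt t then \<phi> (m t) p q * coord t x else 0) else 0) else 0)"
          using True by (intro sum.cong refl) (auto simp: basic_hom_def pq)
        also have "\<dots> = (\<Sum>k<d (src t). if k = k0 then (\<Sum>l<d (tgt t). if l = l0 then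
                (if i = src t \<and> j = tgt t then \<phi> (m t) p q * coord t x else 0) else 0) else 0)"
          by (intro sum.cong) auto
        also have "\<dots> = (if i = src t \<and> k0 < d (src t) \<and> j = tgt t \<and> l0 < d (tgt t) then \<phi> (m t) p q * coord t x else 0)"
          by auto
        also have "\<dots> = coord t x * \<phi> (m t) p q"
          using supp[OF t, of p q] by (auto simp: pq block_index_def)
        finally show "coord t x * \<phi> (m t) p q
          = (\<Sum>k<d (src t). \<Sum>l<d (tgt t). \<phi> (m t) (src t, k) (tgt t, l) * basic_hom (t, k, l) x p q)" ..
      qed
      finally show ?thesis unfolding rhs .
    qed
  qed
qed

theorem hdim_bimod_hom: "hdim (bimod_hom G d B) = (\<Sum>t\<in>T. d (src t) * d (tgt t))"
proof -
  have inj: "inj_on basic_hom hom_index"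
  proof (rule inj_onI)
    fix z z' assume z: "z \<in> hom_index" "z' \<in> hom_index" and eq: "basic_hom z = basic_hom z'"
    obtain t k l where tkl: "z = (t, k, l)" by (cases z)
    then have t: "t \<in> T" using z by (auto simp: hom_index_def)
    have "basic_hom z' (m t) (src t, k) (tgt t, l) = 1"
      using basic_hom_m[OF t z(1)] by (simp add: tkl flip: eq)
    then show "z = z'" using basic_hom_m[OF t z(2)] tkl by (simp split: if_splits)
  qed
  have "hvs.independent (basic_hom ` hom_index)"
  proof (rule hvs.independent_if_scalars_zero)
    fix c b assume z: "(\<Sum>b\<in>basic_hom ` hom_index. hscale (c b) b) = 0" and b: "b \<in> basic_hom ` hom_index"
    obtain t k l where tkl: "(t, k, l) \<in> hom_index" "b = basic_hom (t, k, l)" using b by auto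
    have "(\<Sum>z\<in>hom_index. hscale (c (basic_hom z)) (basic_hom z)) = 0"
      using z by (simp add: sum.reindex[OF inj])
    from basic_hom_coefficients[OF this tkl(1)] show "c b = 0" by (simp add: tkl)
  qed (use finite_hom_index in auto)
  moreover have "bimod_hom G d B \<subseteq> hvs.span (basic_hom ` hom_index)"
  proof
    fix \<phi> assume "\<phi> \<in> bimod_hom G d B"
    from basic_hom_span[OF this] show "\<phi> \<in> hvs.span (basic_hom ` hom_index)"
      by (rule ssubst) (auto intro!: hvs.span_sum hvs.span_scale intro: hvs.span_base)
  qed
  moreover have "basic_hom ` hom_index \<subseteq> bimod_hom G d B" using basic_hom_in by blast
  moreover have "card (basic_hom ` hom_index) = (\<Sum>t\<in>T. d (src t) * d (tgt t))"
    unfolding card_image[OF inj] unfolding hom_index_def using finite_T by simp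
  ultimately show ?thesis using hvs.dim_unique by blast
qed

end

end


section \<open>The relation space of the partial preprojective algebra\<close>

primrec opp :: "'e double_arc \<Rightarrow> 'e double_arc" where
  "opp (Orig a) = Star a" | "opp (Star a) = Orig a"

primrec arc_sign :: "'e double_arc \<Rightarrow> complex" where
  "arc_sign (Orig a) = 1" | "arc_sign (Star a) = - 1"

lemma opp_simps [simp]: "opp (opp b) = b" "opp b \<noteq> b" "arc_sign (opp b) = - arc_sign b" "arc_sign b \<noteq> 0"
  by (cases b; simp)+

lemma double_quiver_opp [simp]:
  "opp b \<in> arcs (double_quiver Q) \<longleftrightarrow> b \<in> arcs (double_quiver Q)"
  "tail (double_quiver Q) (opp b) = head (double_quiver Q) b"
  "head (double_quiver Q) (opp b) = tail (double_quiver Q) b"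
  "verts (double_quiver Q) = verts Q"
  by (cases b; auto simp: double_quiver_def)+

text \<open>The component at the vertex i of the sum of all [a, a*]: the closed paths b b* that
  start at i, signed by whether b is an original or a starred arc.\<close>

definition moment_elt :: "('v, 'e) pre_digraph \<Rightarrow> 'v \<Rightarrow> ('v, 'e double_arc) path \<Rightarrow>\<^sub>0 complex" where
  "moment_elt Q i = (\<Sum>b | b \<in> arcs (double_quiver Q) \<and> tail (double_quiver Q) b = i.
     Poly_Mapping.single (i, [b, opp b], i) (arc_sign b))"

locale partial_quiver = fin_digraph Q for Q :: "('v, 'e) pre_digraph" +
  fixes J :: "'v set"
  assumes conn: "Digraph_Component.connected Q" and J_verts: "J \<subseteq> verts Q" and J_nonempty: "J \<noteq> {}"
begin

abbreviation "D \<equiv> double_quiver Q"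

sublocale D: fin_digraph D
  by (rule double_quiver_fin_digraph[OF fin_digraph_axioms])

abbreviation "\<mu> \<equiv> moment_elt Q"
abbreviation "L \<equiv> partial_relation_space Q J"

lemma arc_ends_verts [simp]: "b \<in> arcs D \<Longrightarrow> tail D b \<in> verts Q" "b \<in> arcs D \<Longrightarrow> head D b \<in> verts Q"
  using D.tail_in_verts[of b] D.head_in_verts[of b] by simp_all

lemma loop_path: "b \<in> arcs D \<Longrightarrow> (tail D b, [b, opp b], tail D b) \<in> paths D"
  by (auto simp: paths_def D.awalk_Cons_iff D.awalk_Nil_iff)

lemma R_mult_single:
  assumes "(u, p, v) \<in> paths D"
  shows "path_mult (path_mult (R_to_F D r) (Poly_Mapping.single (u, p, v) c)) (R_to_F D s)
    = Poly_Mapping.single (u, p, v) (r u * s v * c)"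
  using R_to_F_mult_single[OF D.fin_digraph_axioms assms] by (simp add: mult_ac)

lemma R_mult_moment_elt:
  "path_mult (path_mult (R_to_F D r) (\<mu> i)) (R_to_F D s) = pscale (r i * s i) (\<mu> i)"
  unfolding moment_elt_def path_mult_sum_left path_mult_sum_right pvs.scale_sum_right pscale_single
  using loop_path by (intro sum.cong) (auto simp: R_mult_single)

lemma sum_moment_elt:
  "(\<Sum>a\<in>arcs Q. path_commutator (arc_elt D (Orig a)) (arc_elt D (Star a))) = (\<Sum>i\<in>verts Q. \<mu> i)"
proof -
  let ?f = "\<lambda>b. Poly_Mapping.single (tail D b, [b, opp b], tail D b) (arc_sign b)"
  have comm: "path_commutator (arc_elt D (Orig a)) (arc_elt D (Star a)) = ?f (Orig a) + ?f (Star a)" for a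
    by (simp add: path_commutator_def arc_elt_def path_mult_single path_single_mult_def double_quiver_def
        single_uminus)
  have arcs_D: "arcs D = Orig ` arcs Q \<union> Star ` arcs Q" by (simp add: double_quiver_def)
  have "(\<Sum>i\<in>verts Q. \<mu> i) = (\<Sum>i\<in>verts Q. \<Sum>b | b \<in> arcs D \<and> tail D b = i. ?f b)"
    unfolding moment_elt_def by (intro sum.cong) auto
  also have "\<dots> = (\<Sum>b\<in>arcs D. ?f b)"
    using D.finite_arcs D.finite_verts by (intro sum.group) auto
  also have "\<dots> = (\<Sum>b\<in>Orig ` arcs Q. ?f b) + (\<Sum>b\<in>Star ` arcs Q. ?f b)"
    unfolding arcs_D by (intro sum.union_disjoint) auto
  also have "\<dots> = (\<Sum>a\<in>arcs Q. ?f (Orig a)) + (\<Sum>a\<in>arcs Q. ?f (Star a))"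
    by (subst (1 2) sum.reindex) (auto simp: inj_on_def)
  finally show ?thesis unfolding comm sum.distrib ..
qed

lemma one_minus_idem:
  "\<one>\<^bsub>path_algebra D\<^esub> - (\<Sum>i\<in>J. vertex_idem i) = R_to_F D (\<lambda>i. if i \<in> J then 0 else 1)"
proof -
  have eq: "(\<Sum>i\<in>J. vertex_idem i) = (\<Sum>i\<in>verts Q. if i \<in> J then vertex_idem i else 0)"
    using J_verts by (simp add: sum.If_cases Int_absorb1)
  have "(\<Sum>i\<in>verts Q. vertex_idem i) - (\<Sum>i\<in>J. vertex_idem i)
      = (\<Sum>i\<in>verts Q. pscale (if i \<in> J then 0 else 1) (vertex_idem i))"
    unfolding eq sum_subtractf[symmetric] by (intro sum.cong) auto
  then show ?thesis
    by (simp add: path_algebra_def R_to_F_def)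
qed

lemma partial_relation_eq: "partial_relation Q J = (\<Sum>i\<in>verts Q - J. \<mu> i)"
proof -
  have "partial_relation Q J = (\<Sum>i\<in>verts Q. if i \<in> J then 0 else \<mu> i)"
    unfolding partial_relation_def Let_def one_minus_idem sum_moment_elt
    unfolding path_mult_sum_left path_mult_sum_right R_mult_moment_elt by (intro sum.cong) auto
  also have "\<dots> = (\<Sum>i\<in>verts Q - J. \<mu> i)"
    by (subst sum.If_cases) (auto simp: Diff_eq)
  finally show ?thesis .
qed

lemma R_mult_partial_relation:
  "path_mult (path_mult (R_to_F D r) (partial_relation Q J)) (R_to_F D s)
    = (\<Sum>i\<in>verts Q - J. pscale (r i * s i) (\<mu> i))"
  unfolding partial_relation_eq path_mult_sum_left path_mult_sum_right R_mult_moment_elt ..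

lemma relation_space_eq: "L = pspan (\<mu> ` (verts Q - J))"
  unfolding partial_relation_space_def sub_bimodule_gen_def
proof (rule pvs.span_eq[THEN iffD2], intro conjI subsetI)
  fix x assume "x \<in> {path_mult (path_mult (R_to_F D r) (partial_relation Q J)) (R_to_F D s) | r s. True}"
  then show "x \<in> pspan (\<mu> ` (verts Q - J))"
    by (auto simp: R_mult_partial_relation intro!: pvs.span_sum pvs.span_scale intro: pvs.span_base)
next
  fix x assume "x \<in> \<mu> ` (verts Q - J)"
  then obtain i where i: "i \<in> verts Q - J" "x = \<mu> i" by auto
  \<comment> \<open>The idempotent at i isolates the summand of that vertex.\<close>
  let ?r = "\<lambda>j. if j = i then 1 else 0"
  have "(\<Sum>j\<in>verts Q - J. pscale (?r j * 1) (\<mu> j)) = (\<Sum>j\<in>verts Q - J. if j = i then \<mu> i else 0)"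
    by (intro sum.cong) auto
  also have "\<dots> = x" using i by simp
  finally have "x = path_mult (path_mult (R_to_F D ?r) (partial_relation Q J)) (R_to_F D (\<lambda>_. 1))"
    by (simp only: R_mult_partial_relation)
  then show "x \<in> pspan {path_mult (path_mult (R_to_F D r) (partial_relation Q J)) (R_to_F D s) | r s. True}"
    by (intro pvs.span_base) blast
qed

lemma lookup_moment_elt:
  "Poly_Mapping.lookup (\<mu> i) (j, [b, c], k)
    = (if b \<in> arcs D \<and> tail D b = i \<and> c = opp b \<and> j = i \<and> k = i then arc_sign b else 0)"
proof -
  have "Poly_Mapping.lookup (\<mu> i) (j, [b, c], k)
      = (\<Sum>b' | b' \<in> arcs D \<and> tail D b' = i. if b' = b then (if c = opp b \<and> j = i \<and> k = i then arc_sign b else 0) else 0)"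
    unfolding moment_elt_def lookup_sum lookup_single when_def by (intro sum.cong) auto
  then show ?thesis by auto
qed

text \<open>The double quiver has every edge in both directions, so a property that passes from
  tails to heads there spreads over the whole connected quiver.\<close>

lemma connected_induct:
  assumes "P i" "i \<in> verts Q" "j \<in> verts Q"
    and step: "\<And>b. b \<in> arcs D \<Longrightarrow> P (tail D b) \<Longrightarrow> P (head D b)"
  shows "P j"
proof -
  have "(i, j) \<in> rtrancl_on (verts Q) (parcs (mk_symmetric Q))"
    using conn assms(2,3) unfolding connected_def strongly_connected_def reachable_def by auto
  then show ?thesis
  proof (induction rule: rtrancl_on_induct)
    case (step k l)
    then obtain a where "a \<in> arcs Q" "(k, l) = (tail Q a, head Q a) \<or> (k, l) = (head Q a, tail Q a)"
      by (auto simp: parcs_mk_symmetric)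
    then show ?case
      using assms(4)[of "Orig a"] assms(4)[of "Star a"] step by (auto simp: double_quiver_def)
  qed (use assms in auto)
qed

text \<open>If nothing starts at i, connectedness leaves i as the only vertex, and \<open>J\<close>
  would be empty. The arc guarantees that the moment element at i is nonzero, so that
  \<open>L\<close> has one basis element for each vertex outside \<open>J\<close>.\<close>

lemma ex_arc_from:
  assumes "i \<in> verts Q - J"
  shows "\<exists>b\<in>arcs D. tail D b = i"
proof (rule ccontr)
  assume none: "\<not> (\<exists>b\<in>arcs D. tail D b = i)"
  obtain j where j: "j \<in> J" using J_nonempty by auto
  have "j = i"
    by (rule connected_induct[of "\<lambda>k. k = i" i]) (use assms j J_verts none in auto)
  then show False using assms j by auto
qed

lemma hdim_relation_space: "hdim (bimod_hom D d L) = (\<Sum>i\<in>verts Q - J. d i * d i)"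
proof -
  obtain b where b: "\<And>i. i \<in> verts Q - J \<Longrightarrow> b i \<in> arcs D \<and> tail D (b i) = i"
    using ex_arc_from by metis
  interpret separated_bimodule D "verts Q - J" \<mu> "\<lambda>i. i" "\<lambda>i. i" "\<lambda>i. (i, [b i, opp (b i)], i)"
    by unfold_locales (use b in \<open>auto simp: R_mult_moment_elt lookup_moment_elt\<close>)
  show ?thesis using hdim_bimod_hom[of d] by (simp add: relation_space_eq)
qed

lemma hdim_arc_space: "hdim (bimod_hom D d (arc_space D)) = (\<Sum>b\<in>arcs D. d (tail D b) * d (head D b))"
proof -
  interpret separated_bimodule D "arcs D" "arc_elt D" "tail D" "head D" "\<lambda>b. (tail D b, [b], head D b)"
  proof unfold_locales
    fix b r s assume "b \<in> arcs D"
    then have "(tail D b, [b], head D b) \<in> paths D"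
      by (auto simp: paths_def intro: D.arc_implies_awalk)
    then show "path_mult (path_mult (R_to_F D r) (arc_elt D b)) (R_to_F D s)
        = pscale (r (tail D b) * s (head D b)) (arc_elt D b)"
      unfolding arc_elt_def by (simp add: R_mult_single pscale_single)
  qed (auto simp: arc_elt_def lookup_single when_def)
  show ?thesis using hdim_bimod_hom[of d] by (simp add: arc_space_def)
qed

section \<open>The intersection of the relation space with the commutator space\<close>

text \<open>The coefficient of the cyclic word \<open>b b\<^sup>*\<close>, which is invariant under rotation.\<close>

definition cyclic_coeff :: "'e double_arc \<Rightarrow> (('v, 'e double_arc) path \<Rightarrow>\<^sub>0 complex) \<Rightarrow> complex" where
  "cyclic_coeff b f = Poly_Mapping.lookup f (tail D b, [b, opp b], tail D b)
    + Poly_Mapping.lookup f (head D b, [opp b, b], head D b)"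

lemma cyclic_coeff_linear:
  "cyclic_coeff b 0 = 0" "cyclic_coeff b (f + g) = cyclic_coeff b f + cyclic_coeff b g"
  "cyclic_coeff b (pscale c f) = c * cyclic_coeff b f"
  "cyclic_coeff b (f - g) = cyclic_coeff b f - cyclic_coeff b g"
  by (simp_all add: cyclic_coeff_def lookup_add lookup_minus algebra_simps)

lemma cyclic_coeff_sum: "cyclic_coeff b (sum f S) = (\<Sum>i\<in>S. cyclic_coeff b (f i))"
  by (induction S rule: infinite_finite_induct) (auto simp: cyclic_coeff_linear)

text \<open>If one path is trivial, the two products have the same coefficients at closed paths. If
  neither is, a word of length two forces both to be single arcs, and interchanging them
  interchanges the two summands of \<open>cyclic_coeff\<close>.\<close>

lemma cyclic_coeff_path_single_mult:
  assumes "x \<in> paths D" "y \<in> paths D"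
  shows "cyclic_coeff b (path_single_mult x y c) = cyclic_coeff b (path_single_mult y x c)"
proof -
  obtain u p v u' q v' where xy: "x = (u, p, v)" "y = (u', q, v')" by (metis prod_cases3)
  have aw: "D.awalk u p v" "D.awalk u' q v'" using assms by (auto simp: xy paths_def)
  have lookup: "Poly_Mapping.lookup (path_single_mult (u, p, v) (u', q, v') c) (t, w, t)
      = (if v = u' \<and> u = t \<and> v' = t \<and> p @ q = w then c else 0)" for u p v u' q v' t w
    by (simp add: path_single_mult_def lookup_single when_def)
  consider "p = []" | "q = []" | "p \<noteq> []" "q \<noteq> []" by blast
  then show ?thesis
  proof cases
    case 1
    then have "u = v" using aw by (simp add: D.awalk_Nil_iff)
    then show ?thesis using 1 unfolding xy cyclic_coeff_def lookup 
      by (intro arg_cong2[of _ _ _ _ "(+)"] if_cong) auto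
  next
    case 2
    then have "u' = v'" using aw by (simp add: D.awalk_Nil_iff)
    then show ?thesis unfolding xy cyclic_coeff_def lookup 2 append_Nil append_Nil2
      by (intro arg_cong2[of _ _ _ _ "(+)"] if_cong refl) blast+
  next
    case 3
    have "xs @ ys = [s, t] \<longleftrightarrow> xs = [s] \<and> ys = [t]" if "xs \<noteq> []" "ys \<noteq> []"
      for xs ys :: "'e double_arc list" and s t
    proof -
      obtain x xs' y ys' where "xs = x # xs'" "ys = y # ys'" using \<open>xs \<noteq> []\<close> \<open>ys \<noteq> []\<close> by (meson neq_Nil_conv)
      then show ?thesis by (cases xs') auto
    qed
    then have split: "p @ q = [s, t] \<longleftrightarrow> p = [s] \<and> q = [t]" "q @ p = [s, t] \<longleftrightarrow> q = [s] \<and> p = [t]" for s t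
      using 3 by blast+
    have walk: "(v = u' \<and> u = tail D s \<and> v' = tail D s \<and> p = [s] \<and> q = [opp s]) \<longleftrightarrow> p = [s] \<and> q = [opp s]"
      "(v' = u \<and> u' = tail D s \<and> v = tail D s \<and> q = [s] \<and> p = [opp s]) \<longleftrightarrow> q = [s] \<and> p = [opp s]" for s
      using aw by (auto simp: D.awalk_Cons_iff D.awalk_Nil_iff)
    show ?thesis
      unfolding xy cyclic_coeff_def lookup split
      using walk[of b] walk[of "opp b"] by (simp add: add.commute conj_commute)
  qed
qed

lemma cyclic_coeff_commutator_space:
  assumes "f \<in> commutator_space D"
  shows "cyclic_coeff b f = 0"
proof -
  have comm: "cyclic_coeff b (path_mult x y) = cyclic_coeff b (path_mult y x)"
    if "x \<in> carrier (path_algebra D)" "y \<in> carrier (path_algebra D)" for x y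
  proof -
    have "cyclic_coeff b (path_mult x y) = (\<Sum>i\<in>Poly_Mapping.keys x. \<Sum>j\<in>Poly_Mapping.keys y.
        cyclic_coeff b (path_single_mult i j (Poly_Mapping.lookup x i * Poly_Mapping.lookup y j)))"
      by (simp add: path_mult_def cyclic_coeff_sum)
    also have "\<dots> = (\<Sum>i\<in>Poly_Mapping.keys x. \<Sum>j\<in>Poly_Mapping.keys y.
        cyclic_coeff b (path_single_mult j i (Poly_Mapping.lookup y j * Poly_Mapping.lookup x i)))"
      using that
      by (intro sum.cong refl) (subst cyclic_coeff_path_single_mult, auto simp: path_algebra_def mult.commute)
    also have "\<dots> = cyclic_coeff b (path_mult y x)"
      by (subst sum.swap) (simp add: path_mult_def cyclic_coeff_sum)
    finally show ?thesis .
  qed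
  have "pvs.subspace {f. cyclic_coeff b f = 0}"
    by (auto simp: pvs.subspace_def cyclic_coeff_linear)
  moreover have "{path_commutator x y | x y. x \<in> carrier (path_algebra D) \<and> y \<in> carrier (path_algebra D)}
      \<subseteq> {f. cyclic_coeff b f = 0}"
    using comm by (auto simp: path_commutator_def cyclic_coeff_linear)
  ultimately have "commutator_space D \<subseteq> {f. cyclic_coeff b f = 0}"
    unfolding commutator_space_def by (rule pvs.span_minimal[rotated])
  then show ?thesis using assms by auto
qed

lemma relation_space_Int_commutator_space: "L \<inter> commutator_space D = {0}"
proof (intro equalityI subsetI)
  fix f assume f: "f \<in> L \<inter> commutator_space D"
  then have "f \<in> pspan (\<mu> ` (verts Q - J))" by (simp add: relation_space_eq)
  \<comment> \<open>The coefficients are extended by zero to \<open>J\<close>, so that their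
    constancy along arcs can be used at the vertices of \<open>J\<close> too.\<close>
  then have "\<exists>c. f = (\<Sum>i\<in>verts Q. pscale (c i) (\<mu> i)) \<and> (\<forall>i\<in>J. c i = 0)"
  proof (induction rule: pvs.span_induct_alt)
    case base
    show ?case by (intro exI[of _ "\<lambda>_. 0"]) simp
  next
    case (step a x y)
    then obtain c i where c: "y = (\<Sum>i\<in>verts Q. pscale (c i) (\<mu> i))" "\<forall>i\<in>J. c i = 0"
      and i: "i \<in> verts Q - J" "x = \<mu> i" by auto
    have "pscale a x = (\<Sum>j\<in>verts Q. if j = i then pscale a (\<mu> i) else 0)"
      using i by simp
    also have "\<dots> = (\<Sum>j\<in>verts Q. pscale (if j = i then a else 0) (\<mu> j))"
      by (intro sum.cong) auto
    finally have "pscale a x + y = (\<Sum>j\<in>verts Q. pscale ((if j = i then a else 0) + c j) (\<mu> j))"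
      by (simp add: c pvs.scale_left_distrib sum.distrib)
    then show ?case using c i by (intro exI[of _ "\<lambda>j. (if j = i then a else 0) + c j"]) auto
  qed
  then obtain c where c: "f = (\<Sum>i\<in>verts Q. pscale (c i) (\<mu> i))" "\<And>i. i \<in> J \<Longrightarrow> c i = 0" by blast
  have lookup: "Poly_Mapping.lookup f (tail D b, [b, opp b], tail D b) = c (tail D b) * arc_sign b"
    if b: "b \<in> arcs D" for b
  proof -
    have "Poly_Mapping.lookup f (tail D b, [b, opp b], tail D b)
        = (\<Sum>i\<in>verts Q. if i = tail D b then c (tail D b) * arc_sign b else 0)"
      unfolding c(1) lookup_sum lookup_pscale lookup_moment_elt using b by (intro sum.cong) auto
    then show ?thesis using D.tail_in_verts[OF b] by simp
  qed
  have const: "c (tail D b) = c (head D b)" if b: "b \<in> arcs D" for b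
  proof -
    have "cyclic_coeff b f = (c (tail D b) - c (head D b)) * arc_sign b"
      using lookup[of b] lookup[of "opp b"] b by (simp add: cyclic_coeff_def algebra_simps)
    then show ?thesis using f cyclic_coeff_commutator_space[of f b] by simp
  qed
  obtain j where "j \<in> J" using J_nonempty by auto
  then have "c i = 0" if "i \<in> verts Q" for i
    by (rule_tac connected_induct[of "\<lambda>i. c i = 0" j]) (use c J_verts const that in \<open>auto simp del: split_paired_All\<close>)
  then show "f \<in> {0}" by (simp add: c(1))
next
  fix f :: "('v, 'e double_arc) path \<Rightarrow>\<^sub>0 complex" assume "f \<in> {0}"
  then show "f \<in> L \<inter> commutator_space D"
    by (simp add: relation_space_eq commutator_space_def pvs.span_zero)
qed

lemma pdim_relation_space_Int: "pdim (L \<inter> commutator_space D) = 0"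
  unfolding relation_space_Int_commutator_space by (rule pvs.dim_unique[of "{}"]) (auto simp: pvs.independent_empty)

end


section \<open>A dimension vector\<close>

lemma (in partial_quiver) ex_descent:
  obtains h :: "'v \<Rightarrow> nat" and al where "\<And>i. i \<in> verts Q - J \<Longrightarrow>
    al i \<in> arcs D \<and> tail D (al i) = i \<and> h (head D (al i)) < h i"
proof -
  define R where "R = {(tail D b, head D b) | b. b \<in> arcs D}"
  define reach where "reach n i \<longleftrightarrow> (\<exists>j\<in>J. (i, j) \<in> R ^^ n)" for n i
  obtain j0 where j0: "j0 \<in> J" using J_nonempty by auto
  have ex: "\<exists>n. reach n i" if i: "i \<in> verts Q" for i
  proof (rule connected_induct[of "\<lambda>i. \<exists>n. reach n i" j0])
    show "\<exists>n. reach n j0" using j0 by (intro exI[of _ 0]) (auto simp: reach_def)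
  next
    fix b assume b: "b \<in> arcs D" and "\<exists>n. reach n (tail D b)"
    then obtain n j where j: "j \<in> J" "(tail D b, j) \<in> R ^^ n" by (auto simp: reach_def)
    \<comment> \<open>The opposite arc leads from the head back to the tail, from where
      \<open>J\<close> can be reached.\<close>
    have "(head D b, tail D b) \<in> R" using b unfolding R_def mem_Collect_eq by (intro exI[of _ "opp b"]) simp
    from relpow_Suc_I2[OF this j(2)] show "\<exists>n. reach n (head D b)"
      using j(1) unfolding reach_def by blast
  qed (use i j0 J_verts in auto)
  define h where "h i = (LEAST n. reach n i)" for i
  have "\<exists>b. b \<in> arcs D \<and> tail D b = i \<and> h (head D b) < h i" if i: "i \<in> verts Q - J" for i
  proof -
    have reach: "reach (h i) i" unfolding h_def using ex i by (auto intro: LeastI_ex)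
    then have "h i \<noteq> 0" using i by (auto simp: reach_def intro: ccontr)
    then obtain n where n: "h i = Suc n" by (cases "h i") auto
    obtain j where j: "j \<in> J" "(i, j) \<in> R ^^ Suc n" using reach by (auto simp: reach_def n)
    then obtain i' where i': "(i, i') \<in> R" "(i', j) \<in> R ^^ n" by (meson relpow_Suc_D2)
    have "reach n i'" using i'(2) j(1) by (auto simp: reach_def)
    then have "h i' \<le> n" unfolding h_def by (rule Least_le)
    then show ?thesis using i'(1) n by (auto simp: R_def)
  qed
  then show ?thesis using that by metis
qed

lemma if_sum: "(\<Sum>x\<in>A. if c then f x else 0) = (if c then sum f A else 0)"
  by (cases c) simp_all

lemma if_mult: "a * (if c then x else 0) = (if c then a * x else 0 :: 'b::mult_zero)"
  by (cases c) simp_all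

text \<open>For k, l < d i the inequality \<open>growth\<close> makes k + l a legal middle index for
  \<open>al i\<close>. It also leaves room for the block [1 | 0] in the lower bound.\<close>

locale graded_quiver = partial_quiver Q J for Q :: "('v, 'e) pre_digraph" and J +
  fixes h :: "'v \<Rightarrow> nat" and al :: "'v \<Rightarrow> 'e double_arc" and d :: "'v \<Rightarrow> nat"
  assumes al: "\<And>i. i \<in> verts Q - J \<Longrightarrow> al i \<in> arcs D" "\<And>i. i \<in> verts Q - J \<Longrightarrow> tail D (al i) = i"
    and descent: "\<And>i. i \<in> verts Q - J \<Longrightarrow> h (head D (al i)) < h i"
    and growth: "\<And>i. i \<in> verts Q - J \<Longrightarrow> 2 * d i \<le> d (head D (al i))"
begin

lemma relation_space_carrier: "L \<subseteq> carrier (path_algebra D)"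
proof -
  have "pvs.subspace (carrier (path_algebra D))"
  proof (rule pvs.subspaceI)
    fix x y :: "('v, 'e double_arc) path \<Rightarrow>\<^sub>0 complex" and c
    assume x: "x \<in> carrier (path_algebra D)"
    then show "pscale c x \<in> carrier (path_algebra D)"
      by (auto simp: path_algebra_def in_keys_iff subset_iff)
    assume "y \<in> carrier (path_algebra D)"
    then show "x + y \<in> carrier (path_algebra D)"
      using x Poly_Mapping.keys_add[of x y] unfolding path_algebra_def by auto
  qed (simp add: path_algebra_def)
  moreover have "\<mu> i \<in> carrier (path_algebra D)" for i
    using loop_path unfolding moment_elt_def path_algebra_def by (auto intro!: keys_sum_paths)
  ultimately show ?thesis
    unfolding relation_space_eq by (intro pvs.span_minimal) auto
qed

sublocale rep_presentation D d L
  by unfold_locales (rule relation_space_carrier)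

definition eqn_index :: "('v \<times> nat \<times> nat) set" where
  "eqn_index = {(i, k, l). i \<in> verts Q - J \<and> k < d i \<and> l < d i}"

abbreviation "Y \<equiv> arc_entries D d"

definition arcs_from :: "'v \<Rightarrow> 'e double_arc set" where
  "arcs_from i = {b \<in> arcs D. tail D b = i}"

definition moment_entry :: "'v \<times> nat \<times> nat \<Rightarrow> ('e double_arc \<times> nat \<times> nat) mpoly" where
  "moment_entry = (\<lambda>(i, k, l). \<Sum>b\<in>arcs_from i. mConst (arc_sign b) *
     (\<Sum>q<d (head D b). mVar (b, k, q) * mVar (opp b, q, l)))"

lemma finite_eqn_index: "finite eqn_index"
  and card_eqn_index: "card eqn_index = (\<Sum>i\<in>verts Q - J. d i * d i)"
proof -
  have "eqn_index = (SIGMA i:verts Q - J. {..<d i} \<times> {..<d i})" by (auto simp: eqn_index_def)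
  then show "finite eqn_index" "card eqn_index = (\<Sum>i\<in>verts Q - J. d i * d i)" by simp_all
qed

lemma finite_Y: "finite Y"
  and card_Y: "card Y = (\<Sum>b\<in>arcs D. d (tail D b) * d (head D b))"
proof -
  have "Y = (SIGMA b:arcs D. {..<d (tail D b)} \<times> {..<d (head D b)})" by (auto simp: arc_entries_def)
  then show "finite Y" "card Y = (\<Sum>b\<in>arcs D. d (tail D b) * d (head D b))" by simp_all
qed

lemma finite_arcs_from: "finite (arcs_from i)"
  by (simp add: arcs_from_def)

lemma sum_block:
  assumes "v \<in> verts Q"
  shows "(\<Sum>k\<in>S. if fst k = v then g (snd k) else 0) = (\<Sum>q<d v. g q :: 'b::comm_monoid_add)"
proof -
  have "(\<Sum>k\<in>S. if fst k = v then g (snd k) else 0) = (\<Sum>k\<in>{k\<in>S. fst k = v}. g (snd k))"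
    using finite_S by (intro sum.inter_filter[symmetric])
  also have "{k\<in>S. fst k = v} = Pair v ` {..<d v}" using assms by (auto simp: block_index_def)
  also have "(\<Sum>k\<in>Pair v ` {..<d v}. g (snd k)) = (\<Sum>q<d v. g q)"
    by (subst sum.reindex) (auto simp: inj_on_def)
  finally show ?thesis .
qed

lemma rep_moment_elt:
  assumes pq: "p \<in> S" "q \<in> S"
  shows "\<rho> (\<mu> i) p q = (if fst p = i \<and> fst q = i then moment_entry (i, snd p, snd q) else 0)"
proof -
  have b: "path_mat (verts D) d (gen_mat D d) (i, [b, opp b], i) p q
      = (if fst p = i \<and> fst q = i then \<Sum>r<d (head D b). mVar (b, snd p, r) * mVar (opp b, r, snd q) else 0)"
    if "b \<in> arcs_from i" for b
  proof -
    have b: "b \<in> arcs D" "tail D b = i" using that by (auto simp: arcs_from_def)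
    have "mat_mult S (gen_mat D d (opp b)) (block_id (verts D) d i) p q = gen_mat D d (opp b) p q" for p q
      using b(2) by (intro mult_block_id) (auto simp: gen_mat_def split: if_splits)
    then have "path_mat (verts D) d (gen_mat D d) (i, [b, opp b], i) p q
        = (\<Sum>k\<in>S. gen_mat D d b p k * gen_mat D d (opp b) k q)"
      by (simp add: path_mat_def mat_mult_def)
    also have "\<dots> = (\<Sum>k\<in>S. if fst k = head D b then
        (if fst p = i \<and> fst q = i then mVar (b, snd p, snd k) * mVar (opp b, snd k, snd q) else 0) else 0)"
      using pq b(2) by (intro sum.cong) (auto simp: gen_mat_def)
    also have "\<dots> = (\<Sum>r<d (head D b).
        if fst p = i \<and> fst q = i then mVar (b, snd p, r) * mVar (opp b, r, snd q) else 0)"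
      using b(1) by (intro sum_block) simp
    finally show ?thesis unfolding if_sum .
  qed
  have "\<rho> (\<mu> i) p q = (\<Sum>b\<in>arcs_from i. mConst (arc_sign b) * path_mat (verts D) d (gen_mat D d) (i, [b, opp b], i) p q)"
    unfolding moment_elt_def path_rep_sum path_rep_single arcs_from_def ..
  also have "\<dots> = (\<Sum>b\<in>arcs_from i. mConst (arc_sign b) * (if fst p = i \<and> fst q = i then
      \<Sum>r<d (head D b). mVar (b, snd p, r) * mVar (opp b, r, snd q) else 0))"
    by (intro sum.cong refl) (simp only: b)
  also have "\<dots> = (if fst p = i \<and> fst q = i then moment_entry (i, snd p, snd q) else 0)"
    unfolding if_mult if_sum by (simp add: moment_entry_def)
  finally show ?thesis .
qed

lemma moment_entry_rep_gens:
  assumes "(i, k, l) \<in> eqn_index"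
  shows "moment_entry (i, k, l) \<in> rep_gens"
proof -
  have i: "i \<in> verts Q - J" "(i, k) \<in> S" "(i, l) \<in> S"
    using assms by (auto simp: eqn_index_def block_index_def)
  have "\<mu> i \<in> L" unfolding relation_space_eq using i by (intro pvs.span_base) auto
  moreover have "moment_entry (i, k, l) = \<rho> (\<mu> i) (i, k) (i, l)"
    using rep_moment_elt[OF i(2,3)] by simp
  ultimately show ?thesis unfolding rep_gens_def using i by blast
qed

text \<open>Vanishing after substitution is linear in the element of \<open>L\<close>, so it can be
  tested on the \<open>\<mu> i\<close>, whose entries outside the diagonal block of i are zero
  anyway.\<close>

lemma msubst_rep_gens_eq_0:
  assumes moment: "\<And>z. z \<in> eqn_index \<Longrightarrow> msubst \<sigma> (moment_entry z) = 0"
    and vanish: "\<And>y. y \<notin> Y \<Longrightarrow> \<sigma> y = 0"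
    and "g \<in> rep_gens"
  shows "msubst \<sigma> g = 0"
  using assms(3) unfolding rep_gens_def
proof (elim UnE CollectE exE conjE)
  fix f p q assume g: "g = \<rho> f p q" and f: "f \<in> L" and pq: "p \<in> S" "q \<in> S"
  have "pvs.subspace {f. msubst \<sigma> (\<rho> f p q) = 0}"
    by (auto simp: pvs.subspace_def path_rep_add path_rep_pscale msubst_add msubst_mult)
  moreover have "\<mu> i \<in> {f. msubst \<sigma> (\<rho> f p q) = 0}" if "i \<in> verts Q - J" for i
  proof -
    have "fst p = i \<and> fst q = i \<Longrightarrow> (i, snd p, snd q) \<in> eqn_index"
      using pq that by (auto simp: eqn_index_def block_index_def)
    then show ?thesis using moment[of "(i, snd p, snd q)"] by (auto simp only: rep_moment_elt[OF pq] mem_Collect_eq msubst_0 split: if_splits)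
  qed
  ultimately have "L \<subseteq> {f. msubst \<sigma> (\<rho> f p q) = 0}"
    unfolding relation_space_eq by (intro pvs.span_minimal) auto
  then show ?thesis using f g by auto
next
  fix y assume "g = mVar y" "y \<notin> Y"
  then show ?thesis using vanish by simp
qed

text \<open>Otherwise \<open>h\<close> would decrease from i to j and from j to i.\<close>

lemma al_neq_opp: "i \<in> verts Q - J \<Longrightarrow> j \<in> verts Q - J \<Longrightarrow> al i \<noteq> opp (al j)"
  using descent[of i] descent[of j] al(2)[of i] al(2)[of j]
  by (metis double_quiver_opp(2,3) less_asym)

lemma al_inj: "i \<in> verts Q - J \<Longrightarrow> j \<in> verts Q - J \<Longrightarrow> al i = al j \<Longrightarrow> i = j"
  using al(2) by metis

end


section \<open>Leading monomials of the moment map equations\<close>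

context graded_quiver
begin

definition dmax :: nat where "dmax = (\<Sum>i\<in>verts Q. d i)"

text \<open>One step down in \<open>h\<close> gains at least 5 * dmax^2, more than the 4 * dmax^2
  that bound a mixed term of \<open>entry_wt\<close>. The \<open>Suc\<close> keeps the factor
  positive at every vertex, so that the square subtracted in \<open>entry_wt\<close> is not
  truncated.\<close>

definition base_wt :: "'v \<Rightarrow> nat" where
  "base_wt i = 5 * dmax\<^sup>2 * (Suc (\<Sum>j\<in>verts Q. h j) - h i)"

text \<open>
  On the arcs \<open>al i\<close> and their opposites the weights are chosen such that among the monomials
  \<open>x(al i; k, q) x(al i*; q, l)\<close> of the \<open>(k, l)\<close> entry of the moment map at \<open>i\<close> the weight
  \<open>2 base_wt i + 2(k + l)\<^sup>2 - 2(q - k - l)\<^sup>2\<close> is maximal exactly for \<open>q = k + l\<close>. Since \<open>base_wt\<close> drops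
  quickly with \<open>h\<close>, the arcs \<open>al j\<close> with head \<open>i\<close> do not interfere.
\<close>

definition entry_wt :: "'e double_arc \<times> nat \<times> nat \<Rightarrow> nat" where
  "entry_wt = (\<lambda>(b, k, l).
     if b \<in> al ` (verts Q - J) then base_wt (tail D b) + 4 * l * k - l\<^sup>2
     else if opp b \<in> al ` (verts Q - J) then base_wt (head D b) + 4 * k * l - k\<^sup>2
     else 1)"

lemma d_le_dmax: "i \<in> verts Q \<Longrightarrow> d i \<le> dmax"
  unfolding dmax_def by (intro member_le_sum) auto

lemma base_wt_ge: "i \<in> verts Q \<Longrightarrow> 5 * dmax\<^sup>2 \<le> base_wt i"
proof -
  assume "i \<in> verts Q"
  then have "h i \<le> (\<Sum>j\<in>verts Q. h j)" by (intro member_le_sum) auto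
  then have "1 \<le> Suc (\<Sum>j\<in>verts Q. h j) - h i" by simp
  from mult_le_mono2[OF this, of "5 * dmax\<^sup>2"] show ?thesis unfolding base_wt_def by simp
qed

lemma base_wt_descent:
  assumes "i \<in> verts Q" "h j < h i"
  shows "base_wt i + 5 * dmax\<^sup>2 \<le> base_wt j"
proof -
  have "h i \<le> (\<Sum>j\<in>verts Q. h j)" using assms by (intro member_le_sum) auto
  then have "Suc (\<Sum>j\<in>verts Q. h j) - h i + 1 \<le> Suc (\<Sum>j\<in>verts Q. h j) - h j" using assms by simp
  then have "5 * dmax\<^sup>2 * (Suc (\<Sum>j\<in>verts Q. h j) - h i + 1) \<le> base_wt j"
    unfolding base_wt_def by (rule mult_left_mono) simp
  then show ?thesis unfolding base_wt_def by (simp add: algebra_simps)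
qed

text \<open>Adding the square to the left side frees later estimates from truncated
  subtraction.\<close>

lemma entry_wt_al:
  assumes "i \<in> verts Q - J" "l \<le> dmax"
  shows "entry_wt (al i, k, l) + l\<^sup>2 = base_wt i + 4 * l * k"
    and "entry_wt (opp (al i), l, k) + l\<^sup>2 = base_wt i + 4 * l * k"
proof -
  have "l\<^sup>2 \<le> dmax\<^sup>2" using assms by (intro power_mono) auto
  moreover have "5 * dmax\<^sup>2 \<le> base_wt i" using base_wt_ge[of i] assms by blast
  ultimately have "l\<^sup>2 \<le> base_wt i" by linarith
  moreover have "opp (al i) \<notin> al ` (verts Q - J)" using al_neq_opp assms by (metis imageE)
  ultimately show "entry_wt (al i, k, l) + l\<^sup>2 = base_wt i + 4 * l * k"
    and "entry_wt (opp (al i), l, k) + l\<^sup>2 = base_wt i + 4 * l * k"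
    using assms al(2) by (auto simp: entry_wt_def)
qed

lemma entry_wt_pos:
  assumes "y \<in> Y"
  shows "entry_wt y \<ge> 1"
proof -
  obtain b k l where y: "y = (b, k, l)" "b \<in> arcs D" "k < d (tail D b)" "l < d (head D b)"
    using assms by (auto simp: arc_entries_def)
  have kl: "k < dmax" "l < dmax" using y d_le_dmax[of "tail D b"] d_le_dmax[of "head D b"] by auto
  have sq: "k\<^sup>2 < 5 * dmax\<^sup>2" "l\<^sup>2 < 5 * dmax\<^sup>2"
    using kl power_strict_mono[of k dmax 2] power_strict_mono[of l dmax 2] by auto
  have "5 * dmax\<^sup>2 \<le> base_wt (tail D b)" "5 * dmax\<^sup>2 \<le> base_wt (head D b)"
    using base_wt_ge y by auto
  then show ?thesis using sq by (auto simp: entry_wt_def y)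
qed

lemma leading_wt:
  assumes i: "i \<in> verts Q - J" and kl: "k < d i" "l < d i"
    and b: "b \<in> arcs_from i" and q: "q < d (head D b)" and ne: "(b, q) \<noteq> (al i, k + l)"
  shows "entry_wt (b, k, q) + entry_wt (opp b, q, l)
    < entry_wt (al i, k, k + l) + entry_wt (opp (al i), k + l, l)"
proof -
  have b': "b \<in> arcs D" "tail D b = i" using b by (auto simp: arcs_from_def)
  have di: "d i \<le> dmax" using d_le_dmax i by auto
  have "head D (al i) \<in> verts Q" using al(1)[OF i] by simp
  then have "k + l \<le> dmax" using growth[OF i] kl d_le_dmax[of "head D (al i)"] by linarith
  note lead = entry_wt_al[OF i this]
  have qm: "q \<le> dmax" using q b' d_le_dmax[of "head D b"] by simp
  have lead_sum: "entry_wt (al i, k, k + l) + entry_wt (opp (al i), k + l, l)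
      = 2 * base_wt i + 2 * (k + l)\<^sup>2"
    using lead(1)[of k] lead(2)[of l] by (simp add: power2_eq_square algebra_simps)
  have pos: "dmax\<^sup>2 > 0" using di kl by simp
  consider "b = al i" | j where "j \<in> verts Q - J" "b = opp (al j)"
    | "b \<notin> al ` (verts Q - J)" "opp b \<notin> al ` (verts Q - J)"
    using al(2) b'(2) by (metis imageE opp_simps(1))
  then show ?thesis
  proof cases
    case 1
    then have "q \<noteq> k + l" using ne by auto
    \<comment> \<open>The square is completed over the integers, where q - (k + l) may be
      negative.\<close>
    then have "(int q - int (k + l))\<^sup>2 > 0" by simp
    then have "2 * (2 * int q * int (k + l)) < 2 * (int q)\<^sup>2 + 2 * (int (k + l))\<^sup>2"
      by (simp add: power2_eq_square algebra_simps)
    then have "int (4 * q * (k + l)) < int (2 * q\<^sup>2 + 2 * (k + l)\<^sup>2)" by simp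
    then have "4 * q * (k + l) < 2 * q\<^sup>2 + 2 * (k + l)\<^sup>2" by (simp only: of_nat_less_iff)
    moreover have "entry_wt (b, k, q) + entry_wt (opp b, q, l) + 2 * q\<^sup>2 = 2 * base_wt i + 4 * q * (k + l)"
      using entry_wt_al[OF i qm, of k] entry_wt_al[OF i qm, of l] 1 by (simp add: algebra_simps)
    ultimately show ?thesis unfolding lead_sum by linarith
  next
    case 2
    have h: "head D (al j) = i" "head D b = j" using 2 b'(2) al(2) by auto
    have km: "k \<le> dmax" "l \<le> dmax" using kl di by auto
    have "entry_wt (b, k, q) + k\<^sup>2 = base_wt j + 4 * k * q" "entry_wt (opp b, q, l) + l\<^sup>2 = base_wt j + 4 * l * q"
      using entry_wt_al[OF 2(1), of k q] entry_wt_al[OF 2(1), of l q] km 2 by auto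
    \<comment> \<open>Here \<open>al j\<close> ends at i, so \<open>h i < h j\<close>. The two mixed
      terms add at most 8 * dmax^2, while the two base weights lose at least 10 * dmax^2.\<close>
    moreover have "4 * k * q \<le> 4 * dmax\<^sup>2" "4 * l * q \<le> 4 * dmax\<^sup>2"
      using km qm by (auto simp: power2_eq_square intro: mult_mono)
    moreover have "base_wt j + 5 * dmax\<^sup>2 \<le> base_wt i"
      using base_wt_descent[of j i] descent[OF 2(1)] 2(1) h by auto
    ultimately show ?thesis unfolding lead_sum using pos by linarith
  next
    case 3
    then have "entry_wt (b, k, q) = 1" "entry_wt (opp b, q, l) = 1" by (auto simp: entry_wt_def)
    moreover have "5 * dmax\<^sup>2 \<le> base_wt i" using base_wt_ge i by auto
    ultimately show ?thesis unfolding lead_sum using pos by linarith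
  qed
qed

definition lead1 :: "'v \<times> nat \<times> nat \<Rightarrow> 'e double_arc \<times> nat \<times> nat" where
  "lead1 = (\<lambda>(i, k, l). (al i, k, k + l))"

definition lead2 :: "'v \<times> nat \<times> nat \<Rightarrow> 'e double_arc \<times> nat \<times> nat" where
  "lead2 = (\<lambda>(i, k, l). (opp (al i), k + l, l))"

lemma moment_entry_leading:
  assumes z: "z \<in> eqn_index"
  shows "\<exists>c r. c \<noteq> 0 \<and>
      (\<forall>m\<in>Poly_Mapping.keys r. mwt entry_wt m < entry_wt (lead1 z) + entry_wt (lead2 z)) \<and>
      mConst c * (mVar (lead1 z) * mVar (lead2 z)) + r \<in> rep_gens"
proof -
  obtain i k l where ikl: "z = (i, k, l)" "i \<in> verts Q - J" "k < d i" "l < d i"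
    using z by (auto simp: eqn_index_def)
  let ?T = "SIGMA b:arcs_from i. {..<d (head D b)}"
  let ?f = "\<lambda>(b, q). mConst (arc_sign b) * (mVar (b, k, q) * mVar (opp b, q, l)) :: ('e double_arc \<times> nat \<times> nat) mpoly"
  let ?x = "(al i, k + l)" and ?W = "entry_wt (lead1 z) + entry_wt (lead2 z)"
  have "moment_entry z = (\<Sum>x\<in>?T. ?f x)"
    by (simp add: moment_entry_def ikl sum_distrib_left sum.Sigma finite_arcs_from)
  also have "\<dots> = ?f ?x + (\<Sum>x\<in>?T - {?x}. ?f x)"
  proof (rule sum.remove)
    show "finite ?T" by (simp add: finite_arcs_from)
    show "?x \<in> ?T" using al[OF ikl(2)] growth[OF ikl(2)] ikl by (auto simp: arcs_from_def)
  qed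
  finally have eq: "moment_entry z = mConst (arc_sign (al i)) * (mVar (lead1 z) * mVar (lead2 z))
      + (\<Sum>x\<in>?T - {?x}. ?f x)" by (simp add: ikl lead1_def lead2_def)
  have lt: "?f x \<in> wt_le entry_wt (?W - 1)" if "x \<in> ?T - {?x}" for x
  proof -
    obtain b q where x: "x = (b, q)" "b \<in> arcs_from i" "q < d (head D b)" using \<open>x \<in> _\<close> by auto
    have "entry_wt (b, k, q) + entry_wt (opp b, q, l) < ?W"
      using leading_wt[OF ikl(2-4) x(2,3)] that x by (auto simp: ikl lead1_def lead2_def)
    then have "entry_wt (b, k, q) + entry_wt (opp b, q, l) \<le> ?W - 1" by linarith
    moreover have "?f x \<in> wt_le entry_wt (entry_wt (b, k, q) + entry_wt (opp b, q, l))"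
      unfolding x by (auto intro!: wt_le_const wt_le_mult wt_le_var)
    ultimately show ?thesis using wt_le_mono by blast
  qed
  then have r: "(\<Sum>x\<in>?T - {?x}. ?f x) \<in> wt_le entry_wt (?W - 1)" by (rule wt_le_sum)
  have "lead1 z \<in> Y" using al[OF ikl(2)] growth[OF ikl(2)] ikl by (auto simp: lead1_def arc_entries_def)
  \<comment> \<open>Positivity turns the bound \<open>?W - 1\<close> on natural numbers into a
    strict bound by \<open>?W\<close>.\<close>
  then have "?W > 0" using entry_wt_pos[of "lead1 z"] by linarith
  then have "\<forall>m\<in>Poly_Mapping.keys (\<Sum>x\<in>?T - {?x}. ?f x). mwt entry_wt m < ?W"
    using r by (fastforce simp: wt_le_def)
  then show ?thesis
    using moment_entry_rep_gens[of i k l] z eq ikl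
    by (intro exI[of _ "arc_sign (al i)"] exI[of _ "\<Sum>x\<in>?T - {?x}. ?f x"]) auto
qed

theorem rep_gens_prime_chain_le:
  assumes "prime_chain rep_gens n"
  shows "n \<le> card Y - card eqn_index"
proof -
  interpret coprime_leading_monoms Y entry_wt eqn_index lead1 lead2 rep_gens
  proof unfold_locales
    \<comment> \<open>Both (k, k + l) and (k + l, l) determine k and l, and the arc determines
      i.\<close>
    show "inj_on lead1 eqn_index" "inj_on lead2 eqn_index"
      using al_inj by (auto simp: inj_on_def lead1_def lead2_def eqn_index_def) (metis opp_simps(1))+
    show "lead1 ` eqn_index \<inter> lead2 ` eqn_index = {}"
      using al_neq_opp by (fastforce simp: lead1_def lead2_def eqn_index_def)
    show "lead1 ` eqn_index \<subseteq> Y" "lead2 ` eqn_index \<subseteq> Y"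
      using al growth by (fastforce simp: lead1_def lead2_def eqn_index_def arc_entries_def)+
    show "mVar x \<in> rep_gens" if "x \<notin> Y" for x using that unfolding rep_gens_def by blast
  qed (use finite_Y finite_eqn_index entry_wt_pos moment_entry_leading in blast)+
  show ?thesis by (rule prime_chain_le[OF assms])
qed

end


section \<open>Solving the moment map equations\<close>

text \<open>Cramer's rule for a square system with an arbitrary finite index set, with \<delta> the
  determinant and \<open>B\<close> the adjugate. A homomorphism that fixes the entries fixes
  \<delta>. If some homomorphism makes the kernel trivial, the image of \<delta> is nonzero, and
  therefore \<delta> is too.\<close>

lemma ex_adjugate:
  fixes A :: "'i \<Rightarrow> 'i \<Rightarrow> 'b::idom"
  assumes "finite Z"
  obtains \<delta> B where
    "\<And>z z'. z \<in> Z \<Longrightarrow> z' \<in> Z \<Longrightarrow> (\<Sum>w\<in>Z. A z w * B w z') = (if z = z' then \<delta> else 0)"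
    and "\<And>f. comm_ring_hom f \<Longrightarrow> (\<And>z w. z \<in> Z \<Longrightarrow> w \<in> Z \<Longrightarrow> f (A z w) = A z w) \<Longrightarrow> f \<delta> = \<delta>"
    and "\<And>f :: 'b \<Rightarrow> 'b. comm_ring_hom f \<Longrightarrow>
      (\<And>v. (\<And>z. z \<in> Z \<Longrightarrow> (\<Sum>w\<in>Z. f (A z w) * v w) = 0) \<Longrightarrow> (\<forall>w\<in>Z. v w = 0)) \<Longrightarrow> \<delta> \<noteq> 0"
proof -
  define n where "n = card Z"
  obtain e where e: "bij_betw e {0..<n} Z" using ex_bij_betw_nat_finite[OF assms] n_def by blast
  define e' where "e' = inv_into {0..<n} e"
  have e'e: "e' (e i) = i" if "i < n" for i
    using e that by (simp add: e'_def bij_betw_def)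
  have ee': "e' z < n" "e (e' z) = z" if "z \<in> Z" for z
    using e that inv_into_into[of z e "{0..<n}"] by (auto simp: e'_def bij_betw_def f_inv_into_f)
  have eZ: "e i \<in> Z" if "i < n" for i using e that by (auto simp: bij_betw_def)
  have sum_Z: "(\<Sum>w\<in>Z. g w) = (\<Sum>i=0..<n. g (e i))" for g :: "'i \<Rightarrow> 'b"
    using sum.reindex_bij_betw[OF e, of g] by simp
  define M where "M = mat n n (\<lambda>(i, j). A (e i) (e j))"
  have M: "M \<in> carrier_mat n n" by (simp add: M_def)
  have M_index: "M $$ (i, j) = A (e i) (e j)" if "i < n" "j < n" for i j using that by (simp add: M_def)
  note adj = adj_mat[OF M]
  note dims = carrier_matD[OF M] carrier_matD[OF adj(1)]
  show ?thesis
  proof (rule that[of "\<lambda>w z. adj_mat M $$ (e' w, e' z)" "det M"])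
    fix z z' assume z: "z \<in> Z" "z' \<in> Z"
    have "(\<Sum>w\<in>Z. A z w * adj_mat M $$ (e' w, e' z')) = (M * adj_mat M) $$ (e' z, e' z')"
      using ee'[OF z(1)] ee'[OF z(2)]
      by (auto simp: sum_Z scalar_prod_def e'e dims M_index intro!: sum.cong)
    also have "\<dots> = (if z = z' then det M else 0)"
      unfolding adj(2) using ee'[OF z(1)] ee'[OF z(2)] by auto
    finally show "(\<Sum>w\<in>Z. A z w * adj_mat M $$ (e' w, e' z')) = (if z = z' then det M else 0)" .
  next
    fix f :: "'b \<Rightarrow> 'b" assume f: "comm_ring_hom f"
      and fix_A: "\<And>z w. z \<in> Z \<Longrightarrow> w \<in> Z \<Longrightarrow> f (A z w) = A z w"
    interpret comm_ring_hom f by fact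
    have "map_mat f M = M" using eZ fix_A by (auto simp: M_def)
    then show "f (det M) = det M" by (metis hom_det)
  next
    fix f :: "'b \<Rightarrow> 'b" assume f: "comm_ring_hom f"
      and ker: "\<And>v. (\<And>z. z \<in> Z \<Longrightarrow> (\<Sum>w\<in>Z. f (A z w) * v w) = 0) \<Longrightarrow> \<forall>w\<in>Z. v w = 0"
    interpret comm_ring_hom f by fact
    have fM: "map_mat f M \<in> carrier_mat n n" using M by simp
    have "det (map_mat f M) \<noteq> 0"
    proof
      assume "det (map_mat f M) = 0"
      then obtain v where v: "v \<in> carrier_vec n" "v \<noteq> 0\<^sub>v n" "map_mat f M *\<^sub>v v = 0\<^sub>v n"
        using det_0_iff_vec_prod_zero[OF fM] by blast
      have "(\<Sum>w\<in>Z. f (A z w) * v $ e' w) = 0" if z: "z \<in> Z" for z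
      proof -
        have "(\<Sum>w\<in>Z. f (A z w) * v $ e' w) = (map_mat f M *\<^sub>v v) $ e' z"
          using ee'[OF z] carrier_vecD[OF v(1)]
          by (auto simp: sum_Z scalar_prod_def e'e dims M_index intro!: sum.cong)
        then show ?thesis using ee'[OF z] by (simp add: v(3))
      qed
      from ker[of "\<lambda>w. v $ e' w", OF this] have "v $ i = 0" if "i < n" for i
        using eZ[OF that] e'e[OF that] by metis
      then have "v = 0\<^sub>v n" using v(1) by (intro eq_vecI) auto
      then show False using v(2) by simp
    qed
    then show "det M \<noteq> 0" using hom_det[of M] by auto
  qed
qed

section \<open>The moment map as a bilinear system and its polynomial solution\<close>

primrec is_star :: "'e double_arc \<Rightarrow> bool" where
  "is_star (Orig a) = False" | "is_star (Star a) = True"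

lemma is_star_opp [simp]: "is_star (opp b) \<longleftrightarrow> \<not> is_star b"
  by (cases b) auto

context graded_quiver
begin

text \<open>
  From each pair of opposite arcs we choose one, namely \<open>opp (al i)\<close> whenever this is possible. The
  moment map is bilinear in the entries of the chosen arcs and of the other ones.
\<close>

definition yside :: "'e double_arc \<Rightarrow> bool" where
  "yside b \<longleftrightarrow> opp b \<in> al ` (verts Q - J) \<or> (b \<notin> al ` (verts Q - J) \<and> is_star b)"

lemma yside_al [simp]: "i \<in> verts Q - J \<Longrightarrow> \<not> yside (al i)" "i \<in> verts Q - J \<Longrightarrow> yside (opp (al i))"
  using al_neq_opp by (fastforce simp: yside_def)+

lemma yside_opp [simp]: "yside (opp b) \<longleftrightarrow> \<not> yside b"
proof -
  have "\<not> (b \<in> al ` (verts Q - J) \<and> opp b \<in> al ` (verts Q - J))"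
    using al_neq_opp by (metis imageE)
  then show ?thesis by (auto simp: yside_def)
qed

text \<open>The moment map entry with its two groups of unknowns separated: \<open>y\<close> is read
  only on the chosen arcs and \<open>x\<close> only on the others, so for fixed \<open>x\<close> it
  is a linear form in \<open>y\<close>.\<close>

definition bilin :: "'v \<times> nat \<times> nat \<Rightarrow> ('e double_arc \<times> nat \<times> nat \<Rightarrow> 'z mpoly) \<Rightarrow>
    ('e double_arc \<times> nat \<times> nat \<Rightarrow> 'z mpoly) \<Rightarrow> 'z mpoly" where
  "bilin = (\<lambda>(i, k, l) x y. \<Sum>b\<in>arcs_from i. mConst (arc_sign b) * (\<Sum>q<d (head D b).
     if yside b then y (b, k, q) * x (opp b, q, l) else x (b, k, q) * y (opp b, q, l)))"

lemma msubst_moment_entry: "msubst \<sigma> (moment_entry z) = bilin z \<sigma> \<sigma>"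
  by (cases z) (auto simp: moment_entry_def bilin_def msubst_sum msubst_mult intro!: sum.cong)

lemma msubst_bilin: "msubst g (bilin z x y) = bilin z (\<lambda>v. msubst g (x v)) (\<lambda>v. msubst g (y v))"
  by (cases z) (simp add: bilin_def msubst_sum msubst_mult if_distrib[of "msubst g"] cong: if_cong)

lemma bilin_cong:
  assumes "z \<in> eqn_index" "\<And>v. v \<in> Y \<Longrightarrow> \<not> yside (fst v) \<Longrightarrow> x v = x' v" "\<And>v. v \<in> Y \<Longrightarrow> yside (fst v) \<Longrightarrow> y v = y' v"
  shows "bilin z x y = bilin z x' y'"
  using assms(1) unfolding bilin_def
  by (cases z) (auto simp: eqn_index_def arcs_from_def arc_entries_def intro!: sum.cong assms(2,3)
      arg_cong2[of _ _ _ _ "(*)"])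

lemma bilin_add: "bilin z x (\<lambda>v. y v + y' v) = bilin z x y + bilin z x y'"
proof -
  have "(if c then (y v + y' v) * a else a' * (y w + y' w)) = (if c then y v * a else a' * y w)
      + (if c then y' v * a else a' * y' w)" for c v w a a'
    by (simp add: algebra_simps)
  then show ?thesis by (cases z) (simp only: bilin_def prod.case sum.distrib distrib_left)
qed

lemma bilin_mult: "bilin z x (\<lambda>v. c * y v) = c * bilin z x y"
proof -
  have "(if e then c * y v * a else a' * (c * y w)) = c * (if e then y v * a else a' * y w)" for e v w a a'
    by (simp add: algebra_simps)
  then show ?thesis
    by (cases z) (simp only: bilin_def prod.case sum_distrib_left mult.left_commute[of _ c])
qed

lemma bilin_zero: "bilin z x (\<lambda>v. 0) = 0"
  using bilin_mult[of z x 0 "\<lambda>v. 0"] by simp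

lemma bilin_sum: "bilin z x (\<lambda>v. \<Sum>w\<in>T. y w v) = (\<Sum>w\<in>T. bilin z x (y w))"
  by (induction T rule: infinite_finite_induct) (auto simp: bilin_zero bilin_add)

definition solved :: "'v \<times> nat \<times> nat \<Rightarrow> 'e double_arc \<times> nat \<times> nat" where
  "solved = (\<lambda>(i, k, l). (opp (al i), k, l))"

lemma inj_solved: "inj_on solved eqn_index"
  using al_inj by (auto simp: inj_on_def solved_def eqn_index_def) (metis opp_simps(1))+

lemma solved_Y: "solved ` eqn_index \<subseteq> {v \<in> Y. yside (fst v)}"
  using al growth by (fastforce simp: solved_def eqn_index_def arc_entries_def)

definition identity_entry :: "'e double_arc \<times> nat \<times> nat \<Rightarrow> 'z mpoly" where
  "identity_entry = (\<lambda>(b, k, l). if b \<in> al ` (verts Q - J) \<and> k = l then 1 else 0)"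

text \<open>
  If each \<open>al i\<close> acts by \<open>[1 | 0]\<close> and the other unchosen arcs by zero, then the system for the entries
  of the \<open>opp (al i)\<close> is triangular with respect to \<open>h\<close>.
\<close>

lemma bilin_identity_kernel:
  fixes c :: "'v \<times> nat \<times> nat \<Rightarrow> nat mpoly"
  assumes zero: "\<And>z. z \<in> eqn_index \<Longrightarrow> bilin z identity_entry
    (\<lambda>v. \<Sum>w\<in>eqn_index. c w * (if v = solved w then 1 else 0)) = 0"
  shows "\<forall>w\<in>eqn_index. c w = 0"
proof -
  define y where "y = (\<lambda>v. \<Sum>w\<in>eqn_index. c w * (if v = solved w then 1 else 0))"
  have y_solved: "y (solved w) = c w" if "w \<in> eqn_index" for w
  proof -
    have "y (solved w) = (\<Sum>w'\<in>eqn_index. if w' = w then c w else 0)"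
      unfolding y_def using inj_onD[OF inj_solved _ that] by (intro sum.cong) auto
    then show ?thesis using that finite_eqn_index by simp
  qed
  have y_out: "y v = 0" if "v \<notin> solved ` eqn_index" for v
    unfolding y_def using that by (intro sum.neutral) auto
  have y_zero: "y (opp (al i), k, l) = 0" if "i \<in> verts Q - J" for i k l
    using that
  \<comment> \<open>Induction from large to small \<open>h\<close>: besides the unknowns of i, the
    equation at i contains only those of vertices j whose \<open>al j\<close> ends at i, and these
    have \<open>h i < h j\<close>.\<close>
  proof (induction "(\<Sum>j\<in>verts Q. h j) - h i" arbitrary: i k l rule: less_induct)
    case less
    show ?case
    proof (cases "k < d i \<and> l < d i")
      case False
      then have "(opp (al i), k, l) \<notin> solved ` eqn_index"
        using al_inj less.prems by (auto simp: solved_def eqn_index_def) (metis opp_simps(1))+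
      then show ?thesis by (rule y_out)
    next
      case True
      let ?t = "\<lambda>b. mConst (arc_sign b) * (\<Sum>q<d (head D b).
         if yside b then y (b, k, q) * identity_entry (opp b, q, l) else identity_entry (b, k, q) * y (opp b, q, l))"
      \<comment> \<open>On the chosen side either the other factor is zero by the choice of
        \<open>identity_entry\<close> or \<open>y\<close> is zero by induction; on the other side
        \<open>identity_entry\<close> is zero, as only \<open>al i\<close> itself starts at
        i.\<close>
      have other: "?t b = 0" if b: "b \<in> arcs_from i" "b \<noteq> al i" for b
      proof -
        have "(if yside b then y (b, k, q) * identity_entry (opp b, q, l)
            else identity_entry (b, k, q) * y (opp b, q, l)) = 0" for q
        proof (cases "yside b")
          case True
          show ?thesis
          proof (cases "opp b \<in> al ` (verts Q - J)")
            case True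
            then obtain j where j: "j \<in> verts Q - J" "opp b = al j" by auto
            then have bj: "b = opp (al j)" by (metis opp_simps(1))
            then have "head D (al j) = i" using b by (simp add: arcs_from_def)
            then have "h i < h j" using descent[OF j(1)] by simp
            moreover have "h j \<le> (\<Sum>j\<in>verts Q. h j)" using j by (intro member_le_sum) auto
            ultimately have "y (b, k, q) = 0" unfolding bj by (intro less.hyps j) auto
            then show ?thesis by (simp add: \<open>yside b\<close>)
          qed (simp add: \<open>yside b\<close> identity_entry_def)
        next
          case False
          have "b \<notin> al ` (verts Q - J)" using b al(2) by (auto simp: arcs_from_def)
          then show ?thesis using False by (simp add: identity_entry_def)
        qed
        then show ?thesis by simp
      qed
      have i: "al i \<in> arcs_from i" using al[OF less.prems] by (simp add: arcs_from_def)
      have "bilin (i, k, l) identity_entry y = (\<Sum>b\<in>arcs_from i. if b = al i then ?t (al i) else 0)"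
        unfolding bilin_def prod.case using other by (intro sum.cong) auto
      also have "\<dots> = ?t (al i)" using i finite_arcs_from by simp
      also have "\<dots> = mConst (arc_sign (al i)) *
          (\<Sum>q<d (head D (al i)). if q = k then y (opp (al i), k, l) else 0)"
        using less.prems
        by (intro arg_cong2[of _ _ _ _ "(*)"] refl sum.cong) (auto simp: identity_entry_def)
      also have "\<dots> = mConst (arc_sign (al i)) * y (opp (al i), k, l)"
        using growth[OF less.prems] True by simp
      finally have "mConst (arc_sign (al i)) * y (opp (al i), k, l) = bilin (i, k, l) identity_entry y" ..
      also have "\<dots> = 0"
        unfolding y_def using True less.prems by (intro zero) (auto simp: eqn_index_def)
      finally show ?thesis by simp
    qed
  qed
  show ?thesis
  proof
    fix w assume w: "w \<in> eqn_index"
    have "y (solved w) = 0" using w by (cases w) (auto simp: solved_def eqn_index_def y_zero)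
    then show "c w = 0" using y_solved[OF w] by simp
  qed
qed

theorem rep_gens_prime_chain: "prime_chain rep_gens (card Y - card eqn_index)"
proof -
  define Yx where "Yx = {v \<in> Y. \<not> yside (fst v)}"
  define Yf where "Yf = {v \<in> Y. yside (fst v)} - solved ` eqn_index"
  have fin: "finite Yx" "finite Yf" using finite_Y by (auto simp: Yx_def Yf_def)
  have card: "card Y - card eqn_index = card Yx + card Yf"
  proof -
    have "Y = Yx \<union> (Yf \<union> solved ` eqn_index)" using solved_Y by (auto simp: Yx_def Yf_def)
    moreover have "Yx \<inter> (Yf \<union> solved ` eqn_index) = {}" "Yf \<inter> solved ` eqn_index = {}"
      using solved_Y by (auto simp: Yx_def Yf_def)
    ultimately have "card Y = card Yx + (card Yf + card (solved ` eqn_index))"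
      using fin finite_eqn_index by (metis card_Un_disjoint finite_UnI finite_imageI)
    then show ?thesis by (simp add: card_image[OF inj_solved])
  qed
  obtain f g where f: "bij_betw f Yx {0..<card Yx}" and g: "bij_betw g Yf {0..<card Yf}"
    using ex_bij_betw_finite_nat fin by meson
  \<comment> \<open>The coefficients of the linear system use the parameters of \<open>Yx\<close>,
    numbered first. Hence truncation at any later parameter fixes the determinant.\<close>
  define num where "num v = (if v \<in> Yx then f v else card Yx + g v)" for v
  define x :: "'e double_arc \<times> nat \<times> nat \<Rightarrow> nat mpoly" where "x v = (if v \<in> Yx then mVar (num v) else 0)" for v
  define t :: "'e double_arc \<times> nat \<times> nat \<Rightarrow> nat mpoly" where "t v = (if v \<in> Yf then mVar (num v) else 0)" for v
  have num_x: "num v < card Yx" if "v \<in> Yx" for v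
    using f that by (auto simp: num_def bij_betw_def)
  have num_inj: "u = v" if "u \<in> Yx" "v \<in> Yx" "num u = num v" for u v
    using f that by (auto simp: num_def bij_betw_def inj_on_def)
  let ?unit = "\<lambda>w v. if v = solved w then 1 else 0 :: nat mpoly"
  define A where "A z w = bilin z x (?unit w)" for z w
  obtain \<delta> B where
    adj: "\<And>z z'. z \<in> eqn_index \<Longrightarrow> z' \<in> eqn_index \<Longrightarrow>
      (\<Sum>w\<in>eqn_index. A z w * B w z') = (if z = z' then \<delta> else 0)"
    and \<delta>_fix: "\<And>f. comm_ring_hom f \<Longrightarrow>
      (\<And>z w. z \<in> eqn_index \<Longrightarrow> w \<in> eqn_index \<Longrightarrow> f (A z w) = A z w) \<Longrightarrow> f \<delta> = \<delta>"
    and \<delta>_nonzero: "\<And>f :: nat mpoly \<Rightarrow> nat mpoly. comm_ring_hom f \<Longrightarrow>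
      (\<And>v. (\<And>z. z \<in> eqn_index \<Longrightarrow> (\<Sum>w\<in>eqn_index. f (A z w) * v w) = 0) \<Longrightarrow> (\<forall>w\<in>eqn_index. v w = 0))
      \<Longrightarrow> \<delta> \<noteq> 0"
    by (rule ex_adjugate[OF finite_eqn_index, of A]) blast
  have unit: "msubst s (?unit w v) = ?unit w v" for s w v by simp
  have "\<delta> \<noteq> 0"
  proof (rule \<delta>_nonzero)
    \<comment> \<open>The specialization of the parameters that turns the coefficients
      \<open>x\<close> into \<open>identity_entry\<close>, for which the system has trivial
      kernel.\<close>
    let ?s = "\<lambda>i. if \<exists>v\<in>Yx. num v = i \<and> identity_entry v = (1 :: nat mpoly) then 1 else 0 :: nat mpoly"
    show "comm_ring_hom (msubst ?s)" by (rule comm_ring_hom_msubst)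
    fix c :: "'v \<times> nat \<times> nat \<Rightarrow> nat mpoly"
    assume zero: "\<And>z. z \<in> eqn_index \<Longrightarrow> (\<Sum>w\<in>eqn_index. msubst ?s (A z w) * c w) = 0"
    have x: "msubst ?s (x v) = identity_entry v" if v: "v \<in> Yx" for v
    proof -
      have "?s (num v) = (if identity_entry v = (1 :: nat mpoly) then 1 else 0)"
        using v num_inj by (intro if_cong) blast+
      moreover have "identity_entry v = (1 :: nat mpoly) \<or> identity_entry v = (0 :: nat mpoly)"
        by (cases v) (simp add: identity_entry_def)
      ultimately show ?thesis using v by (auto simp: x_def)
    qed
    have "msubst ?s (A z w) = bilin z identity_entry (?unit w)" if "z \<in> eqn_index" for z w
      unfolding A_def msubst_bilin using that x by (intro bilin_cong) (auto simp: Yx_def)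
    then have "bilin z identity_entry (\<lambda>v. \<Sum>w\<in>eqn_index. c w * ?unit w v) = 0" if "z \<in> eqn_index" for z
      unfolding bilin_sum bilin_mult using zero[OF that] that by (simp add: mult.commute)
    then show "\<forall>w\<in>eqn_index. c w = 0" by (rule bilin_identity_kernel)
  qed
  have \<delta>_trunc: "mtrunc j \<delta> = \<delta>" if j: "card Yx \<le> j" for j
  proof (rule \<delta>_fix)
    have "mtrunc j (x v) = x v" for v
    proof (cases "v \<in> Yx")
      case True
      then show ?thesis using num_x[OF True] j by (simp add: x_def mtrunc_def)
    qed (simp add: x_def mtrunc_def)
    then show "mtrunc j (A z w) = A z w" for z w
      unfolding A_def mtrunc_def msubst_bilin unit by simp
  qed (rule comm_ring_hom_mtrunc)
  \<comment> \<open>Minus the adjugate applied to the contribution of the free unknowns. Applying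
    the system to it gives -\<delta> times that contribution, which cancels against the free
    unknowns because they are scaled by \<delta> in \<open>y\<close>.\<close>
  define \<zeta> where "\<zeta> w = - (\<Sum>z\<in>eqn_index. B w z * bilin z x t)" for w
  define y where "y v = (\<Sum>w\<in>eqn_index. \<zeta> w * ?unit w v) + \<delta> * t v" for v
  define \<sigma> where "\<sigma> v = (if v \<in> Yx then x v else if v \<in> Y then y v else 0)" for v
  have "msubst \<sigma> (moment_entry z) = 0" if z: "z \<in> eqn_index" for z
  proof -
    have "msubst \<sigma> (moment_entry z) = bilin z \<sigma> \<sigma>" by (rule msubst_moment_entry)
    also have "\<dots> = bilin z x y"
      by (rule bilin_cong[OF z]) (auto simp: \<sigma>_def Yx_def)
    also have "\<dots> = (\<Sum>w\<in>eqn_index. \<zeta> w * A z w) + \<delta> * bilin z x t"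
      unfolding y_def bilin_add bilin_sum bilin_mult A_def ..
    also have "(\<Sum>w\<in>eqn_index. \<zeta> w * A z w)
        = - (\<Sum>w\<in>eqn_index. \<Sum>z'\<in>eqn_index. A z w * B w z' * bilin z' x t)"
      unfolding \<zeta>_def by (simp add: sum_negf sum_distrib_left sum_distrib_right mult_ac)
    also have "(\<Sum>w\<in>eqn_index. \<Sum>z'\<in>eqn_index. A z w * B w z' * bilin z' x t)
        = (\<Sum>z'\<in>eqn_index. (\<Sum>w\<in>eqn_index. A z w * B w z') * bilin z' x t)"
      unfolding sum_distrib_right by (rule sum.swap)
    also have "\<dots> = (\<Sum>z'\<in>eqn_index. if z' = z then \<delta> * bilin z x t else 0)"
      using adj[OF z] by (intro sum.cong) auto
    also have "\<dots> = \<delta> * bilin z x t" using z finite_eqn_index by simp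
    finally show ?thesis by simp
  qed
  then have gens: "msubst \<sigma> g = 0" if "g \<in> rep_gens" for g
    by (rule msubst_rep_gens_eq_0[OF _ _ that]) (auto simp: \<sigma>_def Yx_def)
  show ?thesis
  proof (rule prime_chain_parametrization[where \<sigma> = \<sigma>, OF gens])
    fix j assume j: "j < card Y - card eqn_index"
    show "\<exists>v \<delta>. \<sigma> v = \<delta> * mVar j \<and> \<delta> \<noteq> 0 \<and> mtrunc j \<delta> = \<delta>"
    proof (cases "j < card Yx")
      case True
      then have "j \<in> f ` Yx" using f by (simp add: bij_betw_def)
      then obtain v where "v \<in> Yx" "f v = j" by blast
      then have "\<sigma> v = 1 * mVar j" by (simp add: \<sigma>_def x_def num_def)
      moreover have "mtrunc j 1 = 1" by (simp add: mtrunc_def)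
      ultimately show ?thesis by (metis one_neq_zero)
    next
      \<comment> \<open>Now j numbers a free unknown. The part of \<open>y\<close> supported on the
        solved unknowns vanishes there, so \<sigma> takes the value \<delta> * mVar j.\<close>
      case False
      then have "j - card Yx \<in> g ` Yf" using g j by (auto simp: bij_betw_def card)
      then obtain v where v: "v \<in> Yf" "g v = j - card Yx" by auto
      have "v \<notin> Yx" "v \<in> Y" "v \<notin> solved ` eqn_index" using v(1) by (auto simp: Yf_def Yx_def)
      then have "\<sigma> v = \<delta> * mVar j"
        using False v by (auto simp: \<sigma>_def y_def t_def num_def image_iff intro!: sum.neutral)
      then show ?thesis using \<open>\<delta> \<noteq> 0\<close> \<delta>_trunc[of j] False by (metis leI)
    qed
  qed
qed

end


section \<open>Choice of the dimension vector and comparison of the two bounds\<close>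

theorem proposition6p1p4:
  fixes Q :: "('v, 'e) pre_digraph" and J :: "'v set"
  assumes "fin_digraph Q"
    and "Digraph_Component.connected Q"
    and "J \<subseteq> verts Q"
    and "J \<noteq> {}"
  shows "RCI (double_quiver Q) (partial_relation_space Q J)"
  unfolding RCI_def
proof (intro allI)
  fix N :: int
  have large: "N < int (Suc (nat N) * 2 ^ k)" for k
  proof -
    have "N < int m" if "Suc (nat N) \<le> m" for m using that by linarith
    moreover have "Suc (nat N) * 1 \<le> Suc (nat N) * 2 ^ k" by (rule mult_le_mono2) simp
    ultimately show ?thesis by (metis mult.right_neutral)
  qed
  interpret fin_digraph Q by fact
  interpret partial_quiver Q J by unfold_locales fact+
  obtain h al where *: "\<And>i. i \<in> verts Q - J \<Longrightarrow>
    al i \<in> arcs D \<and> tail D (al i) = i \<and> h (head D (al i)) < (h i :: nat)"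
    using ex_descent by blast
  \<comment> \<open>The exponent increases by at least one along each \<open>al i\<close>, which
    gives the doubling; the factor \<open>Suc (nat N)\<close> exceeds N even if N is
    negative.\<close>
  define d where "d i = Suc (nat N) * 2 ^ ((\<Sum>j\<in>verts Q. h j) - h i)" for i
  have growth: "2 * d i \<le> d (head D (al i))" if i: "i \<in> verts Q - J" for i
  proof -
    have "h i \<le> (\<Sum>j\<in>verts Q. h j)" using i by (intro member_le_sum) auto
    then have "Suc ((\<Sum>j\<in>verts Q. h j) - h i) \<le> (\<Sum>j\<in>verts Q. h j) - h (head D (al i))"
      using *[OF i] by linarith
    then have "2 ^ Suc ((\<Sum>j\<in>verts Q. h j) - h i) \<le> (2 :: nat) ^ ((\<Sum>j\<in>verts Q. h j) - h (head D (al i)))"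
      by (rule power_increasing) simp
    from mult_le_mono2[OF this, of "Suc (nat N)"] show ?thesis unfolding d_def by simp
  qed
  interpret graded_quiver Q J h al d by unfold_locales (use * growth in auto)
  let ?n = "card Y - card eqn_index"
  have "rep_dim (verts D) d (quot_alg D L) (R_to_quot_alg D L) = ereal (real ?n)"
    unfolding rep_dim_eq
  proof (rule antisym)
    show "Sup {ereal (real n) | n. prime_chain rep_gens n} \<le> ereal (real ?n)"
      using rep_gens_prime_chain_le by (intro Sup_least) auto
    show "ereal (real ?n) \<le> Sup {ereal (real n) | n. prime_chain rep_gens n}"
      using rep_gens_prime_chain by (intro Sup_upper) blast
  qed
  moreover have "real ?n = real (hdim (bimod_hom D d (arc_space D))) - real (hdim (bimod_hom D d L))
      + real (pdim (L \<inter> commutator_space D))"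
  proof -
    \<comment> \<open>There are at most as many equations as arc entries, so the difference of
      cardinalities in \<open>?n\<close> is not truncated and may be read in the reals.\<close>
    have "card (solved ` eqn_index) \<le> card Y" using solved_Y by (intro card_mono finite_Y) auto
    then show ?thesis
      by (simp add: card_image[OF inj_solved] of_nat_diff hdim_arc_space hdim_relation_space
          pdim_relation_space_Int card_Y card_eqn_index)
  qed
  moreover have "int (d i) > N" for i unfolding d_def by (rule large)
  ultimately show "\<exists>d. (\<forall>i\<in>verts D. int (d i) > N) \<and>
      rep_dim (verts D) d (quot_alg D L) (R_to_quot_alg D L) =
        ereal (real (hdim (bimod_hom D d (arc_space D))) - real (hdim (bimod_hom D d L))
          + real (pdim (L \<inter> commutator_space D)))"
    by (intro exI[of _ d]) simp
qed

end
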